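(* Let $D\subseteq\mathbb{C}_\infty$ be a domain, let $\mathcal{F}\subseteq\mathcal{M}(D)$ and let $\epsilon>0$. Suppose that for each $f\in\mathcal{F}$ there exist functions $a_{1f},a_{2f},a_{3f}\in\mathcal{M}(D)\cup\{\infty\}$ such that (i) $\sigma(a_{jf}(z),a_{kf}(z))\geq\epsilon$ for all $j\neq k$ in $\{1,2,3\}$ and all $z\in D$; (ii) each zero of $f-a_{1f}$ has multiplicity at least four; (iii) each zero of $f-a_{jf}$, $j=2,3$, has multiplicity at least three. Then $\mathcal{F}$ is normal in $D$.
   Context: $\mathbb{C}_\infty=\mathbb{C}\cup\{\infty\}$ is the Riemann sphere and $\sigma$ is the spherical metric on it (great-circle distance on the unit sphere, so the diameter is $\pi$). $\mathcal{M}(D)$ is the class of all meromorphic functions on the domain $D$, regarded as maps into $\mathbb{C}_\infty$, and $\mathcal{M}(D)\cup\{\infty\}$ also includes the function identically equal to $\infty$. A family $\mathcal{F}\subseteq\mathcal{M}(D)$ is normal on $D$ if every sequence in $\mathcal{F}$ has a subsequence converging locally uniformly on $D$ with respect to $\sigma$ to a limit function which is either meromorphic on $D$ or identically $\infty$. For $f\in\mathcal{M}(D)$ and $a\in\mathcal{M}(D)\cup\{\infty\}$, a zero of $f-a$ means a point $z_0\in D$ with $f(z_0)=a(z_0)$ in $\mathbb{C}_\infty$; its multiplicity is the order of vanishing at $z_0$ of $f-a$ if the common value is finite, and of $\frac1f-\frac1a$ if the common value is $\infty$ (with $\frac1a\equiv 0$ when $a\equiv\infty$); the multiplicity is $\infty$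 if $f\equiv a$. *)

theory Defs
  imports "HOL-Complex_Analysis.Complex_Analysis" "HOL-Library.Extended_Nat"
begin

text \<open>
  The Riemann sphere is the one-point compactification of the complex plane, with
  \<open>None\<close> as the point at infinity.  Functions on a domain \<open>D\<close> of the sphere are total
  functions whose values outside \<open>D\<close> are irrelevant.
\<close>

type_synonym riemann_sphere = "complex option"

abbreviation sphere_top :: "riemann_sphere topology" where
  "sphere_top \<equiv> Alexandroff_compactification euclidean"

definition sphere_domain :: "riemann_sphere set \<Rightarrow> bool" where
  "sphere_domain D \<longleftrightarrow> D \<noteq> {} \<and> openin sphere_top D \<and> connectedin sphere_top D"

text \<open>
  Inverse of the stereographic projection from the north pole of the unit sphere
  in \<open>\<complex> \<times> \<real>\<close> (that is, three-dimensional Euclidean space).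
\<close>

fun stereo :: "riemann_sphere \<Rightarrow> complex \<times> real" where
  "stereo None = (0, 1)"
| "stereo (Some z) =
     ((2 / (1 + (cmod z)\<^sup>2)) *\<^sub>R z, ((cmod z)\<^sup>2 - 1) / ((cmod z)\<^sup>2 + 1))"

text \<open>The great-circle distance is the angle between the corresponding unit vectors.\<close>

definition sph_dist :: "riemann_sphere \<Rightarrow> riemann_sphere \<Rightarrow> real" where
  "sph_dist p q = arccos (stereo p \<bullet> stereo q)"

fun sph_inverse :: "riemann_sphere \<Rightarrow> riemann_sphere" where
  "sph_inverse None = Some 0"
| "sph_inverse (Some z) = (if z = 0 then None else Some (1 / z))"

text \<open>Junk value \<open>0\<close> at infinity, the convention for poles in \<^const>\<open>nicely_meromorphic_on\<close>.\<close>

fun finite_part :: "riemann_sphere \<Rightarrow> complex" where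
  "finite_part None = 0"
| "finite_part (Some z) = z"

text \<open>Local parametrization of the sphere that maps \<open>0\<close> to the given point.\<close>

fun sph_chart :: "riemann_sphere \<Rightarrow> complex \<Rightarrow> riemann_sphere" where
  "sph_chart (Some z) w = Some (z + w)"
| "sph_chart None w = sph_inverse (Some w)"

text \<open>
  Near each point of \<open>D\<close>, \<open>f\<close> is an ordinary meromorphic function of the local
  coordinate, with the value infinity exactly at its poles.  This excludes the function
  that is identically infinity: its finite part is zero and has no poles.
\<close>

definition meromorphic_fns :: "riemann_sphere set \<Rightarrow> (riemann_sphere \<Rightarrow> riemann_sphere) set" where
  "meromorphic_fns D = {f. \<forall>p\<in>D.
     (\<lambda>w. finite_part (f (sph_chart p w))) nicely_meromorphic_on {0} \<and>
     (f p = None \<longleftrightarrow> is_pole (\<lambda>w. finite_part (f (sph_chart p w))) 0)}"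

definition infinity_fns :: "riemann_sphere set \<Rightarrow> (riemann_sphere \<Rightarrow> riemann_sphere) set" where
  "infinity_fns D = {f. \<forall>p\<in>D. f p = None}"

text \<open>
  Multiplicity of a zero \<open>p\<close> of \<open>f - a\<close>, that is, of a point of \<open>D\<close> with
  \<open>f p = a p\<close>; the value is meaningful only for such \<open>p\<close>.
\<close>

definition zero_multiplicity ::
  "riemann_sphere set \<Rightarrow> (riemann_sphere \<Rightarrow> riemann_sphere) \<Rightarrow>
   (riemann_sphere \<Rightarrow> riemann_sphere) \<Rightarrow> riemann_sphere \<Rightarrow> enat" where
  "zero_multiplicity D f a p =
    (if \<forall>q\<in>D. f q = a q then \<infinity>
     else if f p \<noteq> None then
       enat (nat (zorder (\<lambda>w. finite_part (f (sph_chart p w))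
                            - finite_part (a (sph_chart p w))) 0))
     else
       enat (nat (zorder (\<lambda>w. finite_part (sph_inverse (f (sph_chart p w)))
                            - finite_part (sph_inverse (a (sph_chart p w)))) 0)))"

definition locally_uniform_limit ::
  "riemann_sphere set \<Rightarrow> (nat \<Rightarrow> riemann_sphere \<Rightarrow> riemann_sphere) \<Rightarrow>
   (riemann_sphere \<Rightarrow> riemann_sphere) \<Rightarrow> bool" where
  "locally_uniform_limit D s g \<longleftrightarrow>
    (\<forall>p\<in>D. \<exists>U. openin sphere_top U \<and> p \<in> U \<and> U \<subseteq> D \<and>
       (\<forall>e>0. \<exists>N. \<forall>n\<ge>N. \<forall>q\<in>U. sph_dist (s n q) (g q) < e))"

definition normal_family ::
  "riemann_sphere set \<Rightarrow> (riemann_sphere \<Rightarrow> riemann_sphere) set \<Rightarrow> bool" where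
  "normal_family D F \<longleftrightarrow>
    (\<forall>s :: nat \<Rightarrow> riemann_sphere \<Rightarrow> riemann_sphere. range s \<subseteq> F \<longrightarrow>
      (\<exists>r g. strict_mono r \<and> g \<in> meromorphic_fns D \<union> infinity_fns D \<and>
             locally_uniform_limit D (s \<circ> r) g))"

end

theory Submission
  imports Defs
begin

text \<open>
  Because \<open>1/4 + 1/3 + 1/3 < 1\<close>, the sphere with three cone points of orders 4, 3 and 3 is
  hyperbolic.  A function that meets its three targets only with multiplicities at least 4, 3 and 3
  pulls a negatively curved metric of this orbifold back to a metric without singularities, so the
  Ahlfors lemma bounds its spherical derivative in terms of the domain and of \<open>\<epsilon>\<close> alone.  The family
  is therefore equicontinuous, and the Arzela-Ascoli argument makes it normal.

  The metric is explicit.  Write \<open>f = [P : Q]\<close> and \<open>a\<^sub>j = [p\<^sub>j : q\<^sub>j]\<close> locally in homogeneous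
  coordinates, let \<open>[f, a\<^sub>j] = P q\<^sub>j - Q p\<^sub>j\<close>, and put
  \<open>X\<^sub>1 = [f, a\<^sub>1] [a\<^sub>2, a\<^sub>3]\<close>, \<open>X\<^sub>2 = [f, a\<^sub>2] [a\<^sub>3, a\<^sub>1]\<close>, \<open>X\<^sub>3 = [f, a\<^sub>3] [a\<^sub>1, a\<^sub>2]\<close>.
  Then \<open>X\<^sub>1 + X\<^sub>2 + X\<^sub>3 = 0\<close>, the ratios of the \<open>X\<^sub>j\<close> are the cross ratio of \<open>f\<close> with its targets,
  and a zero of \<open>f - a\<^sub>j\<close>, finite or infinite, is a zero of \<open>X\<^sub>j\<close> of the same order.  With the
  Wronskian \<open>W = X\<^sub>1' X\<^sub>2 - X\<^sub>1 X\<^sub>2'\<close>, \<open>y\<^sub>j = |X\<^sub>j|\<close> to the power \<open>1/2\<close>, and \<open>S = y\<^sub>1 + y\<^sub>2 + y\<^sub>3\<close>,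
  the density is \<open>\<rho>\<close> with
      \<open>\<rho> ^ 13 = |W| ^ 13 S / (y\<^sub>1 ^ 19 y\<^sub>2 ^ 17 y\<^sub>3 ^ 17)\<close>.
  The powers of \<open>|X\<^sub>1|\<close>, \<open>|X\<^sub>2|\<close>, \<open>|X\<^sub>3|\<close> in \<open>1 / \<rho>\<close> are \<open>19/26 < 3/4\<close>, \<open>17/26 < 2/3\<close> and
  \<open>17/26 < 2/3\<close>, which makes \<open>\<rho>\<close> vanish at the zeros of the \<open>X\<^sub>j\<close>.  Their sum \<open>53/26\<close> exceeds 2, so that
  homogeneity of degree 0 calls for a positive power of \<open>S\<close>, and the Laplacian of \<open>log S\<close>
  supplies the negative curvature.  This is \<open>ahlfors_bound_433\<close>, whose analytic core is
  \<open>laplacian_at_max\<close>.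

  The targets move with \<open>f\<close> and are not bounded, but two targets at spherical distance at least
  \<open>\<epsilon>\<close> define the projection of the plane \<open>\<complex> \<times> \<complex>\<close> onto the line \<open>a\<^sub>j\<close> along the line \<open>a\<^sub>k\<close>.  Its matrix entries
  are holomorphic and bounded in terms of \<open>\<epsilon>\<close>, and Cauchy estimates for them give homogeneous
  coordinates of \<open>a\<^sub>j\<close> that are bounded, together with their derivatives, on a smaller disc of
  definite size (\<open>separated_bounded_lift\<close>).  With these, the bound on \<open>W\<close> becomes a bound on the
  spherical derivative of \<open>f\<close> (\<open>spherical_derivative_bound\<close>).
\<close>

section \<open>The Laplacian at a maximum point\<close>

lemma second_derivative_nonpos_at_max:
  fixes u u' :: "real \<Rightarrow> real"
  assumes d: "d > 0"
    and u: "\<And>t. \<bar>t\<bar> < d \<Longrightarrow> (u has_real_derivative u' t) (at t)"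
    and u': "(u' has_real_derivative L) (at 0)"
    and max: "\<And>t. \<bar>t\<bar> < d \<Longrightarrow> u t \<le> u 0"
  shows "L \<le> 0"
proof (rule ccontr)
  assume "\<not> L \<le> 0"
  then have "L > 0" by simp
  have u'0: "u' 0 = 0"
    using DERIV_local_max[OF u[of 0] d] d max by auto
  obtain e where e: "e > 0" "\<And>h. 0 < h \<Longrightarrow> h < e \<Longrightarrow> u' 0 < u' (0 + h)"
    using DERIV_pos_inc_right[OF u' \<open>L > 0\<close>] by auto
  define b where "b = min d e / 2"
  have b: "0 < b" "b < d" "b < e" using d e by (auto simp: b_def)
  have "u 0 < u b"
  proof (rule DERIV_pos_imp_increasing_open[OF b(1)])
    fix x assume "0 < x" "x < b"
    then show "\<exists>y. (u has_real_derivative y) (at x) \<and> 0 < y"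
      using u[of x] e(2)[of x] b u'0 by auto
  next
    have "(u has_real_derivative u' x) (at x)" if "x \<in> {0..b}" for x
      using that b u[of x] by auto
    then show "continuous_on {0..b} u"
      by (intro DERIV_atLeastAtMost_imp_continuous_on) auto
  qed
  with max[of b] b show False by auto
qed

lemma line_deriv:
  assumes "(f has_field_derivative f') (at (z + of_real t * e))"
  shows "((\<lambda>t. f (z + of_real t * e)) has_vector_derivative f' * e) (at t)"
proof -
  have *: "((\<lambda>t. z + of_real t * e) has_vector_derivative e) (at t)"
    by (auto intro!: derivative_eq_intros)
  from field_vector_diff_chain_at[OF * assms] show ?thesis
    by (simp add: o_def mult.commute)
qed

lemma line_deriv_Re:
  assumes "(f has_field_derivative f') (at (z + of_real t * e))"
  shows "((\<lambda>t. Re (f (z + of_real t * e))) has_real_derivative Re (f' * e)) (at t)"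
  using bounded_linear.has_vector_derivative[OF bounded_linear_Re line_deriv[OF assms]]
  by (simp add: has_real_derivative_iff_has_vector_derivative)

lemma line_deriv_Im:
  assumes "(f has_field_derivative f') (at (z + of_real t * e))"
  shows "((\<lambda>t. Im (f (z + of_real t * e))) has_real_derivative Im (f' * e)) (at t)"
  using bounded_linear.has_vector_derivative[OF bounded_linear_Im line_deriv[OF assms]]
  by (simp add: has_real_derivative_iff_has_vector_derivative)

lemma line_deriv_cmod_sq:
  assumes "(f has_field_derivative f') (at (z + of_real t * e))"
  shows "((\<lambda>t. (cmod (f (z + of_real t * e)))\<^sup>2) has_real_derivative
           2 * Re (cnj (f (z + of_real t * e)) * (f' * e))) (at t)"
  unfolding cmod_power2
  by (rule derivative_eq_intros line_deriv_Re[OF assms] line_deriv_Im[OF assms] refl)+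
     (simp add: algebra_simps)

lemma line_deriv_cmod_sq_second:
  assumes "(f has_field_derivative f' z) (at z)" "(f' has_field_derivative f'') (at z)"
  shows "((\<lambda>t. 2 * Re (cnj (f (z + of_real t * e)) * (f' (z + of_real t * e) * e))) has_real_derivative
           2 * (cmod (f' z * e))\<^sup>2 + 2 * Re (cnj (f z) * f'' * e\<^sup>2)) (at 0)"
proof -
  define p q p' q' where "p t = Re (f (z + of_real t * e))" and "q t = Im (f (z + of_real t * e))"
    and "p' t = Re (f' (z + of_real t * e) * e)" and "q' t = Im (f' (z + of_real t * e) * e)" for t :: real
  have 0: "(f has_field_derivative f' z) (at (z + of_real 0 * e))"
    and 1: "((\<lambda>w. f' w * e) has_field_derivative f'' * e) (at (z + of_real 0 * e))"
    using assms by (auto intro!: derivative_eq_intros)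
  have d: "(p has_real_derivative p' 0) (at 0)" "(q has_real_derivative q' 0) (at 0)"
    "(p' has_real_derivative Re (f'' * e * e)) (at 0)" "(q' has_real_derivative Im (f'' * e * e)) (at 0)"
    unfolding p_def q_def p'_def q'_def
    using line_deriv_Re[OF 0] line_deriv_Im[OF 0] line_deriv_Re[OF 1] line_deriv_Im[OF 1] by auto
  have "((\<lambda>t. 2 * (p t * p' t + q t * q' t)) has_real_derivative
      2 * ((p' 0 * p' 0 + Re (f'' * e * e) * p 0) + (q' 0 * q' 0 + Im (f'' * e * e) * q 0))) (at 0)"
    by (intro DERIV_cmult DERIV_add DERIV_mult d)
  moreover have "2 * ((p' 0 * p' 0 + Re (f'' * e * e) * p 0) + (q' 0 * q' 0 + Im (f'' * e * e) * q 0))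
     = 2 * (cmod (f' z * e))\<^sup>2 + 2 * Re (cnj (f z) * f'' * e\<^sup>2)"
    unfolding cmod_power2 p_def q_def p'_def q'_def
    by (simp add: power2_eq_square algebra_simps)
  moreover have "(\<lambda>t. 2 * Re (cnj (f (z + of_real t * e)) * (f' (z + of_real t * e) * e)))
     = (\<lambda>t. 2 * (p t * p' t + q t * q' t))"
    by (simp add: p_def q_def p'_def q'_def)
  ultimately show ?thesis by metis
qed

lemma lagrange_identity3:
  fixes a1 a2 a3 b1 b2 b3 :: complex
  shows "((cmod b1)\<^sup>2 + (cmod b2)\<^sup>2 + (cmod b3)\<^sup>2) * ((cmod a1)\<^sup>2 + (cmod a2)\<^sup>2 + (cmod a3)\<^sup>2)
     - (cmod (cnj a1 * b1 + cnj a2 * b2 + cnj a3 * b3))\<^sup>2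
     = (cmod (a1 * b2 - a2 * b1))\<^sup>2 + (cmod (a1 * b3 - a3 * b1))\<^sup>2 + (cmod (a2 * b3 - a3 * b2))\<^sup>2"
  unfolding cmod_power2 by (simp add: algebra_simps power2_eq_square)

text \<open>
  At a maximum the Laplacian of the function is nonpositive, and here it can be evaluated:
  the harmonic term \<open>Re H\<close> drops out, \<open>log (|Z\<^sub>1|\<^sup>2 + |Z\<^sub>2|\<^sup>2 + |Z\<^sub>3|\<^sup>2)\<close> contributes four times the sum of
  the squared moduli of the Wronskians divided by the square of its argument, and \<open>log (R\<^sup>2 - |z|\<^sup>2)\<close>
  contributes \<open>- 4 R\<^sup>2 / (R\<^sup>2 - |z|\<^sup>2)\<^sup>2\<close>, minus the square of the hyperbolic density of the disc.
\<close>

lemma laplacian_at_max: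
  fixes H Z1 Z2 Z3 :: "complex \<Rightarrow> complex"
  assumes S: "open S" "z0 \<in> S"
    and hol: "H holomorphic_on S" "Z1 holomorphic_on S" "Z2 holomorphic_on S" "Z3 holomorphic_on S"
    and pos: "\<And>z. z \<in> S \<Longrightarrow> (cmod (Z1 z))\<^sup>2 + (cmod (Z2 z))\<^sup>2 + (cmod (Z3 z))\<^sup>2 > 0"
    and R: "\<And>z. z \<in> S \<Longrightarrow> (cmod z)\<^sup>2 < R\<^sup>2"
    and max: "\<And>z. z \<in> S \<Longrightarrow>
      Re (H z) + c * ln ((cmod (Z1 z))\<^sup>2 + (cmod (Z2 z))\<^sup>2 + (cmod (Z3 z))\<^sup>2) + ln (R\<^sup>2 - (cmod z)\<^sup>2)
      \<le> Re (H z0) + c * ln ((cmod (Z1 z0))\<^sup>2 + (cmod (Z2 z0))\<^sup>2 + (cmod (Z3 z0))\<^sup>2) + ln (R\<^sup>2 - (cmod z0)\<^sup>2)"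
  shows "c * ((cmod (Z1 z0 * deriv Z2 z0 - Z2 z0 * deriv Z1 z0))\<^sup>2
            + (cmod (Z1 z0 * deriv Z3 z0 - Z3 z0 * deriv Z1 z0))\<^sup>2
            + (cmod (Z2 z0 * deriv Z3 z0 - Z3 z0 * deriv Z2 z0))\<^sup>2)
          / ((cmod (Z1 z0))\<^sup>2 + (cmod (Z2 z0))\<^sup>2 + (cmod (Z3 z0))\<^sup>2)\<^sup>2
         \<le> R\<^sup>2 / (R\<^sup>2 - (cmod z0)\<^sup>2)\<^sup>2"
proof -
  obtain r where r: "r > 0" "ball z0 r \<subseteq> S" using S openE by blast
  define N where "N z = (cmod (Z1 z))\<^sup>2 + (cmod (Z2 z))\<^sup>2 + (cmod (Z3 z))\<^sup>2" for z
  define G where "G z = R\<^sup>2 - (cmod z)\<^sup>2" for z :: complex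
  define N1 where "N1 e z = 2 * Re (cnj (Z1 z) * (deriv Z1 z * e)) + 2 * Re (cnj (Z2 z) * (deriv Z2 z * e)) + 2 * Re (cnj (Z3 z) * (deriv Z3 z * e))" for e z
  define G1 where "G1 e z = - 2 * Re (cnj z * (1 * e))" for e z :: complex
  have N0: "N z0 > 0" and G0: "G z0 > 0" using pos[OF S(2)] R[OF S(2)] by (auto simp: N_def G_def)
  define N2 where "N2 e = (2 * (cmod (deriv Z1 z0 * e))\<^sup>2 + 2 * Re (cnj (Z1 z0) * deriv (deriv Z1) z0 * e\<^sup>2))
    + (2 * (cmod (deriv Z2 z0 * e))\<^sup>2 + 2 * Re (cnj (Z2 z0) * deriv (deriv Z2) z0 * e\<^sup>2))
    + (2 * (cmod (deriv Z3 z0 * e))\<^sup>2 + 2 * Re (cnj (Z3 z0) * deriv (deriv Z3) z0 * e\<^sup>2))" for e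
  define G2 where "G2 e = - (2 * (cmod (1 * e))\<^sup>2 + 2 * Re (cnj z0 * 0 * e\<^sup>2))" for e :: complex
  have dh: "(f has_field_derivative deriv f z) (at z)" if "z \<in> S" "f holomorphic_on S" for f z
    using that S holomorphic_derivI by blast
  have key: "Re (deriv (deriv H) z0 * e\<^sup>2)
      + c * ((N2 e * N z0 - N1 e z0 * N1 e z0) / (N z0 * N z0))
      + (G2 e * G z0 - G1 e z0 * G1 e z0) / (G z0 * G z0) \<le> 0"
    if e: "cmod e = 1" for e
  proof (rule second_derivative_nonpos_at_max[OF r(1)])
    let ?l = "\<lambda>t. z0 + of_real t * e"
    fix t :: real assume t: "\<bar>t\<bar> < r"
    have lS: "?l t \<in> S" using t r e by (auto simp: subset_iff dist_norm norm_mult)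
    have NG: "N (?l t) > 0" "G (?l t) > 0" using pos[OF lS] R[OF lS] by (auto simp: N_def G_def)
    have dN: "((\<lambda>t. N (?l t)) has_real_derivative N1 e (?l t)) (at t)"
      unfolding N_def N1_def by (intro derivative_intros line_deriv_cmod_sq dh lS hol)
    have "((\<lambda>t. G (?l t)) has_real_derivative 0 - 2 * Re (cnj (?l t) * (1 * e))) (at t)"
      unfolding G_def by (intro derivative_intros line_deriv_cmod_sq[where f="\<lambda>z. z"])
    then have dG: "((\<lambda>t. G (?l t)) has_real_derivative G1 e (?l t)) (at t)"
      by (simp add: G1_def)
    show "((\<lambda>t. Re (H (?l t)) + c * ln (N (?l t)) + ln (G (?l t))) has_real_derivative
       Re (deriv H (?l t) * e) + c * (N1 e (?l t) / N (?l t)) + G1 e (?l t) / G (?l t)) (at t)"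
    proof (intro DERIV_add DERIV_cmult)
      show "((\<lambda>t. Re (H (?l t))) has_real_derivative Re (deriv H (?l t) * e)) (at t)"
        by (rule line_deriv_Re[OF dh[OF lS hol(1)]])
      show "((\<lambda>t. ln (N (?l t))) has_real_derivative N1 e (?l t) / N (?l t)) (at t)"
        using DERIV_chain2[OF DERIV_ln_divide[OF NG(1)] dN] by simp
      show "((\<lambda>t. ln (G (?l t))) has_real_derivative G1 e (?l t) / G (?l t)) (at t)"
        using DERIV_chain2[OF DERIV_ln_divide[OF NG(2)] dG] by simp
    qed
    show "Re (H (?l t)) + c * ln (N (?l t)) + ln (G (?l t)) \<le> Re (H (?l 0)) + c * ln (N (?l 0)) + ln (G (?l 0))"
      using max[OF lS] by (simp add: N_def G_def)
  next
    let ?l = "\<lambda>t. z0 + of_real t * e"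
    have hol': "deriv f holomorphic_on S" if "f holomorphic_on S" for f
      using that S by (intro holomorphic_deriv)
    have l0: "?l 0 \<in> S" using S by simp
    have "((\<lambda>t. N (?l t)) has_real_derivative N1 e (?l 0)) (at 0)"
      unfolding N_def N1_def by (intro derivative_intros line_deriv_cmod_sq dh l0 hol)
    then have dN: "((\<lambda>t. N (?l t)) has_real_derivative N1 e z0) (at 0)" by simp
    have dN1: "((\<lambda>t. N1 e (?l t)) has_real_derivative N2 e) (at 0)"
      unfolding N1_def N2_def
      by (intro derivative_intros line_deriv_cmod_sq_second dh S hol hol')
    have "((\<lambda>t. G (?l t)) has_real_derivative 0 - 2 * Re (cnj (?l 0) * (1 * e))) (at 0)"
      unfolding G_def by (intro derivative_intros line_deriv_cmod_sq[where f="\<lambda>z. z"])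
    then have dG: "((\<lambda>t. G (?l t)) has_real_derivative G1 e z0) (at 0)"
      by (simp add: G1_def)
    have "((\<lambda>t. - (2 * Re (cnj (?l t) * (1 * e)))) has_real_derivative G2 e) (at 0)"
      unfolding G2_def
      by (intro DERIV_minus line_deriv_cmod_sq_second[where f="\<lambda>z. z" and f'="\<lambda>_. 1"] derivative_intros)
    then have dG1: "((\<lambda>t. G1 e (?l t)) has_real_derivative G2 e) (at 0)"
      by (simp add: G1_def)
    have dH: "((\<lambda>t. Re (deriv H (?l t) * e)) has_real_derivative Re (deriv (deriv H) z0 * e\<^sup>2)) (at 0)"
    proof -
      have "((\<lambda>z. deriv H z * e) has_field_derivative deriv (deriv H) z0 * e) (at (z0 + of_real 0 * e))"
        using dh[OF S(2) hol'[OF hol(1)]] by (auto intro!: derivative_eq_intros)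
      from line_deriv_Re[OF this] show ?thesis by (simp add: power2_eq_square mult.assoc)
    qed
    show "((\<lambda>t. Re (deriv H (?l t) * e) + c * (N1 e (?l t) / N (?l t)) + G1 e (?l t) / G (?l t)) has_real_derivative
      Re (deriv (deriv H) z0 * e\<^sup>2)
      + c * ((N2 e * N z0 - N1 e z0 * N1 e z0) / (N z0 * N z0))
      + (G2 e * G z0 - G1 e z0 * G1 e z0) / (G z0 * G z0)) (at 0)"
    proof (intro DERIV_add DERIV_cmult dH)
      show "((\<lambda>t. N1 e (?l t) / N (?l t)) has_real_derivative (N2 e * N z0 - N1 e z0 * N1 e z0) / (N z0 * N z0)) (at 0)"
        using DERIV_divide[OF dN1 dN] N0 by simp
      show "((\<lambda>t. G1 e (?l t) / G (?l t)) has_real_derivative (G2 e * G z0 - G1 e z0 * G1 e z0) / (G z0 * G z0)) (at 0)"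
        using DERIV_divide[OF dG1 dG] G0 by simp
    qed
  qed
  \<comment> \<open>The Laplacian is the sum of the second derivatives in the directions 1 and \<open>\<i>\<close>. All terms
    containing a second complex derivative carry a factor \<open>e\<^sup>2\<close>, hence cancel because \<open>1\<^sup>2 + \<i>\<^sup>2 = 0\<close>.\<close>
  define B where "B = (cmod (deriv Z1 z0))\<^sup>2 + (cmod (deriv Z2 z0))\<^sup>2 + (cmod (deriv Z3 z0))\<^sup>2"
  define I where "I = cnj (Z1 z0) * deriv Z1 z0 + cnj (Z2 z0) * deriv Z2 z0 + cnj (Z3 z0) * deriv Z3 z0"
  have N2: "N2 1 + N2 \<i> = 4 * B"
    by (simp add: N2_def B_def norm_mult)
  have N1: "N1 e z0 = 2 * Re (I * e)" for e
    by (simp add: N1_def I_def algebra_simps)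
  have N1s: "N1 1 z0 * N1 1 z0 + N1 \<i> z0 * N1 \<i> z0 = 4 * (cmod I)\<^sup>2"
    unfolding N1 cmod_power2 by (simp add: power2_eq_square)
  have G1s: "G1 1 z0 * G1 1 z0 + G1 \<i> z0 * G1 \<i> z0 = 4 * (cmod z0)\<^sup>2"
    unfolding G1_def cmod_power2 by (simp add: power2_eq_square)
  have G2: "G2 1 + G2 \<i> = -4" by (simp add: G2_def)
  have "0 \<ge> (Re (deriv (deriv H) z0 * 1\<^sup>2) + Re (deriv (deriv H) z0 * \<i>\<^sup>2))
      + c * (((N2 1 + N2 \<i>) * N z0 - (N1 1 z0 * N1 1 z0 + N1 \<i> z0 * N1 \<i> z0)) / (N z0 * N z0))
      + ((G2 1 + G2 \<i>) * G z0 - (G1 1 z0 * G1 1 z0 + G1 \<i> z0 * G1 \<i> z0)) / (G z0 * G z0)"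
    using key[of 1] key[of \<i>] by (simp add: algebra_simps add_divide_distrib diff_divide_distrib)
  also have "(Re (deriv (deriv H) z0 * 1\<^sup>2) + Re (deriv (deriv H) z0 * \<i>\<^sup>2)) = 0" by simp
  finally have "0 \<ge> c * ((4 * (B * N z0 - (cmod I)\<^sup>2)) / (N z0 * N z0)) + (-4 * (G z0 + (cmod z0)\<^sup>2)) / (G z0 * G z0)"
    unfolding N2 N1s G1s G2 by (simp add: algebra_simps)
  moreover have "c * ((4 * x) / (n * n)) + (-4 * y) / (g * g) = 4 * (c * x / n\<^sup>2 - y / g\<^sup>2)" for x y n g :: real
    by (simp add: power2_eq_square algebra_simps)
  ultimately have "4 * (c * (B * N z0 - (cmod I)\<^sup>2) / (N z0)\<^sup>2 - (G z0 + (cmod z0)\<^sup>2) / (G z0)\<^sup>2) \<le> 0"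
    by (simp only:)
  moreover have gen: "x \<le> y" if "4 * (x - y) \<le> 0" for x y :: real
    using that by simp
  ultimately have "c * (B * N z0 - (cmod I)\<^sup>2) / (N z0)\<^sup>2 \<le> (G z0 + (cmod z0)\<^sup>2) / (G z0)\<^sup>2"
    by blast
  then show ?thesis
    unfolding B_def N_def I_def lagrange_identity3 G_def by simp
qed

section \<open>An Ahlfors lemma for multiplicities 4, 3, 3\<close>

text \<open>
  A function that is zero near \<open>z\<close> vanishes to every order.  Thus the case that \<open>f\<close> coincides with
  one of its targets is covered together with the others.
\<close>

definition vanishes_to_order :: "nat \<Rightarrow> (complex \<Rightarrow> complex) \<Rightarrow> complex \<Rightarrow> bool" where
  "vanishes_to_order m h z \<longleftrightarrow>
     (\<exists>k. k analytic_on {z} \<and> (\<forall>\<^sub>F w in nhds z. h w = (w - z) ^ m * k w))"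

lemma holomorphic_isCont:
  assumes "f holomorphic_on S" "open S" "z \<in> S"
  shows "isCont f z"
  using assms by (meson analytic_at analytic_at_imp_isCont)

lemma power_mean_cubes:
  fixes a b c :: real
  assumes "a \<ge> 0" "b \<ge> 0" "c \<ge> 0"
  shows "(a + b + c) ^ 3 \<le> 9 * (a ^ 3 + b ^ 3 + c ^ 3)"
proof -
  have "9 * (a ^ 3 + b ^ 3 + c ^ 3) - (a + b + c) ^ 3
     = 3 * ((a + b) * (a - b)\<^sup>2 + (b + c) * (b - c)\<^sup>2 + (a + c) * (a - c)\<^sup>2)
       + (a + b + c) * ((a - b)\<^sup>2 + (b - c)\<^sup>2 + (a - c)\<^sup>2)"
    by (simp add: algebra_simps power2_eq_square power3_eq_cube)
  also have "\<dots> \<ge> 0" using assms by simp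
  finally show ?thesis by simp
qed

text \<open>
  If \<open>X\<close> has a zero of order \<open>n \<ge> m\<close>, then the Wronskian has a zero of order at least \<open>n - 1\<close>, and the
  quotient is of order at least \<open>26 (n - 1) - e n\<close>, which is positive.  Its limit at the zero is
  therefore 0, which is also the value that division by zero assigns to it there.
\<close>

lemma wronskian_quotient_continuous:
  fixes X Y :: "complex \<Rightarrow> complex"
  assumes S: "open S" "connected S" "z0 \<in> S" and hol: "X holomorphic_on S" "Y holomorphic_on S"
    and nz: "z1 \<in> S" "X z1 \<noteq> 0" and X0: "X z0 = 0"
    and m: "vanishes_to_order m X z0" "e < 26" "26 < (26 - e) * m" "e > 0"
  shows "isCont (\<lambda>z. cmod (deriv X z * Y z - X z * deriv Y z) ^ 26 / cmod (X z) ^ e) z0"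
    and "deriv X z0 * Y z0 - X z0 * deriv Y z0 = 0"
proof -
  define n where "n = nat (zorder X z0)"
  obtain r g where r: "r > 0" "cball z0 r \<subseteq> S" and g: "g holomorphic_on cball z0 r"
    and Xg: "\<And>w. w \<in> cball z0 r \<Longrightarrow> X w = g w * (w - z0) ^ n \<and> g w \<noteq> 0" and n0: "n > 0"
  proof -
    have *: "\<exists>w\<in>S. X w \<noteq> 0" using nz by blast
    from zorder_exist_zero[OF hol(1) S(1-3) *] X0 obtain r where "r > 0" "cball z0 r \<subseteq> S"
      "zor_poly X z0 holomorphic_on cball z0 r" "zorder X z0 > 0"
      "\<forall>w\<in>cball z0 r. X w = zor_poly X z0 w * (w - z0) ^ n \<and> zor_poly X z0 w \<noteq> 0"
      unfolding n_def by auto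
    then show ?thesis using that[of r "zor_poly X z0"] by (simp add: n_def)
  qed
  define B where "B = ball z0 r"
  have B: "open B" "z0 \<in> B" "B \<subseteq> cball z0 r" "B \<subseteq> S" using r by (auto simp: B_def)
  have gB: "g holomorphic_on B" using g B(3) holomorphic_on_subset by blast
  have mn: "m \<le> n"
  proof (rule ccontr)
    assume "\<not> m \<le> n"
    then obtain j where j: "m = n + Suc j" by (metis add_Suc_right less_imp_Suc_add not_le)
    obtain k where k: "k analytic_on {z0}" "\<forall>\<^sub>F w in nhds z0. X w = (w - z0) ^ m * k w"
      using m(1) by (auto simp: vanishes_to_order_def)
    have "\<forall>\<^sub>F w in nhds z0. w \<in> B" using B eventually_nhds_in_open by blast
    with k(2) have "\<forall>\<^sub>F w in nhds z0. w \<in> B \<and> X w = (w - z0) ^ m * k w"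
      using eventually_conj by blast
    then have "\<forall>\<^sub>F w in at z0. w \<in> B \<and> X w = (w - z0) ^ m * k w \<and> w \<noteq> z0"
      unfolding eventually_at_filter by (auto elim: eventually_mono)
    then have ev: "\<forall>\<^sub>F w in at z0. g w = (w - z0) * (w - z0) ^ j * k w"
    proof (rule eventually_mono)
      fix w assume w: "w \<in> B \<and> X w = (w - z0) ^ m * k w \<and> w \<noteq> z0"
      then have "g w * (w - z0) ^ n = (w - z0) ^ n * ((w - z0) * (w - z0) ^ j * k w)"
        using Xg[of w] B(3) by (auto simp: j power_add mult.assoc)
      then show "g w = (w - z0) * (w - z0) ^ j * k w" using w by simp
    qed
    have "isCont k z0" using k(1) analytic_at_imp_isCont by blast
    then have "isCont (\<lambda>w. (w - z0) * (w - z0) ^ j * k w) z0" by (intro continuous_intros)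
    then have "((\<lambda>w. (w - z0) * (w - z0) ^ j * k w) \<longlongrightarrow> 0) (at z0)" by (simp add: isCont_def)
    with ev have "(g \<longlongrightarrow> 0) (at z0)" by (simp add: tendsto_cong)
    moreover have "(g \<longlongrightarrow> g z0) (at z0)"
      using holomorphic_isCont[OF gB B(1,2)] by (simp add: isCont_def)
    ultimately have "g z0 = 0" using tendsto_unique at_neq_bot by blast
    with Xg[of z0] r show False by simp
  qed
  obtain n' where n': "n = Suc n'" using n0 by (cases n) auto
  define l where "l w = (of_nat n * g w + (w - z0) * deriv g w) * Y w - (w - z0) * g w * deriv Y w" for w
  have dX: "deriv X w = (w - z0) ^ n' * (of_nat n * g w + (w - z0) * deriv g w)" if w: "w \<in> B" for w
  proof -
    have "((\<lambda>w. g w * (w - z0) ^ n) has_field_derivative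
        deriv g w * (w - z0) ^ n + of_nat n * (w - z0) ^ n' * g w) (at w)"
    proof -
      have "((\<lambda>w. w - z0) has_field_derivative 1) (at w)"
        by (auto intro!: derivative_eq_intros)
      from DERIV_power[OF this, of n]
      have "((\<lambda>w. (w - z0) ^ n) has_field_derivative of_nat n * (w - z0) ^ n') (at w)"
        by (simp add: n' del: of_nat_Suc)
      from DERIV_mult[OF holomorphic_derivI[OF gB B(1) w] this] show ?thesis .
    qed
    then have "(X has_field_derivative
        deriv g w * (w - z0) ^ n + of_nat n * (w - z0) ^ n' * g w) (at w)"
      by (rule has_field_derivative_transform_within_open[OF _ B(1) w]) (use Xg B in auto)
    from DERIV_imp_deriv[OF this] show ?thesis by (simp add: n' algebra_simps)
  qed
  have V: "deriv X w * Y w - X w * deriv Y w = (w - z0) ^ n' * l w" if "w \<in> B" for w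
  proof -
    have Xw: "X w = (w - z0) ^ n' * ((w - z0) * g w)" using Xg[of w] B that by (auto simp: n')
    show ?thesis unfolding dX[OF that] l_def Xw by (simp add: algebra_simps)
  qed
  have "26 + e * n < 26 * n"
  proof -
    have "(26 - e) * m \<le> (26 - e) * n" using mn by simp
    with m(3) have "26 < (26 - e) * n" by linarith
    then show ?thesis using m(2) by (simp add: diff_mult_distrib)
  qed
  then obtain j where j: "26 * n' = e * n + Suc j"
    unfolding n' by (metis add.commute add_less_cancel_left less_imp_Suc_add mult_Suc_right add_Suc_right)
  have eq: "cmod (deriv X w * Y w - X w * deriv Y w) ^ 26 / cmod (X w) ^ e
      = cmod (w - z0) ^ Suc j * (cmod (l w) ^ 26 / cmod (g w) ^ e)" if w: "w \<in> B" for w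
  proof (cases "w = z0")
    case True
    then show ?thesis using V[OF w] X0 m(4) by simp
  next
    case False
    have "cmod (deriv X w * Y w - X w * deriv Y w) ^ 26 = cmod (w - z0) ^ (e * n) * (cmod (w - z0) ^ Suc j * cmod (l w) ^ 26)"
      unfolding V[OF w]
      by (simp only: norm_mult norm_power power_mult_distrib power_mult[symmetric] mult.commute[of n' 26] j power_add mult.assoc)
    moreover have "cmod (X w) ^ e = cmod (g w) ^ e * cmod (w - z0) ^ (e * n)"
      using Xg[of w] w B by (auto simp: norm_mult norm_power power_mult_distrib power_mult[symmetric] mult.commute)
    ultimately show ?thesis using False by simp
  qed
  have cont: "isCont g z0" "isCont (deriv g) z0" "isCont Y z0" "isCont (deriv Y) z0"
    using gB hol B S holomorphic_deriv[OF gB B(1)] holomorphic_deriv[OF hol(2) S(1)]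
    by (blast intro: holomorphic_isCont)+
  have "isCont (\<lambda>w. cmod (w - z0) ^ Suc j * (cmod (l w) ^ 26 / cmod (g w) ^ e)) z0"
    unfolding l_def using cont Xg[of z0] r by (intro continuous_intros) auto
  moreover have "\<forall>\<^sub>F w in nhds z0. cmod (w - z0) ^ Suc j * (cmod (l w) ^ 26 / cmod (g w) ^ e)
     = cmod (deriv X w * Y w - X w * deriv Y w) ^ 26 / cmod (X w) ^ e"
    using eventually_nhds_in_open[OF B(1,2)] by eventually_elim (simp add: eq)
  ultimately show "isCont (\<lambda>z. cmod (deriv X z * Y z - X z * deriv Y z) ^ 26 / cmod (X z) ^ e) z0"
    using isCont_cong by fastforce
  have "n' > 0" using j by (cases n') auto
  then show "deriv X z0 * Y z0 - X z0 * deriv Y z0 = 0" using V[OF B(2)] by simp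
qed

text \<open>
  Here \<open>w = |W|\<close>, and the hypothesis is what \<open>laplacian_at_max\<close> says about the density at a maximum
  point.  The left-hand side of the conclusion is the power 26 of \<open>G \<rho>\<close>.  Multiplying
  numerator and denominator by \<open>y\<^sub>1 y\<^sub>2 ^ 5 y\<^sub>3 ^ 5\<close> completes the denominator to
  \<open>(y\<^sub>1 y\<^sub>2 y\<^sub>3) ^ 39\<close>, and the eleven new factors of the numerator are at most \<open>S\<close> each; this turns it
  into the power 13 of \<open>G\<^sup>2 w\<^sup>2 S / (y\<^sub>1 y\<^sub>2 y\<^sub>3) ^ 3\<close>.  The power mean inequality bounds this expression
  by the hypothesis, with the constant \<open>9 * 208 = 1872\<close>.
\<close>

lemma curvature_bound_imp_density_bound:
  fixes w y1 y2 y3 G R :: real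
  assumes y: "y1 > 0" "y2 > 0" "y3 > 0" and w: "w \<ge> 0" and G: "G > 0" 
    and curv: "1/13 * (w\<^sup>2 / (16 * (y1 * y2) ^ 3) + w\<^sup>2 / (16 * (y1 * y3) ^ 3) + w\<^sup>2 / (16 * (y2 * y3) ^ 3))
        / (y1 + y2 + y3)\<^sup>2 \<le> R\<^sup>2 / G\<^sup>2"
  shows "G ^ 26 * w ^ 26 * (y1 + y2 + y3)\<^sup>2 / (y1 ^ 38 * y2 ^ 34 * y3 ^ 34) \<le> (1872 * R\<^sup>2) ^ 13"
proof -
  define s where "s = y1 + y2 + y3"
  define P where "P = (y1 * y2 * y3) ^ 3"
  define Q where "Q = y1 ^ 3 + y2 ^ 3 + y3 ^ 3"
  have s: "s > 0" "y1 \<le> s" "y2 \<le> s" "y3 \<le> s" using y by (auto simp: s_def)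
  have P: "P > 0" using y by (simp add: P_def)
  have "w\<^sup>2 / (16 * (y1 * y2) ^ 3) + w\<^sup>2 / (16 * (y1 * y3) ^ 3) + w\<^sup>2 / (16 * (y2 * y3) ^ 3) = w\<^sup>2 * Q / (16 * P)"
    using y by (simp add: Q_def P_def field_simps power_mult_distrib)
  with curv have "1/13 * (w\<^sup>2 * Q / (16 * P)) / s\<^sup>2 \<le> R\<^sup>2 / G\<^sup>2" by (simp add: s_def)
  then have 1: "G\<^sup>2 * w\<^sup>2 * Q \<le> 208 * R\<^sup>2 * (P * s\<^sup>2)"
    using P s G by (simp add: field_simps)
  have "s ^ 3 \<le> 9 * Q" unfolding s_def Q_def using y by (intro power_mean_cubes) auto
  then have "G\<^sup>2 * w\<^sup>2 * s ^ 3 \<le> G\<^sup>2 * w\<^sup>2 * (9 * Q)" by (intro mult_left_mono) auto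
  with 1 have "G\<^sup>2 * w\<^sup>2 * s * s\<^sup>2 \<le> (1872 * R\<^sup>2 * P) * s\<^sup>2" by (simp add: power2_eq_square power3_eq_cube mult_ac)
  then have "G\<^sup>2 * w\<^sup>2 * s \<le> 1872 * R\<^sup>2 * P" using s by simp
  then have 2: "(G\<^sup>2 * w\<^sup>2 * s) ^ 13 \<le> (1872 * R\<^sup>2 * P) ^ 13" using s by (intro power_mono) auto
  have "y1 * y2 ^ 5 * y3 ^ 5 \<le> s * s ^ 5 * s ^ 5"
    using y s by (intro mult_mono power_mono) auto
  then have 3: "y1 * y2 ^ 5 * y3 ^ 5 \<le> s ^ 11" by (simp flip: power_Suc power_add)
  have "G ^ 26 * w ^ 26 * s\<^sup>2 * (y1 * y2 ^ 5 * y3 ^ 5) \<le> G ^ 26 * w ^ 26 * s\<^sup>2 * s ^ 11"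
    using 3 w G by (intro mult_left_mono) auto
  also have "\<dots> = (G\<^sup>2 * w\<^sup>2 * s) ^ 13" by (simp add: power_mult_distrib flip: power_mult power_add)
  also note 2
  also have "(1872 * R\<^sup>2 * P) ^ 13 = (1872 * R\<^sup>2) ^ 13 * (y1 ^ 38 * y2 ^ 34 * y3 ^ 34) * (y1 * y2 ^ 5 * y3 ^ 5)"
  proof -
    have "P ^ 13 = y1 ^ 39 * y2 ^ 39 * y3 ^ 39" by (simp add: P_def power_mult_distrib flip: power_mult)
    also have "\<dots> = (y1 ^ 38 * y2 ^ 34 * y3 ^ 34) * (y1 * y2 ^ 5 * y3 ^ 5)"
    proof -
      have "y1 ^ 39 = y1 ^ 38 * y1" "y2 ^ 39 = y2 ^ 34 * y2 ^ 5" "y3 ^ 39 = y3 ^ 34 * y3 ^ 5"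
        by (simp_all flip: power_add power_Suc2)
      then show ?thesis by (simp add: mult_ac)
    qed
    finally have *: "P ^ 13 = (y1 ^ 38 * y2 ^ 34 * y3 ^ 34) * (y1 * y2 ^ 5 * y3 ^ 5)" .
    show ?thesis unfolding power_mult_distrib[of "1872 * R\<^sup>2" P] * by (rule mult.assoc[symmetric])
  qed
  finally have "G ^ 26 * w ^ 26 * s\<^sup>2 \<le> (1872 * R\<^sup>2) ^ 13 * (y1 ^ 38 * y2 ^ 34 * y3 ^ 34)"
    by (rule mult_right_le_imp_le) (use y in simp)
  then show ?thesis using y by (simp add: s_def divide_le_eq)
qed

text \<open>
  The maximum principle of Ahlfors: \<open>(R\<^sup>2 - |z|\<^sup>2) \<rho> z\<close> vanishes on the circle of radius \<open>R\<close> and at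
  the zeros of the \<open>X\<^sub>j\<close>, so if it is not identically 0, its maximum lies at a point where all \<open>X\<^sub>j\<close>
  and \<open>W\<close> have holomorphic logarithms.  There the Laplacian of the logarithm of \<open>\<rho>\<close> is at
  least \<open>\<rho>\<^sup>2 / 468\<close>, whereas \<open>R\<^sup>2 - |z|\<^sup>2\<close> can compensate only \<open>4 R\<^sup>2 / (R\<^sup>2 - |z|\<^sup>2)\<^sup>2\<close>; hence
  \<open>(R\<^sup>2 - |z|\<^sup>2) \<rho>\<close> is at most \<open>R\<close> times the square root of 1872, which is less than \<open>44 R\<close>.
  Finally \<open>\<rho> \<ge> |W| / S ^ 4\<close>, because \<open>y\<^sub>j \<le> S\<close>.
\<close>

lemma ahlfors_bound_433:
  fixes X1 X2 X3 :: "complex \<Rightarrow> complex"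
  assumes R: "0 < R" "R < R'"
    and hol: "X1 holomorphic_on ball 0 R'" "X2 holomorphic_on ball 0 R'" "X3 holomorphic_on ball 0 R'"
    and sum0: "\<And>z. z \<in> ball 0 R' \<Longrightarrow> X1 z + X2 z + X3 z = 0"
    and nocommon: "\<And>z. z \<in> ball 0 R' \<Longrightarrow> \<not> (X1 z = 0 \<and> X2 z = 0)"
    and ord1: "\<And>z. z \<in> ball 0 R' \<Longrightarrow> X1 z = 0 \<Longrightarrow> vanishes_to_order 4 X1 z"
    and ord2: "\<And>z. z \<in> ball 0 R' \<Longrightarrow> X2 z = 0 \<Longrightarrow> vanishes_to_order 3 X2 z"
    and ord3: "\<And>z. z \<in> ball 0 R' \<Longrightarrow> X3 z = 0 \<Longrightarrow> vanishes_to_order 3 X3 z"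
    and z: "z \<in> ball 0 R"
  shows "(R\<^sup>2 - (cmod z)\<^sup>2) * cmod (deriv X1 z * X2 z - X1 z * deriv X2 z)
     \<le> 44 * R * (sqrt (cmod (X1 z)) + sqrt (cmod (X2 z)) + sqrt (cmod (X3 z))) ^ 4"
proof -
  define T where "T = ball (0::complex) R'"
  have T: "open T" "connected T" "cball 0 R \<subseteq> T" using R by (auto simp: T_def)
  note hol = hol[folded T_def] and sum0 = sum0[folded T_def] and nocommon = nocommon[folded T_def]
    and ord1 = ord1[folded T_def] and ord2 = ord2[folded T_def] and ord3 = ord3[folded T_def]
  define W where "W z = deriv X1 z * X2 z - X1 z * deriv X2 z" for z
  define G where "G z = R\<^sup>2 - (cmod z)\<^sup>2" for z :: complex
  define s where "s z = sqrt (cmod (X1 z)) + sqrt (cmod (X2 z)) + sqrt (cmod (X3 z))" for z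
  have zT: "z \<in> T" using z T by auto
  have G0: "G z > 0" using z R by (simp add: G_def power_strict_mono)
  have s0: "s z \<ge> 0" for z by (simp add: s_def)
  have dX: "(X1 has_field_derivative deriv X1 z) (at z)" "(X2 has_field_derivative deriv X2 z) (at z)"
    "(X3 has_field_derivative deriv X3 z) (at z)" if "z \<in> T" for z
    using hol T that holomorphic_derivI by blast+
  have X3: "X3 z = - X1 z - X2 z" if "z \<in> T" for z
    using sum0[OF that] by (simp add: add_eq_0_iff algebra_simps)
  have d3: "deriv X3 z = - deriv X1 z - deriv X2 z" if "z \<in> T" for z
  proof -
    have "((\<lambda>z. - X1 z - X2 z) has_field_derivative - deriv X1 z - deriv X2 z) (at z)"
      by (intro derivative_intros dX that)
    then have "(X3 has_field_derivative - deriv X1 z - deriv X2 z) (at z)"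
      by (rule has_field_derivative_transform_within_open[OF _ T(1) that]) (simp add: X3)
    then show ?thesis by (rule DERIV_imp_deriv)
  qed
  have W2: "W z = deriv X2 z * X3 z - X2 z * deriv X3 z" if "z \<in> T" for z
    using that by (simp add: W_def X3 d3 algebra_simps)
  have W3: "W z = deriv X3 z * X1 z - X3 z * deriv X1 z" if "z \<in> T" for z
    using that by (simp add: W_def X3 d3 algebra_simps)
  have main: "G z * cmod (W z) \<le> 44 * R * s z ^ 4"
  proof (cases "(\<forall>z\<in>T. X1 z = 0) \<or> (\<forall>z\<in>T. X2 z = 0) \<or> (\<forall>z\<in>T. X3 z = 0)")
    case True
    have d0: "deriv X z = 0" if "\<forall>z\<in>T. X z = 0" for X :: "complex \<Rightarrow> complex"
    proof -
      have "(X has_field_derivative 0) (at z)"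
        by (rule has_field_derivative_transform_within_open[OF DERIV_const[of 0] T(1) zT]) (use that in auto)
      then show ?thesis by (rule DERIV_imp_deriv)
    qed
    from True have "W z = 0"
    proof (elim disjE)
      assume "\<forall>z\<in>T. X1 z = 0" then show ?thesis using d0[of X1] zT by (simp add: W_def)
    next
      assume "\<forall>z\<in>T. X2 z = 0" then show ?thesis using d0[of X2] zT by (simp add: W_def)
    next
      assume "\<forall>z\<in>T. X3 z = 0" then show ?thesis using d0[of X3] zT by (simp add: W3)
    qed
    then show ?thesis using R s0 by simp
  next
    case False
    then obtain u1 u2 u3 where u: "u1 \<in> T" "X1 u1 \<noteq> 0" "u2 \<in> T" "X2 u2 \<noteq> 0" "u3 \<in> T" "X3 u3 \<noteq> 0"
      by blast
    \<comment> \<open>The power 26 of \<open>(R\<^sup>2 - |z|\<^sup>2) \<rho>\<close>, which leaves no fractional exponents but the square roots in \<open>S\<close>. Division by zero gives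
      it the value 0 at the zeros of the \<open>X\<^sub>j\<close>, which is its limit there.\<close>
    define U where "U z = G z ^ 26 * cmod (W z) ^ 26 * (s z)\<^sup>2
        / (cmod (X1 z) ^ 19 * cmod (X2 z) ^ 17 * cmod (X3 z) ^ 17)" for z
    have z1: "isCont (\<lambda>z. cmod (W z) ^ 26 / cmod (X1 z) ^ 19) z0" "W z0 = 0"
      if "z0 \<in> T" "X1 z0 = 0" for z0
      using wronskian_quotient_continuous[OF T(1,2) that(1) hol(1,2) u(1,2) that(2) ord1[OF that], of 19]
      by (simp_all add: W_def)
    have z2: "isCont (\<lambda>z. cmod (W z) ^ 26 / cmod (X2 z) ^ 17) z0" "W z0 = 0"
      if "z0 \<in> T" "X2 z0 = 0" for z0
    proof -
      have "isCont (\<lambda>z. cmod (W z) ^ 26 / cmod (X2 z) ^ 17) z0 \<longleftrightarrow>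
        isCont (\<lambda>z. cmod (deriv X2 z * X3 z - X2 z * deriv X3 z) ^ 26 / cmod (X2 z) ^ 17) z0"
        by (rule isCont_cong) (use W2 in \<open>auto intro!: eventually_mono[OF eventually_nhds_in_open[OF T(1) that(1)]]\<close>)
      then show "isCont (\<lambda>z. cmod (W z) ^ 26 / cmod (X2 z) ^ 17) z0" "W z0 = 0"
        using wronskian_quotient_continuous[OF T(1,2) that(1) hol(2,3) u(3,4) that(2) ord2[OF that], of 17] W2[OF that(1)]
        by simp_all
    qed
    have z3: "isCont (\<lambda>z. cmod (W z) ^ 26 / cmod (X3 z) ^ 17) z0" "W z0 = 0"
      if "z0 \<in> T" "X3 z0 = 0" for z0
    proof -
      have "isCont (\<lambda>z. cmod (W z) ^ 26 / cmod (X3 z) ^ 17) z0 \<longleftrightarrow>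
        isCont (\<lambda>z. cmod (deriv X3 z * X1 z - X3 z * deriv X1 z) ^ 26 / cmod (X3 z) ^ 17) z0"
        by (rule isCont_cong) (use W3 in \<open>auto intro!: eventually_mono[OF eventually_nhds_in_open[OF T(1) that(1)]]\<close>)
      then show "isCont (\<lambda>z. cmod (W z) ^ 26 / cmod (X3 z) ^ 17) z0" "W z0 = 0"
        using wronskian_quotient_continuous[OF T(1,2) that(1) hol(3,1) u(5,6) that(2) ord3[OF that], of 17] W3[OF that(1)]
        by simp_all
    qed
    have cX: "isCont X1 z0" "isCont X2 z0" "isCont X3 z0" "isCont (deriv X1) z0" "isCont (deriv X2) z0"
      if "z0 \<in> T" for z0
      using that hol T holomorphic_deriv[OF hol(1) T(1)] holomorphic_deriv[OF hol(2) T(1)]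
      by (blast intro: holomorphic_isCont)+
    have cG: "isCont (\<lambda>z. G z ^ 26) z0" for z0 unfolding G_def by (intro continuous_intros)
    have cs: "isCont (\<lambda>z. (s z)\<^sup>2) z0" if "z0 \<in> T" for z0
      unfolding s_def by (intro continuous_intros cX that)
    have cW: "isCont (\<lambda>z. cmod (W z) ^ 26) z0" if "z0 \<in> T" for z0
      unfolding W_def by (intro continuous_intros cX that)
    have cU: "isCont U z0" if z0: "z0 \<in> T" for z0
    proof -
      consider "X1 z0 = 0" "X2 z0 \<noteq> 0" "X3 z0 \<noteq> 0" | "X1 z0 \<noteq> 0" "X2 z0 = 0" "X3 z0 \<noteq> 0"
        | "X1 z0 \<noteq> 0" "X2 z0 \<noteq> 0" "X3 z0 = 0" | "X1 z0 \<noteq> 0" "X2 z0 \<noteq> 0" "X3 z0 \<noteq> 0"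
        using nocommon[OF z0] X3[OF z0] by force
      then show ?thesis
      proof cases
        case 1
        have Ueq: "U = (\<lambda>z. (cmod (W z) ^ 26 / cmod (X1 z) ^ 19) * (G z ^ 26 * (s z)\<^sup>2 / (cmod (X2 z) ^ 17 * cmod (X3 z) ^ 17)))"
          by (rule ext) (simp add: U_def mult_ac)
        show ?thesis
          unfolding Ueq using 1 by (intro continuous_intros z1(1) cG cs cX z0) auto
      next
        case 2
        have Ueq: "U = (\<lambda>z. (cmod (W z) ^ 26 / cmod (X2 z) ^ 17) * (G z ^ 26 * (s z)\<^sup>2 / (cmod (X1 z) ^ 19 * cmod (X3 z) ^ 17)))"
          by (rule ext) (simp add: U_def mult_ac)
        show ?thesis
          unfolding Ueq using 2 by (intro continuous_intros z2(1) cG cs cX z0) auto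
      next
        case 3
        have Ueq: "U = (\<lambda>z. (cmod (W z) ^ 26 / cmod (X3 z) ^ 17) * (G z ^ 26 * (s z)\<^sup>2 / (cmod (X1 z) ^ 19 * cmod (X2 z) ^ 17)))"
          by (rule ext) (simp add: U_def mult_ac)
        show ?thesis
          unfolding Ueq using 3 by (intro continuous_intros z3(1) cG cs cX z0) auto
      next
        case 4
        then show ?thesis
          unfolding U_def by (intro continuous_intros cW cG cs cX z0) auto
      qed
    qed
    have "continuous_on (cball 0 R) U"
      using cU T by (intro continuous_at_imp_continuous_on) auto
    then obtain z0 where z0: "z0 \<in> cball 0 R" and max: "\<And>y. y \<in> cball 0 R \<Longrightarrow> U y \<le> U z0"
      using continuous_attains_sup[of "cball 0 R" U] R by auto
    have z0T: "z0 \<in> T" using z0 T by auto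
    have Uz0: "U z0 \<le> (1872 * R\<^sup>2) ^ 13"
    proof (cases "U z0 > 0")
      case False
      then show ?thesis by (intro order_trans[OF leI[OF False]] zero_le_power) simp
    next
      case True
      then have nz: "X1 z0 \<noteq> 0" "X2 z0 \<noteq> 0" "X3 z0 \<noteq> 0" "W z0 \<noteq> 0" "G z0 \<noteq> 0"
        by (auto simp: U_def)
      have "cmod z0 \<noteq> R" using nz(5) by (auto simp: G_def)
      then have z0R: "z0 \<in> ball 0 R" using z0 by simp
      define E where "E = {z \<in> ball 0 R. X1 z * X2 z * X3 z * W z \<noteq> 0}"
      have "open E"
      proof -
        have "continuous_on (ball 0 R) (\<lambda>z. X1 z * X2 z * X3 z * W z)"
          unfolding W_def using T
          by (intro continuous_at_imp_continuous_on ballI continuous_intros cX) auto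
        then have "open ((\<lambda>z. X1 z * X2 z * X3 z * W z) -` (-{0}) \<inter> ball 0 R)"
          using continuous_on_open_vimage[of "ball 0 R"] open_Compl[OF closed_singleton, of "0 :: complex"] by blast
        moreover have "(\<lambda>z. X1 z * X2 z * X3 z * W z) -` (-{0}) \<inter> ball 0 R = E"
          by (auto simp: E_def)
        ultimately show ?thesis by simp
      qed
      moreover have "z0 \<in> E" using nz z0R by (simp add: E_def)
      ultimately obtain d where d: "d > 0" "ball z0 d \<subseteq> E" using openE by blast
      define B where "B = ball z0 d"
      have BR: "B \<subseteq> ball 0 R" using d by (auto simp: B_def E_def)
      then have BT: "B \<subseteq> T" using T(3) ball_subset_cball by blast
      have B: "open B" "convex B" "z0 \<in> B" using d by (auto simp: B_def)
      have nzB: "X1 z \<noteq> 0" "X2 z \<noteq> 0" "X3 z \<noteq> 0" "W z \<noteq> 0" if "z \<in> B" for z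
        using that d by (auto simp: B_def E_def)
      have holB: "X1 holomorphic_on B" "X2 holomorphic_on B" "X3 holomorphic_on B" "W holomorphic_on B"
        unfolding W_def using hol BT B T holomorphic_on_subset
        by (auto intro!: holomorphic_intros holomorphic_deriv)
      obtain x1 where x1: "x1 holomorphic_on B" "\<And>z. z \<in> B \<Longrightarrow> exp (x1 z) = X1 z"
        using holomorphic_logarithm_exists[OF B(2,1) holB(1) nzB(1) B(3)] by blast
      obtain x2 where x2: "x2 holomorphic_on B" "\<And>z. z \<in> B \<Longrightarrow> exp (x2 z) = X2 z"
        using holomorphic_logarithm_exists[OF B(2,1) holB(2) nzB(2) B(3)] by blast
      obtain x3 where x3: "x3 holomorphic_on B" "\<And>z. z \<in> B \<Longrightarrow> exp (x3 z) = X3 z"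
        using holomorphic_logarithm_exists[OF B(2,1) holB(3) nzB(3) B(3)] by blast
      obtain \<omega> where \<omega>: "\<omega> holomorphic_on B" "\<And>z. z \<in> B \<Longrightarrow> exp (\<omega> z) = W z"
        using holomorphic_logarithm_exists[OF B(2,1) holB(4) nzB(4) B(3)] by blast
      \<comment> \<open>Fourth roots of the \<open>X\<^sub>j\<close>, which turn \<open>S\<close> into a sum of squared moduli of holomorphic functions.\<close>
      define Z where "Z x z = exp (x z / 4)" for x :: "complex \<Rightarrow> complex" and z
      have Zsq: "(cmod (Z x z))\<^sup>2 = sqrt (cmod (exp (x z)))" for x z
      proof -
        have "sqrt (exp (Re (x z))) = exp (Re (x z) / 2)"
          by (rule real_sqrt_unique) (simp_all flip: exp_double)
        then show ?thesis by (simp add: Z_def flip: exp_double)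
      qed
      have sZ: "(cmod (Z x1 z))\<^sup>2 + (cmod (Z x2 z))\<^sup>2 + (cmod (Z x3 z))\<^sup>2 = s z" if "z \<in> B" for z
        using that by (simp add: Zsq x1 x2 x3 s_def)
      have sp: "s z > 0" if "z \<in> B" for z
        using nzB(1)[OF that] by (simp add: s_def add_pos_nonneg)
      have Gp: "(cmod z)\<^sup>2 < R\<^sup>2" if "z \<in> B" for z
        using that BR R by (auto intro!: power_strict_mono)
      define H where "H z = (26 * \<omega> z - 19 * x1 z - 17 * x2 z - 17 * x3 z) / 26" for z
      have lnU: "ln (U z) = 26 * (Re (H z) + 1/13 * ln (s z) + ln (G z))" if zB: "z \<in> B" for z
      proof -
        have *: "ln (cmod (X1 z)) = Re (x1 z)" "ln (cmod (X2 z)) = Re (x2 z)" "ln (cmod (X3 z)) = Re (x3 z)"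
           "ln (cmod (W z)) = Re (\<omega> z)"
          using zB by (simp_all flip: x1(2) x2(2) x3(2) \<omega>(2))
        have "ln (U z) = 26 * ln (G z) + 26 * ln (cmod (W z)) + 2 * ln (s z)
           - (19 * ln (cmod (X1 z)) + 17 * ln (cmod (X2 z)) + 17 * ln (cmod (X3 z)))"
          using nzB[OF zB] sp[OF zB] Gp[OF zB] unfolding U_def G_def
          by (simp add: ln_mult ln_div ln_realpow)
        then show ?thesis by (simp add: * H_def)
      qed
      have Upos: "U z > 0" if "z \<in> B" for z
        using nzB[OF that] sp[OF that] Gp[OF that] unfolding U_def G_def by simp
      have lap: "1/13 * ((cmod (Z x1 z0 * deriv (Z x2) z0 - Z x2 z0 * deriv (Z x1) z0))\<^sup>2
            + (cmod (Z x1 z0 * deriv (Z x3) z0 - Z x3 z0 * deriv (Z x1) z0))\<^sup>2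
            + (cmod (Z x2 z0 * deriv (Z x3) z0 - Z x3 z0 * deriv (Z x2) z0))\<^sup>2)
          / ((cmod (Z x1 z0))\<^sup>2 + (cmod (Z x2 z0))\<^sup>2 + (cmod (Z x3 z0))\<^sup>2)\<^sup>2
         \<le> R\<^sup>2 / (R\<^sup>2 - (cmod z0)\<^sup>2)\<^sup>2"
      proof (rule laplacian_at_max[where H = H and S = B])
        show "H holomorphic_on B" unfolding H_def by (intro holomorphic_intros x1 x2 x3 \<omega>) auto
        show "Z x1 holomorphic_on B" "Z x2 holomorphic_on B" "Z x3 holomorphic_on B"
          unfolding Z_def by (intro holomorphic_intros x1 x2 x3; simp)+
        show "0 < (cmod (Z x1 z))\<^sup>2 + (cmod (Z x2 z))\<^sup>2 + (cmod (Z x3 z))\<^sup>2" if "z \<in> B" for z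
          using sp sZ that by simp
        show "Re (H z) + 1/13 * ln ((cmod (Z x1 z))\<^sup>2 + (cmod (Z x2 z))\<^sup>2 + (cmod (Z x3 z))\<^sup>2) + ln (R\<^sup>2 - (cmod z)\<^sup>2)
          \<le> Re (H z0) + 1/13 * ln ((cmod (Z x1 z0))\<^sup>2 + (cmod (Z x2 z0))\<^sup>2 + (cmod (Z x3 z0))\<^sup>2) + ln (R\<^sup>2 - (cmod z0)\<^sup>2)"
          if zB: "z \<in> B" for z
        proof -
          have "z \<in> cball 0 R" using zB BR by auto
          then have "ln (U z) \<le> ln (U z0)" using max Upos[OF zB] Upos[OF B(3)] by simp
          then show ?thesis using sZ[OF zB] sZ[OF B(3)] lnU[OF zB] lnU[OF B(3)] by (simp add: G_def)
        qed
      qed (use B Gp in auto)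
      define y1 y2 y3 where "y1 = sqrt (cmod (X1 z0))" and "y2 = sqrt (cmod (X2 z0))" and "y3 = sqrt (cmod (X3 z0))"
      have y: "y1 > 0" "y2 > 0" "y3 > 0" using nz by (auto simp: y1_def y2_def y3_def)
      have cX': "cmod (X1 z0) = y1\<^sup>2" "cmod (X2 z0) = y2\<^sup>2" "cmod (X3 z0) = y3\<^sup>2"
        by (simp_all add: y1_def y2_def y3_def)
      \<comment> \<open>All three Wronskians of the \<open>X\<^sub>j\<close> equal \<open>W\<close> up to sign, so those of the fourth roots differ only by
        powers of the \<open>y\<^sub>j\<close>.\<close>
      have wr: "(cmod (Z x z0 * deriv (Z y) z0 - Z y z0 * deriv (Z x) z0))\<^sup>2
          = (cmod (deriv X z0 * Y z0 - X z0 * deriv Y z0))\<^sup>2 / (16 * (sqrt (cmod (X z0)) * sqrt (cmod (Y z0))) ^ 3)"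
        if x: "x holomorphic_on B" "\<And>z. z \<in> B \<Longrightarrow> exp (x z) = X z"
          and y: "y holomorphic_on B" "\<And>z. z \<in> B \<Longrightarrow> exp (y z) = Y z" for x y X Y
      proof -
        have dZ: "deriv (Z v) z0 = Z v z0 * deriv V z0 / (4 * V z0)"
          if v: "v holomorphic_on B" "\<And>z. z \<in> B \<Longrightarrow> exp (v z) = V z" for v V
        proof -
          have dv: "(v has_field_derivative deriv v z0) (at z0)"
            using holomorphic_derivI[OF v(1) B(1,3)] .
          have "((\<lambda>z. exp (v z)) has_field_derivative exp (v z0) * deriv v z0) (at z0)"
            using dv by (auto intro!: derivative_eq_intros)
          then have "(V has_field_derivative exp (v z0) * deriv v z0) (at z0)"
            by (rule has_field_derivative_transform_within_open[OF _ B(1,3)]) (use v(2) in auto)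
          then have 1: "deriv V z0 = V z0 * deriv v z0" using v(2)[OF B(3)] by (simp add: DERIV_imp_deriv)
          have "(Z v has_field_derivative Z v z0 * (deriv v z0 / 4)) (at z0)"
            unfolding Z_def using dv by (auto intro!: derivative_eq_intros)
          then have "deriv (Z v) z0 = Z v z0 * (deriv v z0 / 4)" by (rule DERIV_imp_deriv)
          moreover have "V z0 \<noteq> 0" using v(2)[OF B(3)] by auto
          ultimately show ?thesis using 1 by simp
        qed
        have XY: "X z0 \<noteq> 0" "Y z0 \<noteq> 0" using x(2)[OF B(3)] y(2)[OF B(3)] by auto
        define p q where "p = sqrt (cmod (X z0))" and "q = sqrt (cmod (Y z0))"
        have pq: "p > 0" "q > 0" "cmod (X z0) = p\<^sup>2" "cmod (Y z0) = q\<^sup>2" using XY by (auto simp: p_def q_def)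
        have Zpq: "(cmod (Z x z0))\<^sup>2 = p" "(cmod (Z y z0))\<^sup>2 = q"
          using x(2)[OF B(3)] y(2)[OF B(3)] by (simp_all add: Zsq p_def q_def)
        have dzx: "deriv (Z x) z0 = Z x z0 * deriv X z0 / (4 * X z0)"
          and dzy: "deriv (Z y) z0 = Z y z0 * deriv Y z0 / (4 * Y z0)"
          using dZ[of x X] dZ[of y Y] x y by blast+
        have Zd: "Z x z0 * deriv (Z y) z0 - Z y z0 * deriv (Z x) z0
          = - (Z x z0 * Z y z0 * (deriv X z0 * Y z0 - X z0 * deriv Y z0) / (4 * X z0 * Y z0))"
          unfolding dzx dzy using XY by (simp add: field_simps)
        have "(cmod (Z x z0 * deriv (Z y) z0 - Z y z0 * deriv (Z x) z0))\<^sup>2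
          = p * q * (cmod (deriv X z0 * Y z0 - X z0 * deriv Y z0))\<^sup>2 / (4 * p\<^sup>2 * q\<^sup>2)\<^sup>2"
          unfolding Zd by (simp add: norm_mult norm_divide power_mult_distrib power_divide pq Zpq)
        then show ?thesis using pq(1,2)
          by (simp add: p_def[symmetric] q_def[symmetric] field_simps power2_eq_square power3_eq_cube)
      qed
      have "1/13 * ((cmod (W z0))\<^sup>2 / (16 * (y1 * y2) ^ 3) + (cmod (W z0))\<^sup>2 / (16 * (y1 * y3) ^ 3)
           + (cmod (W z0))\<^sup>2 / (16 * (y2 * y3) ^ 3)) / (y1 + y2 + y3)\<^sup>2 \<le> R\<^sup>2 / (G z0)\<^sup>2"
      proof -
        have w13: "cmod (deriv X1 z0 * X3 z0 - X1 z0 * deriv X3 z0) = cmod (W z0)"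
          unfolding W3[OF z0T] by (subst norm_minus_commute) (simp add: mult.commute)
        have w12: "cmod (deriv X1 z0 * X2 z0 - X1 z0 * deriv X2 z0) = cmod (W z0)"
          by (simp add: W_def)
        have w23: "cmod (deriv X2 z0 * X3 z0 - X2 z0 * deriv X3 z0) = cmod (W z0)"
          by (simp add: W2[OF z0T])
        have wr12: "(cmod (Z x1 z0 * deriv (Z x2) z0 - Z x2 z0 * deriv (Z x1) z0))\<^sup>2
            = (cmod (W z0))\<^sup>2 / (16 * (y1 * y2) ^ 3)"
          using wr[of x1 X1 x2 X2] x1 x2 by (simp add: w12 y1_def y2_def)
        have wr13: "(cmod (Z x1 z0 * deriv (Z x3) z0 - Z x3 z0 * deriv (Z x1) z0))\<^sup>2
            = (cmod (W z0))\<^sup>2 / (16 * (y1 * y3) ^ 3)"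
          using wr[of x1 X1 x3 X3] x1 x3 by (simp add: w13 y1_def y3_def)
        have wr23: "(cmod (Z x2 z0 * deriv (Z x3) z0 - Z x3 z0 * deriv (Z x2) z0))\<^sup>2
            = (cmod (W z0))\<^sup>2 / (16 * (y2 * y3) ^ 3)"
          using wr[of x2 X2 x3 X3] x2 x3 by (simp add: w23 y2_def y3_def)
        from lap show ?thesis
          unfolding sZ[OF B(3)] wr12 wr13 wr23
          by (simp add: y1_def y2_def y3_def s_def G_def)
      qed
      moreover have "G z0 > 0" using Gp[OF B(3)] by (simp add: G_def)
      ultimately have "G z0 ^ 26 * cmod (W z0) ^ 26 * (y1 + y2 + y3)\<^sup>2 / (y1 ^ 38 * y2 ^ 34 * y3 ^ 34) \<le> (1872 * R\<^sup>2) ^ 13"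
        using y by (intro curvature_bound_imp_density_bound) auto
      also have "G z0 ^ 26 * cmod (W z0) ^ 26 * (y1 + y2 + y3)\<^sup>2 / (y1 ^ 38 * y2 ^ 34 * y3 ^ 34) = U z0"
        using y unfolding U_def cX' s_def y1_def[symmetric] y2_def[symmetric] y3_def[symmetric]
        by (simp flip: power_mult)
      finally show ?thesis .
    qed
    show ?thesis
    proof (cases "X1 z = 0 \<or> X2 z = 0 \<or> X3 z = 0")
      case True
      then have "W z = 0" using z1(2) z2(2) z3(2) zT by blast
      then show ?thesis using R s0 by simp
    next
      case False
      define y1 y2 y3 where "y1 = sqrt (cmod (X1 z))" and "y2 = sqrt (cmod (X2 z))" and "y3 = sqrt (cmod (X3 z))"
      have y: "y1 > 0" "y2 > 0" "y3 > 0" using False by (auto simp: y1_def y2_def y3_def)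
      have cX': "cmod (X1 z) = y1\<^sup>2" "cmod (X2 z) = y2\<^sup>2" "cmod (X3 z) = y3\<^sup>2"
        by (simp_all add: y1_def y2_def y3_def)
      have ys: "y1 \<le> s z" "y2 \<le> s z" "y3 \<le> s z" "s z > 0"
        unfolding s_def y1_def[symmetric] y2_def[symmetric] y3_def[symmetric] using y by auto
      have "U z \<le> (1872 * R\<^sup>2) ^ 13" using max[of z] z Uz0 by auto
      also have "U z = G z ^ 26 * cmod (W z) ^ 26 * (s z)\<^sup>2 / (y1 ^ 38 * y2 ^ 34 * y3 ^ 34)"
        unfolding U_def cX' by (simp flip: power_mult)
      finally have "(G z * cmod (W z)) ^ 26 * (s z)\<^sup>2 \<le> (1872 * R\<^sup>2) ^ 13 * (y1 ^ 38 * y2 ^ 34 * y3 ^ 34)"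
        using y by (simp add: divide_le_eq power_mult_distrib)
      also have "\<dots> \<le> (1936 * R\<^sup>2) ^ 13 * (s z ^ 38 * s z ^ 34 * s z ^ 34)"
        using y ys R by (intro mult_mono power_mono) auto
      also have "\<dots> = (44 * R * s z ^ 4) ^ 26 * (s z)\<^sup>2"
      proof -
        have "1936 * R\<^sup>2 = (44 * R)\<^sup>2" by (simp add: power2_eq_square)
        then have "(1936 * R\<^sup>2) ^ 13 = (44 * R) ^ 26" by (metis mult_2 numeral_Bit0 numeral_times_numeral power_mult)
        moreover have "s z ^ 38 * s z ^ 34 * s z ^ 34 = (s z ^ 4) ^ 26 * (s z)\<^sup>2" by (simp flip: power_mult power_add)
        ultimately show ?thesis by (simp add: power_mult_distrib mult_ac)
      qed
      finally have "(G z * cmod (W z)) ^ 26 \<le> (44 * R * s z ^ 4) ^ 26" using ys by simp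
      moreover have "0 \<le> G z * cmod (W z)" "0 \<le> 44 * R * s z ^ 4" using G0 R by simp_all
      ultimately show ?thesis by (simp only: power_mono_iff zero_less_numeral)
    qed
  qed
  then show ?thesis by (simp add: G_def W_def s_def)
qed

section \<open>Homogeneous coordinates on the sphere\<close>

text \<open>
  The point with homogeneous coordinates \<open>[P : Q]\<close>.
\<close>

definition sphere_pt :: "complex \<Rightarrow> complex \<Rightarrow> riemann_sphere" where
  "sphere_pt P Q = (if Q = 0 then None else Some (P / Q))"

definition lift_on :: "complex set \<Rightarrow> (complex \<Rightarrow> riemann_sphere) \<Rightarrow> (complex \<Rightarrow> complex) \<Rightarrow> (complex \<Rightarrow> complex) \<Rightarrow> bool" where
  "lift_on S \<phi> P Q \<longleftrightarrow> P holomorphic_on S \<and> Q holomorphic_on S \<and>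
     (\<forall>z\<in>S. (P z \<noteq> 0 \<or> Q z \<noteq> 0) \<and> \<phi> z = sphere_pt (P z) (Q z))"

text \<open>
  Holomorphic maps into the sphere.  In contrast to meromorphic functions they include the constant
  \<open>\<infinity>\<close>, as the targets may be, and they treat \<open>\<infinity>\<close> like any other value.
\<close>

definition sphere_holo :: "complex set \<Rightarrow> (complex \<Rightarrow> riemann_sphere) \<Rightarrow> bool" where
  "sphere_holo S \<phi> \<longleftrightarrow> (\<forall>z\<in>S. \<exists>r>0. \<exists>P Q. ball z r \<subseteq> S \<and> lift_on (ball z r) \<phi> P Q)"

text \<open>
  Two lifts of the same map differ by a factor without zeros, so the order of vanishing does not
  depend on the lifts; it is demanded for all of them so that it can be used with any.
\<close>

definition contact_ge :: "nat \<Rightarrow> (complex \<Rightarrow> riemann_sphere) \<Rightarrow> (complex \<Rightarrow> riemann_sphere) \<Rightarrow> complex set \<Rightarrow> bool" where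
  "contact_ge m \<phi> a S \<longleftrightarrow> (\<forall>z\<in>S. \<phi> z = a z \<longrightarrow>
     (\<forall>r P Q A B. r > 0 \<longrightarrow> lift_on (ball z r) \<phi> P Q \<longrightarrow> lift_on (ball z r) a A B \<longrightarrow>
        vanishes_to_order m (\<lambda>w. P w * B w - Q w * A w) z))"

lemma lift_on_subset: "lift_on S \<phi> P Q \<Longrightarrow> T \<subseteq> S \<Longrightarrow> lift_on T \<phi> P Q"
  unfolding lift_on_def using holomorphic_on_subset by blast

lemma lift_onD:
  assumes "lift_on S \<phi> P Q" "z \<in> S"
  shows "P z \<noteq> 0 \<or> Q z \<noteq> 0" "\<phi> z = sphere_pt (P z) (Q z)"
  using assms by (auto simp: lift_on_def)

lemma sphere_holo_open_subset:
  assumes "sphere_holo S \<phi>" "open T" "T \<subseteq> S"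
  shows "sphere_holo T \<phi>"
  unfolding sphere_holo_def
proof
  fix z assume z: "z \<in> T"
  then obtain r P Q where r: "r > 0" "ball z r \<subseteq> S" "lift_on (ball z r) \<phi> P Q"
    using assms by (meson sphere_holo_def subsetD)
  obtain r' where "r' > 0" "ball z r' \<subseteq> T" using assms(2) z openE by blast
  then have "min r r' > 0" "ball z (min r r') \<subseteq> T" "ball z (min r r') \<subseteq> ball z r" using r by auto
  then show "\<exists>r>0. \<exists>P Q. ball z r \<subseteq> T \<and> lift_on (ball z r) \<phi> P Q"
    using lift_on_subset[OF r(3)] by blast
qed

lemma sphere_pt_eq_iff:
  assumes "P \<noteq> 0 \<or> Q \<noteq> 0" "A \<noteq> 0 \<or> B \<noteq> 0"
  shows "sphere_pt P Q = sphere_pt A B \<longleftrightarrow> P * B = Q * A"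
  using assms by (auto simp: sphere_pt_def field_simps)

lemma stereo_sphere_pt:
  assumes "P \<noteq> 0 \<or> Q \<noteq> 0"
  shows "stereo (sphere_pt P Q) =
    ((2 / ((cmod P)\<^sup>2 + (cmod Q)\<^sup>2)) *\<^sub>R (P * cnj Q),
     ((cmod P)\<^sup>2 - (cmod Q)\<^sup>2) / ((cmod P)\<^sup>2 + (cmod Q)\<^sup>2))"
proof (cases "Q = 0")
  case True
  then show ?thesis using assms by (simp add: sphere_pt_def)
next
  case False
  define n where "n = (cmod P)\<^sup>2 + (cmod Q)\<^sup>2"
  have q: "(cmod Q)\<^sup>2 > 0" and n: "n > 0" using False by (auto simp: n_def intro: add_nonneg_pos)
  have 1: "1 + (cmod (P / Q))\<^sup>2 = n / (cmod Q)\<^sup>2" using q by (simp add: n_def norm_divide power_divide field_simps)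
  have 2: "(cmod (P / Q))\<^sup>2 - 1 = ((cmod P)\<^sup>2 - (cmod Q)\<^sup>2) / (cmod Q)\<^sup>2"
    using q by (simp add: norm_divide power_divide field_simps)
  have "P / Q = P * cnj Q / of_real ((cmod Q)\<^sup>2)" 
    by (simp add: complex_div_cnj[of P Q])
  then have "(2 / (n / (cmod Q)\<^sup>2)) *\<^sub>R (P / Q) = (2 / n) *\<^sub>R (P * cnj Q)"
    using q n by (simp add: scaleR_conv_of_real field_simps)
  then show ?thesis using False 1 2 q
    by (simp add: sphere_pt_def n_def[symmetric] add.commute)
qed

text \<open>
  The identity \<open>(|P|\<^sup>2 + |Q|\<^sup>2) (|A|\<^sup>2 + |B|\<^sup>2) = |P B - Q A|\<^sup>2 + |P cnj A + Q cnj B|\<^sup>2\<close> in disguise.  It expresses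
  spherical distance by the normalised determinant of homogeneous coordinates.
\<close>

lemma stereo_inner:
  assumes "P \<noteq> 0 \<or> Q \<noteq> 0" "A \<noteq> 0 \<or> B \<noteq> 0"
  shows "stereo (sphere_pt P Q) \<bullet> stereo (sphere_pt A B) =
    1 - 2 * (cmod (P * B - Q * A))\<^sup>2 / (((cmod P)\<^sup>2 + (cmod Q)\<^sup>2) * ((cmod A)\<^sup>2 + (cmod B)\<^sup>2))"
proof -
  define n m where "n = (cmod P)\<^sup>2 + (cmod Q)\<^sup>2" and "m = (cmod A)\<^sup>2 + (cmod B)\<^sup>2"
  have n: "n > 0" "m > 0" using assms by (auto simp: n_def m_def sum_power2_gt_zero_iff)
  have "n * m = 2 * (cmod (P * B - Q * A))\<^sup>2 + 4 * ((P * cnj Q) \<bullet> (A * cnj B))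
       + ((cmod P)\<^sup>2 - (cmod Q)\<^sup>2) * ((cmod A)\<^sup>2 - (cmod B)\<^sup>2)"
    unfolding n_def m_def cmod_power2 inner_complex_def
    by (simp add: algebra_simps power2_eq_square)
  then have *: "4 * ((P * cnj Q) \<bullet> (A * cnj B)) + ((cmod P)\<^sup>2 - (cmod Q)\<^sup>2) * ((cmod A)\<^sup>2 - (cmod B)\<^sup>2)
     = n * m - 2 * (cmod (P * B - Q * A))\<^sup>2" by linarith
  have "stereo (sphere_pt P Q) \<bullet> stereo (sphere_pt A B)
    = (2 / n) * (2 / m) * ((P * cnj Q) \<bullet> (A * cnj B)) + ((cmod P)\<^sup>2 - (cmod Q)\<^sup>2) / n * (((cmod A)\<^sup>2 - (cmod B)\<^sup>2) / m)"
    unfolding stereo_sphere_pt[OF assms(1)] stereo_sphere_pt[OF assms(2)] n_def[symmetric] m_def[symmetric]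
    by simp
  also have "\<dots> = (4 * ((P * cnj Q) \<bullet> (A * cnj B)) + ((cmod P)\<^sup>2 - (cmod Q)\<^sup>2) * ((cmod A)\<^sup>2 - (cmod B)\<^sup>2)) / (n * m)"
    by (simp add: add_divide_distrib)
  also have "\<dots> = 1 - 2 * (cmod (P * B - Q * A))\<^sup>2 / (n * m)"
    unfolding * using n by (simp add: diff_divide_distrib)
  finally show ?thesis by (simp add: n_def m_def)
qed

lemma sphere_pt_surj: obtains P Q where "P \<noteq> 0 \<or> Q \<noteq> 0" "p = sphere_pt P Q"
proof (cases p)
  case None
  then show ?thesis using that[of 1 0] by (simp add: sphere_pt_def)
next
  case (Some z)
  then show ?thesis using that[of z 1] by (simp add: sphere_pt_def)
qed

lemma norm_stereo [simp]: "norm (stereo p) = 1"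
proof -
  obtain P Q where "P \<noteq> 0 \<or> Q \<noteq> 0" "p = sphere_pt P Q" using sphere_pt_surj by blast
  then have "stereo p \<bullet> stereo p = 1" using stereo_inner[of P Q P Q] by (simp add: mult.commute)
  then show ?thesis by (simp add: norm_eq_sqrt_inner)
qed

lemma norm_stereo_diff_sq: "(norm (stereo p - stereo q))\<^sup>2 = 2 - 2 * (stereo p \<bullet> stereo q)"
proof -
  have "stereo r \<bullet> stereo r = 1" for r by (simp add: dot_square_norm)
  then show ?thesis
    by (simp add: power2_norm_eq_inner inner_diff_left inner_diff_right inner_commute)
qed

lemma norm_stereo_diff:
  assumes "P \<noteq> 0 \<or> Q \<noteq> 0" "A \<noteq> 0 \<or> B \<noteq> 0"
  shows "norm (stereo (sphere_pt P Q) - stereo (sphere_pt A B)) =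
    2 * cmod (P * B - Q * A) / (sqrt ((cmod P)\<^sup>2 + (cmod Q)\<^sup>2) * sqrt ((cmod A)\<^sup>2 + (cmod B)\<^sup>2))"
proof (rule power2_eq_imp_eq)
  show "(norm (stereo (sphere_pt P Q) - stereo (sphere_pt A B)))\<^sup>2 = 
    (2 * cmod (P * B - Q * A) / (sqrt ((cmod P)\<^sup>2 + (cmod Q)\<^sup>2) * sqrt ((cmod A)\<^sup>2 + (cmod B)\<^sup>2)))\<^sup>2"
    unfolding norm_stereo_diff_sq stereo_inner[OF assms]
    by (simp add: power_divide power_mult_distrib)
qed auto

lemma lift_on_locally_none_or_isolated:
  assumes "\<rho> > 0" "lift_on (ball z \<rho>) \<phi> P Q"
  shows "(\<forall>w\<in>ball z \<rho>. \<phi> w = None) \<or> (\<exists>\<rho>'>0. \<rho>' \<le> \<rho> \<and> (\<forall>w\<in>ball z \<rho>' - {z}. \<phi> w \<noteq> None))"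
proof (cases "\<forall>w\<in>ball z \<rho>. Q w = 0")
  case True
  then show ?thesis using assms by (auto simp: lift_on_def sphere_pt_def)
next
  case False
  then obtain \<beta> where \<beta>: "\<beta> \<in> ball z \<rho>" "Q \<beta> \<noteq> 0" by blast
  have Q: "Q holomorphic_on ball z \<rho>" using assms by (simp add: lift_on_def)
  have "\<exists>r>0. \<forall>w\<in>ball z r - {z}. Q w \<noteq> 0"
  proof (cases "Q z = 0")
    case True
    have z: "z \<in> ball z \<rho>" using assms by simp
    obtain r where "0 < r" "\<And>w. w \<in> ball z r - {z} \<Longrightarrow> Q w \<noteq> 0"
      using isolated_zeros[OF Q open_ball connected_ball z True \<beta>] by metis
    then show ?thesis by blast
  next
    case False
    have "isCont Q z" using holomorphic_isCont[OF Q] assms by simp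
    then have "\<forall>\<^sub>F w in nhds z. Q w \<noteq> 0" using False
      by (metis isContD t1_space_nhds tendsto_at_iff_tendsto_nhds tendsto_imp_eventually_ne isCont_def)
    then show ?thesis by (auto simp: eventually_nhds_metric dist_commute)
  qed
  then obtain r where r: "r > 0" "\<And>w. w \<in> ball z r - {z} \<Longrightarrow> Q w \<noteq> 0" by blast
  have "\<phi> w \<noteq> None" if "w \<in> ball z (min r \<rho>) - {z}" for w
    using that r(2)[of w] assms by (auto simp: lift_on_def sphere_pt_def)
  then show ?thesis using r assms by (intro disjI2 exI[of _ "min r \<rho>"]) auto
qed

lemma lift_on_finite_part:
  assumes "lift_on S \<phi> P Q" "w \<in> S"
  shows "finite_part (\<phi> w) = P w / Q w"
  using assms by (auto simp: lift_on_def sphere_pt_def)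

lemma lift_on_nicely_meromorphic:
  assumes \<rho>: "\<rho> > 0" and lift: "lift_on (ball z \<rho>) \<phi> P Q"
    and iso: "\<rho>' > 0" "\<And>w. w \<in> ball z \<rho>' - {z} \<Longrightarrow> \<phi> w \<noteq> None"
  shows "(\<lambda>w. finite_part (\<phi> w)) nicely_meromorphic_on {z}"
    and "\<phi> z = None \<longleftrightarrow> is_pole (\<lambda>w. finite_part (\<phi> w)) z"
proof -
  let ?h = "\<lambda>w. finite_part (\<phi> w)"
  have hol: "P holomorphic_on ball z \<rho>" "Q holomorphic_on ball z \<rho>" and nz: "P z \<noteq> 0 \<or> Q z \<noteq> 0"
    and \<phi>z: "\<phi> z = sphere_pt (P z) (Q z)"
    using lift \<rho> by (auto simp: lift_on_def)
  have an: "P analytic_on {z}" "Q analytic_on {z}" using hol \<rho> by (auto simp: analytic_at intro: exI[of _ "ball z \<rho>"])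
  have ev: "\<forall>\<^sub>F w in nhds z. ?h w = P w / Q w"
    using eventually_nhds_in_open[of "ball z \<rho>" z] \<rho> by (auto elim!: eventually_mono simp: lift_on_finite_part[OF lift])
  then have ev': "\<forall>\<^sub>F w in at z. ?h w = P w / Q w" by (simp add: eventually_at_filter eventually_mono)
  have mero: "?h meromorphic_on {z}"
  proof -
    have "(\<lambda>w. P w / Q w) meromorphic_on {z}"
      by (intro meromorphic_on_divide analytic_on_imp_meromorphic_on an)
    then show ?thesis using meromorphic_on_cong[of "{z}" ?h "\<lambda>w. P w / Q w" "{z}"] ev' by auto
  qed
  have "(if Q z = 0 then is_pole ?h z else \<not> is_pole ?h z) \<and> ((is_pole ?h z \<and> ?h z = 0) \<or> ?h \<midarrow>z\<rightarrow> ?h z)"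
  proof (cases "Q z = 0")
    case True
    have "\<forall>\<^sub>F w in at z. Q w \<noteq> 0"
      unfolding eventually_at
    proof (intro exI[of _ "min \<rho> \<rho>'"] conjI ballI impI)
      fix w assume w: "w \<noteq> z \<and> dist w z < min \<rho> \<rho>'"
      then have "\<phi> w \<noteq> None" "w \<in> ball z \<rho>" using iso(2)[of w] by (auto simp: dist_commute)
      then show "Q w \<noteq> 0" using lift by (auto simp: lift_on_def sphere_pt_def)
    qed (use \<rho> iso in auto)
    moreover have "(Q \<longlongrightarrow> 0) (at z)" using analytic_at_imp_isCont[OF an(2)] True by (simp add: isCont_def)
    ultimately have "filterlim Q (at 0) (at z)" by (simp add: filterlim_at)
    then have "is_pole (\<lambda>w. P w / Q w) z"
      using is_pole_divide analytic_at_imp_isCont[OF an(1)] nz True by blast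
    then have "is_pole ?h z" using is_pole_cong[OF ev'] by blast
    then show ?thesis using True \<phi>z by (simp add: sphere_pt_def)
  next
    case False
    have "isCont (\<lambda>w. P w / Q w) z" using an False by (intro continuous_intros analytic_at_imp_isCont)
    then have "isCont ?h z" using isCont_cong[OF ev] by simp
    then have lim: "?h \<midarrow>z\<rightarrow> ?h z" by (simp add: isCont_def)
    then have "\<not> is_pole ?h z" unfolding is_pole_def by (metis not_tendsto_and_filterlim_at_infinity at_neq_bot)
    then show ?thesis using lim False by simp
  qed
  then show "?h nicely_meromorphic_on {z}" "\<phi> z = None \<longleftrightarrow> is_pole ?h z"
    using mero \<phi>z by (auto simp: nicely_meromorphic_on_def sphere_pt_def split: if_splits)
qed

text \<open>
  The identity theorem: the points near which the map is constantly \<open>\<infinity>\<close> and the points near which it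
  takes the value \<open>\<infinity>\<close> at most at the centre form two disjoint open sets.
\<close>

lemma sphere_holo_dichotomy:
  assumes "sphere_holo S \<phi>" "open S" "connected S"
  shows "(\<forall>z\<in>S. \<phi> z = None) \<or>
    ((\<lambda>w. finite_part (\<phi> w)) nicely_meromorphic_on S \<and> (\<forall>z\<in>S. \<phi> z = None \<longleftrightarrow> is_pole (\<lambda>w. finite_part (\<phi> w)) z))"
proof -
  define A where "A = {z\<in>S. \<exists>r>0. ball z r \<subseteq> S \<and> (\<forall>w\<in>ball z r. \<phi> w = None)}"
  define B where "B = {z\<in>S. \<exists>r>0. ball z r \<subseteq> S \<and> (\<forall>w\<in>ball z r - {z}. \<phi> w \<noteq> None)}"
  have "open A"
    unfolding open_contains_ball
  proof
    fix z assume "z \<in> A"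
    then obtain r where r: "r > 0" "ball z r \<subseteq> S" "\<forall>w\<in>ball z r. \<phi> w = None" by (auto simp: A_def)
    have "ball z r \<subseteq> A"
    proof
      fix w assume w: "w \<in> ball z r"
      obtain e where "e > 0" "ball w e \<subseteq> ball z r" using openE[OF open_ball w] by blast
      then show "w \<in> A" using r w by (auto simp: A_def intro!: exI[of _ e])
    qed
    then show "\<exists>e>0. ball z e \<subseteq> A" using r by blast
  qed
  moreover have "open B"
    unfolding open_contains_ball
  proof
    fix z assume "z \<in> B"
    then obtain r where r: "r > 0" "ball z r \<subseteq> S" "\<forall>w\<in>ball z r - {z}. \<phi> w \<noteq> None" and zS: "z \<in> S" by (auto simp: B_def)
    have "ball z r \<subseteq> B"
    proof
      fix w assume w: "w \<in> ball z r"
      show "w \<in> B"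
      proof (cases "w = z")
        case True
        then show ?thesis using \<open>z \<in> B\<close> by simp
      next
        case False
        have "open (ball z r - {z})" by (simp add: open_delete)
        then obtain e where "e > 0" "ball w e \<subseteq> ball z r - {z}" using openE w False by (metis DiffI singletonD)
        then show ?thesis using r w by (auto simp: B_def intro!: exI[of _ e])
      qed
    qed
    then show "\<exists>e>0. ball z e \<subseteq> B" using r by blast
  qed
  moreover have "S \<subseteq> A \<union> B"
  proof
    fix z assume z: "z \<in> S"
    then obtain r P Q where r: "r > 0" "ball z r \<subseteq> S" "lift_on (ball z r) \<phi> P Q"
      using assms by (meson sphere_holo_def)
    from lift_on_locally_none_or_isolated[OF r(1,3)] show "z \<in> A \<union> B"
    proof
      assume "\<forall>w\<in>ball z r. \<phi> w = None"
      then show ?thesis using r z by (auto simp: A_def)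
    next
      assume "\<exists>\<rho>'>0. \<rho>' \<le> r \<and> (\<forall>w\<in>ball z \<rho>' - {z}. \<phi> w \<noteq> None)"
      then obtain \<rho>' where "\<rho>' > 0" "\<rho>' \<le> r" "\<forall>w\<in>ball z \<rho>' - {z}. \<phi> w \<noteq> None" by blast
      moreover from this have "ball z \<rho>' \<subseteq> S" using r(2) subset_ball by blast
      ultimately show ?thesis using z by (auto simp: B_def)
    qed
  qed
  moreover have "A \<inter> B \<inter> S = {}"
  proof -
    have False if "z \<in> A" "z \<in> B" for z
    proof -
      obtain r1 r2 where r: "r1 > 0" "\<forall>w\<in>ball z r1. \<phi> w = None" "r2 > 0" "\<forall>w\<in>ball z r2 - {z}. \<phi> w \<noteq> None"
        using \<open>z \<in> A\<close> \<open>z \<in> B\<close> by (auto simp: A_def B_def)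
      define w where "w = z + of_real (min r1 r2 / 2)"
      have "w \<in> ball z r1" "w \<in> ball z r2 - {z}" using r by (auto simp: w_def dist_norm)
      then show False using r by blast
    qed
    then show ?thesis by blast
  qed
  ultimately consider "A \<inter> S = {}" | "B \<inter> S = {}"
    using connectedD[OF assms(3)] by metis
  then show ?thesis
  proof cases
    case 1
    then have SB: "S \<subseteq> B" using \<open>S \<subseteq> A \<union> B\<close> by blast
    have "(\<lambda>w. finite_part (\<phi> w)) nicely_meromorphic_on {z} \<and> (\<phi> z = None \<longleftrightarrow> is_pole (\<lambda>w. finite_part (\<phi> w)) z)" if "z \<in> S" for z
    proof -
      obtain r P Q where r: "r > 0" "ball z r \<subseteq> S" "lift_on (ball z r) \<phi> P Q"
        using assms \<open>z \<in> S\<close> by (meson sphere_holo_def)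
      have "z \<in> B" using SB \<open>z \<in> S\<close> by blast
      then obtain r2 where r2: "r2 > 0" "\<forall>w\<in>ball z r2 - {z}. \<phi> w \<noteq> None" unfolding B_def by blast
      from lift_on_nicely_meromorphic[OF r(1,3) r2(1) bspec[OF r2(2)]] show ?thesis by blast
    qed
    then show ?thesis unfolding nicely_meromorphic_on_def meromorphic_on_def by blast
  next
    case 2
    then have "S \<subseteq> A" using \<open>S \<subseteq> A \<union> B\<close> by blast
    then show ?thesis by (force simp: A_def)
  qed
qed

text \<open>
  Passing to a smaller disc keeps zeros and poles from accumulating at the boundary.  Weierstrass
  factorization then provides a quotient whose numerator and denominator have no common zero.
\<close>

lemma sphere_holo_global_lift:
  assumes "sphere_holo (ball 0 R) \<phi>" "0 < r" "r < R"
  obtains P Q where "lift_on (ball 0 r) \<phi> P Q"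
proof -
  let ?S = "ball (0::complex) R" and ?h = "\<lambda>w. finite_part (\<phi> w)"
  have sub: "ball 0 r \<subseteq> ?S" "cball 0 r \<subseteq> ?S" using assms by auto
  from sphere_holo_dichotomy[OF assms(1) open_ball connected_ball] show ?thesis
  proof
    assume "\<forall>z\<in>?S. \<phi> z = None"
    then have "lift_on (ball 0 r) \<phi> (\<lambda>_. 1) (\<lambda>_. 0)" using sub by (auto simp: lift_on_def sphere_pt_def)
    then show ?thesis by (rule that)
  next
    assume *: "?h nicely_meromorphic_on ?S \<and> (\<forall>z\<in>?S. \<phi> z = None \<longleftrightarrow> is_pole ?h z)"
    then have nm: "?h nicely_meromorphic_on ?S" and pole: "\<And>z. z \<in> ?S \<Longrightarrow> \<phi> z = None \<longleftrightarrow> is_pole ?h z" by auto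
    from nicely_meromorphic_imp_constant_or_avoid[OF nm open_ball connected_ball, of 0]
    show ?thesis
    proof
      assume h0: "\<forall>x\<in>?S. ?h x = 0"
      have "\<not> is_pole ?h z" if z: "z \<in> ?S" for z
      proof -
        have "\<forall>\<^sub>F w in at z. ?h w = 0"
          using eventually_at_in_open'[OF open_ball z] by eventually_elim (use h0 in auto)
        from is_pole_cong[OF this refl] show ?thesis by simp
      qed
      then have "\<phi> z = Some 0" if "z \<in> ?S" for z using pole[OF that] h0 that by (metis finite_part.elims)
      then have "lift_on (ball 0 r) \<phi> (\<lambda>_. 0) (\<lambda>_. 1)" using sub by (auto simp: lift_on_def sphere_pt_def)
      then show ?thesis by (rule that)
    next
      assume "\<forall>\<^sub>\<approx>x\<in>?S. ?h x \<noteq> 0"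
      then have sp: "{x. ?h x = 0} sparse_in ?S" by (simp add: eventually_cosparse)
      have nm': "?h nicely_meromorphic_on ball 0 r" using nm sub nicely_meromorphic_on_subset by blast
      have pz: "?h z = 0" if "z \<in> ?S" "is_pole ?h z" for z using pole that by force
      have nl: "\<not> z islimpt {w \<in> ball 0 r. ?h w = 0 \<or> is_pole ?h w}" if "z \<in> frontier (ball 0 r)" for z
      proof
        assume lim: "z islimpt {w \<in> ball 0 r. ?h w = 0 \<or> is_pole ?h w}"
        have "z \<in> ?S" using that assms by simp
        moreover have "z islimpt {x. ?h x = 0}"
          by (rule islimpt_subset[OF lim]) (use pz sub in auto)
        ultimately show False using sp unfolding sparse_in_def by blast
      qed
      obtain k f1 f2 where f: "k holomorphic_on ball 0 r" "f1 holomorphic_on UNIV" "f2 holomorphic_on UNIV"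
        "\<forall>z\<in>ball 0 r. f1 z = 0 \<longleftrightarrow> \<not> is_pole ?h z \<and> ?h z = 0"
        "\<forall>z\<in>ball 0 r. f2 z = 0 \<longleftrightarrow> is_pole ?h z"
        "\<forall>z\<in>ball 0 r. k z \<noteq> 0"
        "\<forall>z\<in>ball 0 r. ?h z = k z * f1 z / f2 z"
        by (rule weierstrass_factorization_meromorphic[OF nm' open_ball connected_ball nl])
      have "lift_on (ball 0 r) \<phi> (\<lambda>z. k z * f1 z) f2"
        unfolding lift_on_def
      proof (intro conjI ballI)
        show "(\<lambda>z. k z * f1 z) holomorphic_on ball 0 r" "f2 holomorphic_on ball 0 r"
          using f(1-3) holomorphic_on_subset by (auto intro!: holomorphic_intros)
        fix z assume z: "z \<in> ball (0::complex) r"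
        then have zS: "z \<in> ?S" using sub by blast
        show "k z * f1 z \<noteq> 0 \<or> f2 z \<noteq> 0" using f z by auto
        show "\<phi> z = sphere_pt (k z * f1 z) (f2 z)"
        proof (cases "\<phi> z")
          case None
          then show ?thesis using bspec[OF f(5) z] pole[OF zS] by (simp add: sphere_pt_def)
        next
          case (Some a)
          then have "f2 z \<noteq> 0" using bspec[OF f(5) z] pole[OF zS] by simp
          moreover have "a = k z * f1 z / f2 z" using bspec[OF f(7) z] unfolding Some by simp
          ultimately show ?thesis using Some by (simp add: sphere_pt_def)
        qed
      qed
      then show ?thesis by (rule that)
    qed
  qed
qed

section \<open>Bounded lifts of separated maps\<close>

lemma Cauchy_deriv_bound_half_ball:
  assumes "f holomorphic_on ball 0 R" "0 < R" "\<And>z. z \<in> ball 0 R \<Longrightarrow> cmod (f z) \<le> K" "z \<in> ball 0 (R/2)"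
  shows "cmod (deriv f z) \<le> 4 * K / R"
proof -
  have sub: "cball z (R/4) \<subseteq> ball 0 R"
  proof
    fix w assume "w \<in> cball z (R/4)"
    then have "dist z w \<le> R/4" "dist 0 z < R/2" using assms(4) by auto
    moreover have "dist 0 w \<le> dist 0 z + dist z w" by (rule dist_triangle)
    ultimately show "w \<in> ball 0 R" using assms(2) by auto
  qed
  have "cmod ((deriv ^^ 1) f z) \<le> fact 1 * K / (R/4) ^ 1"
  proof (rule Cauchy_inequality)
    show "f holomorphic_on ball z (R/4)" using assms(1) sub ball_subset_cball holomorphic_on_subset by (meson order_trans)
    show "continuous_on (cball z (R/4)) f"
      using assms(1) sub holomorphic_on_imp_continuous_on continuous_on_subset by blast
    show "0 < R/4" using assms by simp
    show "cmod (f x) \<le> K" if "cmod (z - x) = R/4" for x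
      using that sub by (intro assms(3)) (auto simp: dist_norm)
  qed
  then show ?thesis by (simp add: field_simps)
qed

lemma separated_imp_wedge_ge:
  assumes "P \<noteq> 0 \<or> Q \<noteq> 0" "A \<noteq> 0 \<or> B \<noteq> 0"
    and "stereo (sphere_pt P Q) \<bullet> stereo (sphere_pt A B) \<le> 1 - \<kappa>"
  shows "\<kappa> / 2 * (((cmod P)\<^sup>2 + (cmod Q)\<^sup>2) * ((cmod A)\<^sup>2 + (cmod B)\<^sup>2)) \<le> (cmod (P * B - Q * A))\<^sup>2"
proof -
  have "((cmod P)\<^sup>2 + (cmod Q)\<^sup>2) * ((cmod A)\<^sup>2 + (cmod B)\<^sup>2) > 0"
    using assms(1,2) by (intro mult_pos_pos) (auto simp: sum_power2_gt_zero_iff)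
  then show ?thesis using assms(3) unfolding stereo_inner[OF assms(1,2)] by (simp add: field_simps)
qed

text \<open>
  The choice of coordinates is not continuous at \<open>\<infinity>\<close>.  It only serves to write down expressions that
  do not depend on the choice, such as \<open>proj_form\<close>.
\<close>

definition homog :: "riemann_sphere \<Rightarrow> complex \<times> complex" where
  "homog p = (case p of None \<Rightarrow> (1, 0) | Some z \<Rightarrow> (z, 1))"

lemma homog_sphere_pt:
  assumes "P \<noteq> 0 \<or> Q \<noteq> 0"
  obtains l where "l \<noteq> 0" "P = l * fst (homog (sphere_pt P Q))" "Q = l * snd (homog (sphere_pt P Q))"
proof (rule that[of "if Q = 0 then P else Q"])
qed (use assms in \<open>auto simp: homog_def sphere_pt_def\<close>)

lemma homog_nonzero: "fst (homog p) \<noteq> 0 \<or> snd (homog p) \<noteq> 0"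
  by (simp add: homog_def split: option.splits)

lemma sphere_pt_homog: "sphere_pt (fst (homog p)) (snd (homog p)) = p"
  by (simp add: homog_def sphere_pt_def split: option.splits)

text \<open>
  Up to sign, the matrix entries of the linear projection of \<open>\<complex> \<times> \<complex>\<close> onto the line \<open>a z\<close> along the line
  \<open>b z\<close>, when the coordinate functions \<open>\<pi>\<close> and \<open>\<pi>'\<close> run through \<open>fst\<close> and \<open>snd\<close>.
\<close>

definition proj_form :: "(complex \<Rightarrow> riemann_sphere) \<Rightarrow> (complex \<Rightarrow> riemann_sphere) \<Rightarrow>
    (complex \<times> complex \<Rightarrow> complex) \<Rightarrow> (complex \<times> complex \<Rightarrow> complex) \<Rightarrow> complex \<Rightarrow> complex" where
  "proj_form a b \<pi> \<pi>' z = \<pi> (homog (a z)) * \<pi>' (homog (b z)) /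
     (fst (homog (a z)) * snd (homog (b z)) - snd (homog (a z)) * fst (homog (b z)))"

text \<open>
  Rescaling the coordinates of \<open>a z\<close> or \<open>b z\<close> changes numerator and denominator by the same factor, so
  holomorphic lifts may replace the discontinuous choice.
\<close>

lemma proj_form_holomorphic:
  assumes a: "sphere_holo S a" and b: "sphere_holo S b"
    and ne: "\<And>z. z \<in> S \<Longrightarrow> a z \<noteq> b z"
    and \<pi>: "\<pi> = fst \<or> \<pi> = snd" and \<pi>': "\<pi>' = fst \<or> \<pi>' = snd"
  shows "proj_form a b \<pi> \<pi>' analytic_on S"
proof (subst analytic_on_analytic_at, rule ballI)
  fix z assume z: "z \<in> S"
  obtain r1 P Q where 1: "r1 > 0" "ball z r1 \<subseteq> S" "lift_on (ball z r1) a P Q"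
    using a z by (meson sphere_holo_def)
  obtain r2 A B where 2: "r2 > 0" "ball z r2 \<subseteq> S" "lift_on (ball z r2) b A B"
    using b z by (meson sphere_holo_def)
  define U where "U = ball z (min r1 r2)"
  have U: "open U" "z \<in> U" "U \<subseteq> S" using 1 2 by (auto simp: U_def)
  have l: "lift_on U a P Q" "lift_on U b A B" using 1(3) 2(3) by (auto intro: lift_on_subset simp: U_def)
  then have hol: "P holomorphic_on U" "Q holomorphic_on U" "A holomorphic_on U" "B holomorphic_on U"
    by (auto simp: lift_on_def)
  have key: "P w * B w - Q w * A w \<noteq> 0 \<and>
     proj_form a b \<pi> \<pi>' w = \<pi> (P w, Q w) * \<pi>' (A w, B w) / (P w * B w - Q w * A w)" if w: "w \<in> U" for w
  proof
    have nz: "P w \<noteq> 0 \<or> Q w \<noteq> 0" "A w \<noteq> 0 \<or> B w \<noteq> 0" and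
      ab: "a w = sphere_pt (P w) (Q w)" "b w = sphere_pt (A w) (B w)"
      using l w by (auto simp: lift_on_def)
    show d: "P w * B w - Q w * A w \<noteq> 0" using ne[of w] w U ab sphere_pt_eq_iff[OF nz] by auto
    obtain k where k: "k \<noteq> 0" "P w = k * fst (homog (a w))" "Q w = k * snd (homog (a w))"
      using homog_sphere_pt[OF nz(1)] ab by metis
    obtain m where m: "m \<noteq> 0" "A w = m * fst (homog (b w))" "B w = m * snd (homog (b w))"
      using homog_sphere_pt[OF nz(2)] ab by metis
    have "P w * B w - Q w * A w = (k * m) * (fst (homog (a w)) * snd (homog (b w)) - snd (homog (a w)) * fst (homog (b w)))"
      unfolding k(2,3) m(2,3) by (simp add: algebra_simps)
    moreover have "\<pi> (P w, Q w) * \<pi>' (A w, B w) = (k * m) * (\<pi> (homog (a w)) * \<pi>' (homog (b w)))"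
      unfolding k(2,3) m(2,3) using \<pi> \<pi>' by auto
    ultimately show "proj_form a b \<pi> \<pi>' w = \<pi> (P w, Q w) * \<pi>' (A w, B w) / (P w * B w - Q w * A w)"
      using k(1) m(1) by (simp add: proj_form_def)
  qed
  have "(\<lambda>w. \<pi> (P w, Q w) * \<pi>' (A w, B w) / (P w * B w - Q w * A w)) holomorphic_on U"
    using \<pi> \<pi>' key by (auto intro!: holomorphic_intros hol)
  then have "proj_form a b \<pi> \<pi>' holomorphic_on U"
    by (subst holomorphic_cong[OF refl]) (use key in auto)
  then show "proj_form a b \<pi> \<pi>' analytic_on {z}" using U by (auto simp: analytic_at)
qed

text \<open>
  The projection matrix has entries bounded by \<open>K\<close> and trace 1.  One of its diagonal entries is
  therefore at least \<open>1/2\<close> at the centre, and by the Cauchy estimate at least \<open>1/4\<close> on the disc of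
  radius \<open>r\<close>.  The column of this entry spans the line \<open>a z\<close>; dividing it by the diagonal entry gives a
  lift with one coordinate equal to 1.
\<close>

lemma separated_bounded_lift:
  assumes R: "0 < R" and \<kappa>: "0 < \<kappa>" and a: "sphere_holo (ball 0 R) a" and b: "sphere_holo (ball 0 R) b"
    and sep: "\<And>z. z \<in> ball 0 R \<Longrightarrow> stereo (a z) \<bullet> stereo (b z) \<le> 1 - \<kappa>"
    and K: "K = sqrt (2 / \<kappa>)" and r: "r = R / (16 * K)"
  shows "1/2 \<le> K"
    and "\<exists>P Q. lift_on (ball 0 r) a P Q \<and>
       (\<forall>z\<in>ball 0 r. cmod (P z) \<le> 4 * K \<and> cmod (Q z) \<le> 4 * K \<and> (P z = 1 \<or> Q z = 1))"
proof -
  let ?S = "ball (0::complex) R"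
  have K0: "K > 0" using \<kappa> by (simp add: K)
  have ne: "a z \<noteq> b z" if "z \<in> ?S" for z
    using sep[OF that] \<kappa> by (auto simp: dot_square_norm)
  have bound: "cmod (proj_form a b \<pi> \<pi>' z) \<le> K"
    if z: "z \<in> ?S" and \<pi>: "\<pi> = fst \<or> \<pi> = snd" and \<pi>': "\<pi>' = fst \<or> \<pi>' = snd" for z \<pi> \<pi>'
  proof -
    define p q where "p = homog (a z)" and "q = homog (b z)"
    define N M where "N = (cmod (fst p))\<^sup>2 + (cmod (snd p))\<^sup>2" and "M = (cmod (fst q))\<^sup>2 + (cmod (snd q))\<^sup>2"
    define d where "d = cmod (fst p * snd q - snd p * fst q)"
    have pq: "fst p \<noteq> 0 \<or> snd p \<noteq> 0" "fst q \<noteq> 0 \<or> snd q \<noteq> 0" unfolding p_def q_def by (rule homog_nonzero)+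
    have le: "\<kappa> / 2 * (N * M) \<le> d\<^sup>2"
      unfolding N_def M_def d_def
      by (rule separated_imp_wedge_ge[OF pq]) (use sep[OF z] in \<open>simp add: p_def q_def sphere_pt_homog\<close>)
    have NM: "N > 0" "M > 0" using pq by (auto simp: N_def M_def sum_power2_gt_zero_iff)
    have "(cmod (\<pi> p))\<^sup>2 \<le> N" "(cmod (\<pi>' q))\<^sup>2 \<le> M" using \<pi> \<pi>' by (auto simp: N_def M_def)
    then have "(cmod (\<pi> p))\<^sup>2 * (cmod (\<pi>' q))\<^sup>2 \<le> N * M" using NM by (intro mult_mono) auto
    also have "N * M \<le> 2 / \<kappa> * d\<^sup>2" using le \<kappa> by (simp add: field_simps)
    finally have "(cmod (\<pi> p))\<^sup>2 * (cmod (\<pi>' q))\<^sup>2 \<le> 2 / \<kappa> * d\<^sup>2" .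
    moreover have "0 < \<kappa> / 2 * (N * M)" using NM \<kappa> by simp
    then have "d\<^sup>2 > 0" using le by linarith
    ultimately have "(cmod (\<pi> p))\<^sup>2 * (cmod (\<pi>' q))\<^sup>2 \<le> 2 / \<kappa> * d\<^sup>2" "d\<^sup>2 > 0" by blast+
    then have "(cmod (\<pi> p) * cmod (\<pi>' q))\<^sup>2 \<le> (K * d)\<^sup>2" and d0: "d > 0"
      using \<kappa> by (auto simp: K power_mult_distrib d_def)
    from this(1) have "cmod (\<pi> p) * cmod (\<pi>' q) \<le> K * d"
      by (rule power2_le_imp_le) (use K0 d0 in simp)
    then show ?thesis using \<open>d > 0\<close>
      by (simp add: proj_form_def norm_mult norm_divide p_def[symmetric] q_def[symmetric] d_def[symmetric] divide_le_eq)
  qed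
  define e1 e2 e3 e4 where "e1 = proj_form a b fst snd" and "e2 z = - proj_form a b fst fst z"
    and "e3 = proj_form a b snd snd" and "e4 z = - proj_form a b snd fst z" for z
  have e_bd: "cmod (e1 z) \<le> K" "cmod (e2 z) \<le> K" "cmod (e3 z) \<le> K" "cmod (e4 z) \<le> K" if "z \<in> ?S" for z
    using bound[OF that] by (auto simp: e1_def e2_def e3_def e4_def)
  have e_hol: "e1 holomorphic_on ?S" "e2 holomorphic_on ?S" "e3 holomorphic_on ?S" "e4 holomorphic_on ?S"
  proof -
    have "proj_form a b \<pi> \<pi>' holomorphic_on ?S"
      if "\<pi> = fst \<or> \<pi> = snd" "\<pi>' = fst \<or> \<pi>' = snd" for \<pi> \<pi>'
      using proj_form_holomorphic[OF a b ne that] analytic_imp_holomorphic by blast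
    then show "e1 holomorphic_on ?S" "e2 holomorphic_on ?S" "e3 holomorphic_on ?S" "e4 holomorphic_on ?S"
      unfolding e1_def e2_def e3_def e4_def by (simp_all add: holomorphic_on_minus)
  qed
  have delta: "fst (homog (a z)) * snd (homog (b z)) - snd (homog (a z)) * fst (homog (b z)) \<noteq> 0" if "z \<in> ?S" for z
  proof
    assume "fst (homog (a z)) * snd (homog (b z)) - snd (homog (a z)) * fst (homog (b z)) = 0"
    then have "a z = b z"
      using sphere_pt_eq_iff[OF homog_nonzero[of "a z"] homog_nonzero[of "b z"]] by (simp add: sphere_pt_homog)
    with ne[OF that] show False by simp
  qed
  have trace: "e1 z + e4 z = 1" if "z \<in> ?S" for z
    using delta[OF that] by (simp add: e1_def e4_def proj_form_def flip: diff_divide_distrib)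
  have col1: "a z = sphere_pt 1 (e3 z / e1 z)" if "z \<in> ?S" "e1 z \<noteq> 0" for z
  proof -
    have "a z = sphere_pt (fst (homog (a z))) (snd (homog (a z)))" by (simp add: sphere_pt_homog)
    also have "\<dots> = sphere_pt 1 (e3 z / e1 z)"
      using that delta[OF that(1)] homog_nonzero[of "a z"]
      by (subst sphere_pt_eq_iff) (auto simp: e1_def e3_def proj_form_def)
    finally show ?thesis .
  qed
  have col2: "a z = sphere_pt (e2 z / e4 z) 1" if "z \<in> ?S" "e4 z \<noteq> 0" for z
  proof -
    have "a z = sphere_pt (fst (homog (a z))) (snd (homog (a z)))" by (simp add: sphere_pt_homog)
    also have "\<dots> = sphere_pt (e2 z / e4 z) 1"
      using that delta[OF that(1)] homog_nonzero[of "a z"]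
      by (subst sphere_pt_eq_iff) (auto simp: e2_def e4_def proj_form_def)
    finally show ?thesis .
  qed
  have 0: "0 \<in> ?S" using R by simp
  have "1 \<le> cmod (e1 0) + cmod (e4 0)" using trace[OF 0] norm_triangle_ineq[of "e1 0" "e4 0"] by simp
  then have half: "1/2 \<le> cmod (e1 0) \<or> 1/2 \<le> cmod (e4 0)" by linarith
  then show K12: "1/2 \<le> K" using e_bd[OF 0] by linarith
  have r8: "r \<le> R / 8" "r > 0" using K12 R by (auto simp: r field_simps)
  have sub: "ball 0 r \<subseteq> ?S" using r8 R by auto
  have quarter: "cmod (e z) \<ge> 1/4" if e: "e holomorphic_on ?S" "\<And>z. z \<in> ?S \<Longrightarrow> cmod (e z) \<le> K" "1/2 \<le> cmod (e 0)"
    and z: "z \<in> ball 0 r" for e z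
  proof -
    have zz: "z \<in> ball 0 (R/2)" using z r8 R by auto
    have "cmod (e z - e 0) \<le> (4 * K / R) * cmod (z - 0)"
    proof (rule field_differentiable_bound[of "ball 0 (R/2)"])
      show "(e has_field_derivative deriv e w) (at w within ball 0 (R/2))" if "w \<in> ball 0 (R/2)" for w
      proof -
        have "w \<in> ?S" using that R by auto
        then show ?thesis by (rule has_field_derivative_at_within[OF holomorphic_derivI[OF e(1) open_ball]])
      qed
      show "cmod (deriv e w) \<le> 4 * K / R" if "w \<in> ball 0 (R/2)" for w
        by (rule Cauchy_deriv_bound_half_ball[OF e(1) R e(2) that])
    qed (use zz R in auto)
    also have "\<dots> \<le> (4 * K / R) * r" using z K0 R by (intro mult_left_mono) auto
    also have "\<dots> = 1/4" using K0 R by (simp add: r)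
    finally have "cmod (e z - e 0) \<le> 1/4" .
    moreover have "cmod (e 0) \<le> cmod (e z) + cmod (e z - e 0)"
      using norm_triangle_ineq4[of "e z" "e z - e 0"] by simp
    ultimately show ?thesis using e(3) by linarith
  qed
  have quot: "cmod (x / y) \<le> 4 * K" if "cmod x \<le> K" "1/4 \<le> cmod y" for x y
  proof -
    have "cmod y > 0" using that by linarith
    then have "cmod (x / y) = cmod x / cmod y" by (simp add: norm_divide)
    also have "\<dots> \<le> K / (1/4)" using that K0 by (intro frac_le) auto
    finally show ?thesis by simp
  qed
  from half show "\<exists>P Q. lift_on (ball 0 r) a P Q \<and>
       (\<forall>z\<in>ball 0 r. cmod (P z) \<le> 4 * K \<and> cmod (Q z) \<le> 4 * K \<and> (P z = 1 \<or> Q z = 1))"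
  proof
    assume "1/2 \<le> cmod (e1 0)"
    then have q: "1/4 \<le> cmod (e1 z)" if "z \<in> ball 0 r" for z
      using quarter[OF e_hol(1) e_bd(1) _ that] by blast
    then have nz: "e1 z \<noteq> 0" if "z \<in> ball 0 r" for z using that by fastforce
    have "lift_on (ball 0 r) a (\<lambda>_. 1) (\<lambda>z. e3 z / e1 z)"
      unfolding lift_on_def using nz col1 sub
      by (intro conjI ballI holomorphic_on_const holomorphic_on_divide
          holomorphic_on_subset[OF e_hol(1) sub] holomorphic_on_subset[OF e_hol(3) sub]) (auto simp: subset_iff)
    moreover have "cmod (e3 z / e1 z) \<le> 4 * K" if "z \<in> ball 0 r" for z
      using e_bd(3)[of z] q[OF that] sub that by (intro quot) auto
    ultimately show ?thesis using K12 by (intro exI[of _ "\<lambda>_. 1"] exI[of _ "\<lambda>z. e3 z / e1 z"]) auto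
  next
    assume "1/2 \<le> cmod (e4 0)"
    then have q: "1/4 \<le> cmod (e4 z)" if "z \<in> ball 0 r" for z
      using quarter[OF e_hol(4) e_bd(4) _ that] by blast
    then have nz: "e4 z \<noteq> 0" if "z \<in> ball 0 r" for z using that by fastforce
    have "lift_on (ball 0 r) a (\<lambda>z. e2 z / e4 z) (\<lambda>_. 1)"
      unfolding lift_on_def using nz col2 sub
      by (intro conjI ballI holomorphic_on_const holomorphic_on_divide
          holomorphic_on_subset[OF e_hol(2) sub] holomorphic_on_subset[OF e_hol(4) sub]) (auto simp: subset_iff)
    moreover have "cmod (e2 z / e4 z) \<le> 4 * K" if "z \<in> ball 0 r" for z
      using e_bd(2)[of z] q[OF that] sub that by (intro quot) auto
    ultimately show ?thesis using K12 by (intro exI[of _ "\<lambda>z. e2 z / e4 z"] exI[of _ "\<lambda>_. 1"]) auto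
  qed
qed

section \<open>A uniform bound for the spherical derivative\<close>

text \<open>
  The hypothesis bounds the spherical derivative of \<open>\<phi>\<close> by \<open>2 C\<close>.  The chordal distance of \<open>\<phi> x\<close> and
  \<open>\<phi> y\<close>, divided by \<open>|x - y|\<close>, tends to this derivative, so it is smaller than \<open>2 C + 1\<close> when \<open>y\<close> is near \<open>x\<close>; the
  extra 1 makes the inequality strict.  The Bolzano principle chains these local estimates along a segment.
\<close>

lemma stereo_lipschitz:
  assumes lift: "lift_on (ball 0 r) \<phi> P Q" and \<rho>: "\<rho> \<le> r" and C: "C \<ge> 0"
    and bd: "\<And>z. z \<in> ball 0 \<rho> \<Longrightarrow> cmod (deriv P z * Q z - P z * deriv Q z) \<le> C * ((cmod (P z))\<^sup>2 + (cmod (Q z))\<^sup>2)"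
    and zw: "z \<in> ball 0 \<rho>" "w \<in> ball 0 \<rho>"
  shows "norm (stereo (\<phi> z) - stereo (\<phi> w)) \<le> (2 * C + 1) * cmod (z - w)"
proof -
  have hol: "P holomorphic_on ball 0 r" "Q holomorphic_on ball 0 r" using lift by (auto simp: lift_on_def)
  define N where "N z = (cmod (P z))\<^sup>2 + (cmod (Q z))\<^sup>2" for z
  have loc: "\<exists>d>0. \<forall>y. dist y x < d \<longrightarrow> norm (stereo (\<phi> x) - stereo (\<phi> y)) \<le> (2 * C + 1) * cmod (x - y)"
    if x: "x \<in> ball 0 \<rho>" for x
  proof -
    have xr: "x \<in> ball 0 r" using x \<rho> by auto
    have nz: "P y \<noteq> 0 \<or> Q y \<noteq> 0" "\<phi> y = sphere_pt (P y) (Q y)" if "y \<in> ball 0 r" for y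
      using lift that by (auto simp: lift_on_def)
    have Np: "N y > 0" if "y \<in> ball 0 r" for y using nz[OF that] by (auto simp: N_def sum_power2_gt_zero_iff)
    define D where "D = P x * deriv Q x - Q x * deriv P x"
    have cont: "isCont P x" "isCont Q x" using hol xr holomorphic_isCont by blast+
    have "((\<lambda>y. P x * Q y - Q x * P y) has_field_derivative D) (at x)"
      unfolding D_def using holomorphic_derivI[OF hol(1) open_ball xr] holomorphic_derivI[OF hol(2) open_ball xr]
      by (auto intro!: derivative_eq_intros)
    then have lim: "((\<lambda>y. (P x * Q y - Q x * P y) / (y - x)) \<longlongrightarrow> D) (at x)"
      by (simp add: has_field_derivative_iff mult.commute)
    have "((\<lambda>y. N y) \<longlongrightarrow> N x) (at x)"
      unfolding N_def using cont by (intro tendsto_intros) (auto simp: isCont_def)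
    then have "((\<lambda>y. 2 * cmod ((P x * Q y - Q x * P y) / (y - x)) / (sqrt (N x) * sqrt (N y))) \<longlongrightarrow>
       2 * cmod D / (sqrt (N x) * sqrt (N x))) (at x)"
      using Np[OF xr] by (intro tendsto_intros lim) auto
    moreover have "2 * cmod D / (sqrt (N x) * sqrt (N x)) < 2 * C + 1"
    proof -
      have "cmod D = cmod (deriv P x * Q x - P x * deriv Q x)"
        unfolding D_def by (subst norm_minus_commute) (simp add: mult.commute)
      then have "cmod D \<le> C * N x" using bd[OF x] by (simp add: N_def)
      then have "2 * cmod D / N x \<le> 2 * C" using Np[OF xr] by (simp add: field_simps)
      then show ?thesis using Np[OF xr] by simp
    qed
    ultimately have "\<forall>\<^sub>F y in at x. 2 * cmod ((P x * Q y - Q x * P y) / (y - x)) / (sqrt (N x) * sqrt (N y)) < 2 * C + 1"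
      by (rule order_tendstoD)
    moreover have "\<forall>\<^sub>F y in at x. y \<in> ball 0 r - {x}" using xr eventually_at_in_open[OF open_ball] by blast
    ultimately have "\<forall>\<^sub>F y in at x. norm (stereo (\<phi> x) - stereo (\<phi> y)) \<le> (2 * C + 1) * cmod (x - y)"
    proof eventually_elim
      case (elim y)
      have y: "y \<in> ball 0 r" "cmod (y - x) > 0" using elim by auto
      have "norm (stereo (\<phi> x) - stereo (\<phi> y)) = 2 * cmod (P x * Q y - Q x * P y) / (sqrt (N x) * sqrt (N y))"
        using nz[OF xr] nz[OF y(1)] norm_stereo_diff by (simp add: N_def)
      also have "\<dots> = 2 * cmod ((P x * Q y - Q x * P y) / (y - x)) / (sqrt (N x) * sqrt (N y)) * cmod (y - x)"
        using y(2) by (simp add: norm_divide)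
      also have "\<dots> \<le> (2 * C + 1) * cmod (y - x)"
        using elim(1) by (intro mult_right_mono) auto
      finally show ?case by (simp add: norm_minus_commute)
    qed
    then obtain d where d: "d > 0" "\<And>y. y \<noteq> x \<Longrightarrow> dist y x < d \<Longrightarrow> norm (stereo (\<phi> x) - stereo (\<phi> y)) \<le> (2 * C + 1) * cmod (x - y)"
      unfolding eventually_at by auto
    have "norm (stereo (\<phi> x) - stereo (\<phi> y)) \<le> (2 * C + 1) * cmod (x - y)" if "dist y x < d" for y
      using d(2)[of y] that by (cases "y = x") auto
    then show ?thesis using d(1) by blast
  qed
  define L where "L = (2 * C + 1) * cmod (w - z)"
  define \<gamma> where "\<gamma> t = z + of_real t * (w - z)" for t :: real
  have \<gamma>_dist: "cmod (\<gamma> s - \<gamma> t) = \<bar>s - t\<bar> * cmod (w - z)" for s t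
  proof -
    have "\<gamma> s - \<gamma> t = of_real (s - t) * (w - z)" by (simp add: \<gamma>_def algebra_simps)
    then show ?thesis by (simp only: norm_mult norm_of_real)
  qed
  have \<gamma>_in: "\<gamma> t \<in> ball 0 \<rho>" if "0 \<le> t" "t \<le> 1" for t
  proof -
    have "\<gamma> t = (1 - t) *\<^sub>R z + t *\<^sub>R w" by (simp add: \<gamma>_def scaleR_conv_of_real algebra_simps)
    then show ?thesis using convexD[OF convex_ball zw] that by auto
  qed
  have "norm (stereo (\<phi> (\<gamma> 0)) - stereo (\<phi> (\<gamma> 1))) \<le> L * (1 - 0)"
  proof (rule Bolzano[of 0 1 "\<lambda>a b. norm (stereo (\<phi> (\<gamma> a)) - stereo (\<phi> (\<gamma> b))) \<le> L * (b - a)"])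
    fix a b c :: real
    assume "norm (stereo (\<phi> (\<gamma> a)) - stereo (\<phi> (\<gamma> b))) \<le> L * (b - a)"
      "norm (stereo (\<phi> (\<gamma> b)) - stereo (\<phi> (\<gamma> c))) \<le> L * (c - b)"
    moreover have "norm (stereo (\<phi> (\<gamma> a)) - stereo (\<phi> (\<gamma> c))) \<le>
      norm (stereo (\<phi> (\<gamma> a)) - stereo (\<phi> (\<gamma> b))) + norm (stereo (\<phi> (\<gamma> b)) - stereo (\<phi> (\<gamma> c)))"
      using norm_triangle_ineq[of "stereo (\<phi> (\<gamma> a)) - stereo (\<phi> (\<gamma> b))" "stereo (\<phi> (\<gamma> b)) - stereo (\<phi> (\<gamma> c))"] by simp
    ultimately show "norm (stereo (\<phi> (\<gamma> a)) - stereo (\<phi> (\<gamma> c))) \<le> L * (c - a)"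
      by (simp add: algebra_simps)
  next
    fix x :: real assume x: "0 \<le> x" "x \<le> 1"
    obtain d where d: "d > 0" "\<And>y. dist y (\<gamma> x) < d \<Longrightarrow> norm (stereo (\<phi> (\<gamma> x)) - stereo (\<phi> y)) \<le> (2 * C + 1) * cmod (\<gamma> x - y)"
      using loc[OF \<gamma>_in[OF x]] by blast
    define e where "e = d / (cmod (w - z) + 1)"
    have e: "e > 0" using d(1) by (simp add: e_def add_nonneg_pos)
    have near: "norm (stereo (\<phi> (\<gamma> x)) - stereo (\<phi> (\<gamma> t))) \<le> L * \<bar>x - t\<bar>" if t: "\<bar>x - t\<bar> < e" for t
    proof -
      have "dist (\<gamma> t) (\<gamma> x) = \<bar>t - x\<bar> * cmod (w - z)" by (simp add: dist_norm \<gamma>_dist)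
      also have "\<dots> \<le> \<bar>t - x\<bar> * (cmod (w - z) + 1)" by (intro mult_left_mono) auto
      also have "\<dots> < e * (cmod (w - z) + 1)" using t by (intro mult_strict_right_mono) (auto simp: add_nonneg_pos)
      also have "\<dots> = d" by (simp add: e_def add_nonneg_eq_0_iff)
      finally have "norm (stereo (\<phi> (\<gamma> x)) - stereo (\<phi> (\<gamma> t))) \<le> (2 * C + 1) * cmod (\<gamma> x - \<gamma> t)" by (rule d(2))
      then show ?thesis by (simp add: \<gamma>_dist L_def mult_ac)
    qed
    show "\<exists>d>0. \<forall>a b. a \<le> x \<and> x \<le> b \<and> b - a < d \<longrightarrow> norm (stereo (\<phi> (\<gamma> a)) - stereo (\<phi> (\<gamma> b))) \<le> L * (b - a)"
    proof (intro exI[of _ e] conjI e allI impI)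
      fix a b assume ab: "a \<le> x \<and> x \<le> b \<and> b - a < e"
      have "norm (stereo (\<phi> (\<gamma> a)) - stereo (\<phi> (\<gamma> b))) \<le>
        norm (stereo (\<phi> (\<gamma> x)) - stereo (\<phi> (\<gamma> a))) + norm (stereo (\<phi> (\<gamma> x)) - stereo (\<phi> (\<gamma> b)))"
        using norm_triangle_ineq4[of "stereo (\<phi> (\<gamma> x)) - stereo (\<phi> (\<gamma> b))" "stereo (\<phi> (\<gamma> x)) - stereo (\<phi> (\<gamma> a))"] by simp
      also have "\<dots> \<le> L * \<bar>x - a\<bar> + L * \<bar>x - b\<bar>" using ab by (intro add_mono near) auto
      also have "\<dots> = L * (b - a)" using ab by (simp add: algebra_simps)
      finally show "norm (stereo (\<phi> (\<gamma> a)) - stereo (\<phi> (\<gamma> b))) \<le> L * (b - a)" .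
    qed
  qed auto
  then show ?thesis by (simp add: L_def \<gamma>_def norm_minus_commute)
qed

lemma vanishes_to_order_mult:
  assumes "vanishes_to_order m h z" "g analytic_on {z}"
  shows "vanishes_to_order m (\<lambda>w. h w * g w) z"
proof -
  obtain k where k: "k analytic_on {z}" "\<forall>\<^sub>F w in nhds z. h w = (w - z) ^ m * k w"
    using assms(1) by (auto simp: vanishes_to_order_def)
  have "\<forall>\<^sub>F w in nhds z. h w * g w = (w - z) ^ m * (k w * g w)"
    using k(2) by eventually_elim simp
  moreover have "(\<lambda>w. k w * g w) analytic_on {z}" by (rule analytic_on_mult[OF k(1) assms(2)])
  ultimately show ?thesis unfolding vanishes_to_order_def by blast
qed

text \<open>
  On a disc of radius \<open>r\<close> the targets have lifts with coordinates bounded by \<open>M\<close> and derivatives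
  bounded by \<open>D\<close>, and their mutual determinants have modulus at least \<open>1 / K\<close>.  All constants depend only on
  \<open>R\<close> and \<open>\<kappa>\<close>.  Up to terms of size \<open>|P|\<^sup>2 + |Q|\<^sup>2\<close>, the Wronskian of \<open>X\<^sub>1\<close> and \<open>X\<^sub>2\<close> is therefore
  the Wronskian of \<open>[f, a\<^sub>1]\<close> and \<open>[f, a\<^sub>2]\<close> multiplied by two determinants of targets, and the
  latter Wronskian is \<open>P' Q - P Q'\<close> multiplied by a third one.  So the bound of \<open>ahlfors_bound_433\<close> carries over to
  \<open>P' Q - P Q'\<close>.
\<close>

lemma spherical_derivative_bound:
  fixes R \<kappa> :: real
  assumes R: "0 < R" and \<kappa>: "0 < \<kappa>"
  shows "\<exists>C r. 0 \<le> C \<and> 0 < r \<and> (\<forall>\<phi> a1 a2 a3.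
     sphere_holo (ball 0 R) \<phi> \<longrightarrow> sphere_holo (ball 0 R) a1 \<longrightarrow> sphere_holo (ball 0 R) a2 \<longrightarrow> sphere_holo (ball 0 R) a3 \<longrightarrow>
     (\<forall>z\<in>ball 0 R. stereo (a1 z) \<bullet> stereo (a2 z) \<le> 1 - \<kappa> \<and> stereo (a2 z) \<bullet> stereo (a3 z) \<le> 1 - \<kappa>
        \<and> stereo (a3 z) \<bullet> stereo (a1 z) \<le> 1 - \<kappa>) \<longrightarrow>
     contact_ge 4 \<phi> a1 (ball 0 R) \<longrightarrow> contact_ge 3 \<phi> a2 (ball 0 R) \<longrightarrow> contact_ge 3 \<phi> a3 (ball 0 R) \<longrightarrow>
     (\<exists>P Q. lift_on (ball 0 r) \<phi> P Q \<and> (\<forall>z\<in>ball 0 (r/4).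
        cmod (deriv P z * Q z - P z * deriv Q z) \<le> C * ((cmod (P z))\<^sup>2 + (cmod (Q z))\<^sup>2))))"
proof -
  define K where "K = sqrt (2 / \<kappa>)"
  define r where "r = R / (16 * K)"
  define M where "M = 4 * K"
  define D where "D = 4 * M / r"
  define C1 where "C1 = 118 * 1296 * M ^ 6 / r"
  define C2 where "C2 = K\<^sup>2 * (C1 + 64 * M ^ 5 * D)"
  define C3 where "C3 = K * (C2 + 8 * D * M)"
  have K0: "K > 0" using \<kappa> by (simp add: K_def)
  have r0: "r > 0" using R K0 by (simp add: r_def)
  have pos: "M > 0" "D > 0" "C1 > 0" "C2 > 0" "C3 > 0"
    using K0 r0 by (simp_all add: M_def D_def C1_def C2_def C3_def add_pos_pos)
  show ?thesis
  proof (rule exI[of _ "2 * C3"], rule exI[of _ r], intro conjI allI impI)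
    show "0 \<le> 2 * C3" using pos by simp
    show "0 < r" by fact
    fix \<phi> a1 a2 a3
    assume sh: "sphere_holo (ball 0 R) \<phi>" "sphere_holo (ball 0 R) a1" "sphere_holo (ball 0 R) a2" "sphere_holo (ball 0 R) a3"
      and sep: "\<forall>z\<in>ball 0 R. stereo (a1 z) \<bullet> stereo (a2 z) \<le> 1 - \<kappa> \<and> stereo (a2 z) \<bullet> stereo (a3 z) \<le> 1 - \<kappa>
        \<and> stereo (a3 z) \<bullet> stereo (a1 z) \<le> 1 - \<kappa>"
      and ct: "contact_ge 4 \<phi> a1 (ball 0 R)" "contact_ge 3 \<phi> a2 (ball 0 R)" "contact_ge 3 \<phi> a3 (ball 0 R)"
    let ?T = "ball (0::complex) r"
    have sep12: "\<And>z. z \<in> ball 0 R \<Longrightarrow> stereo (a1 z) \<bullet> stereo (a2 z) \<le> 1 - \<kappa>"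
      and sep23: "\<And>z. z \<in> ball 0 R \<Longrightarrow> stereo (a2 z) \<bullet> stereo (a3 z) \<le> 1 - \<kappa>"
      and sep31: "\<And>z. z \<in> ball 0 R \<Longrightarrow> stereo (a3 z) \<bullet> stereo (a1 z) \<le> 1 - \<kappa>"
      using sep by auto
    have K12: "1/2 \<le> K" by (rule separated_bounded_lift(1)[OF R \<kappa> sh(2,3) sep12 K_def r_def])
    have "R / (16 * K) \<le> R / 8" using K12 R by (intro divide_left_mono) auto
    then have rR: "r < R" using R by (simp add: r_def)
    then have TR: "?T \<subseteq> ball 0 R" by auto
    obtain p1 q1 where l1: "lift_on ?T a1 p1 q1"
      and b1: "\<forall>z\<in>?T. cmod (p1 z) \<le> 4 * K \<and> cmod (q1 z) \<le> 4 * K \<and> (p1 z = 1 \<or> q1 z = 1)"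
      using separated_bounded_lift(2)[OF R \<kappa> sh(2,3) sep12 K_def r_def] by blast
    obtain p2 q2 where l2: "lift_on ?T a2 p2 q2"
      and b2: "\<forall>z\<in>?T. cmod (p2 z) \<le> 4 * K \<and> cmod (q2 z) \<le> 4 * K \<and> (p2 z = 1 \<or> q2 z = 1)"
      using separated_bounded_lift(2)[OF R \<kappa> sh(3,4) sep23 K_def r_def] by blast
    obtain p3 q3 where l3: "lift_on ?T a3 p3 q3"
      and b3: "\<forall>z\<in>?T. cmod (p3 z) \<le> 4 * K \<and> cmod (q3 z) \<le> 4 * K \<and> (p3 z = 1 \<or> q3 z = 1)"
      using separated_bounded_lift(2)[OF R \<kappa> sh(4,2) sep31 K_def r_def] by blast
    obtain P Q where lf: "lift_on ?T \<phi> P Q"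
      using sphere_holo_global_lift[OF sh(1) r0 rR] by blast
    have hol: "P holomorphic_on ?T" "Q holomorphic_on ?T" "p1 holomorphic_on ?T" "q1 holomorphic_on ?T"
      "p2 holomorphic_on ?T" "q2 holomorphic_on ?T" "p3 holomorphic_on ?T" "q3 holomorphic_on ?T"
      using lf l1 l2 l3 by (auto simp: lift_on_def)
    have bM: "cmod (p1 z) \<le> M" "cmod (q1 z) \<le> M" "cmod (p2 z) \<le> M" "cmod (q2 z) \<le> M" "cmod (p3 z) \<le> M" "cmod (q3 z) \<le> M"
      if "z \<in> ?T" for z using b1 b2 b3 that by (auto simp: M_def)
    have wedge_lower: "1 / K \<le> cmod (A z * B' z - B z * A' z)"
      if "lift_on ?T a A B" "lift_on ?T b A' B'" "\<And>z. z \<in> ball 0 R \<Longrightarrow> stereo (a z) \<bullet> stereo (b z) \<le> 1 - \<kappa>"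
        "A z = 1 \<or> B z = 1" "A' z = 1 \<or> B' z = 1" "z \<in> ?T" for a b A B A' B' z
    proof -
      have nz: "A z \<noteq> 0 \<or> B z \<noteq> 0" "A' z \<noteq> 0 \<or> B' z \<noteq> 0" using that(4,5) by auto
      have "1 * 1 \<le> ((cmod (A z))\<^sup>2 + (cmod (B z))\<^sup>2) * ((cmod (A' z))\<^sup>2 + (cmod (B' z))\<^sup>2)"
        using that(4,5) by (intro mult_mono) auto
      then have "\<kappa> / 2 * (1 * 1) \<le> \<kappa> / 2 * (((cmod (A z))\<^sup>2 + (cmod (B z))\<^sup>2) * ((cmod (A' z))\<^sup>2 + (cmod (B' z))\<^sup>2))"
        using \<kappa> by (intro mult_left_mono) auto
      also have "\<dots> \<le> (cmod (A z * B' z - B z * A' z))\<^sup>2"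
      proof (rule separated_imp_wedge_ge[OF nz])
        have "a z = sphere_pt (A z) (B z)" "b z = sphere_pt (A' z) (B' z)"
          using that(1,2,6) unfolding lift_on_def by blast+
        then show "stereo (sphere_pt (A z) (B z)) \<bullet> stereo (sphere_pt (A' z) (B' z)) \<le> 1 - \<kappa>"
          using that(3)[of z] that(6) TR by auto
      qed
      also have "\<kappa> / 2 * (1 * 1) = (1 / K)\<^sup>2" using \<kappa> by (simp add: K_def power_divide)
      finally show ?thesis by (rule power2_le_imp_le) simp
    qed
    have w12: "1 / K \<le> cmod (p1 z * q2 z - q1 z * p2 z)" if "z \<in> ?T" for z
      using wedge_lower[OF l1 l2 sep12] b1 b2 that by blast
    have w23: "1 / K \<le> cmod (p2 z * q3 z - q2 z * p3 z)" if "z \<in> ?T" for z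
      using wedge_lower[OF l2 l3 sep23] b2 b3 that by blast
    have w31: "1 / K \<le> cmod (p3 z * q1 z - q3 z * p1 z)" if "z \<in> ?T" for z
      using wedge_lower[OF l3 l1 sep31] b3 b1 that by blast
    define f1 f2 f3 where "f1 z = P z * q1 z - Q z * p1 z" and "f2 z = P z * q2 z - Q z * p2 z"
      and "f3 z = P z * q3 z - Q z * p3 z" for z
    define e1 e2 e3 where "e1 z = p2 z * q3 z - q2 z * p3 z" and "e2 z = p3 z * q1 z - q3 z * p1 z"
      and "e3 z = p1 z * q2 z - q1 z * p2 z" for z
    have e_nz: "e1 z \<noteq> 0" "e2 z \<noteq> 0" "e3 z \<noteq> 0" if "z \<in> ?T" for z
      using w12[OF that] w23[OF that] w31[OF that] K0 by (auto simp: e1_def e2_def e3_def divide_le_0_iff)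
    have f_hol: "f1 holomorphic_on ?T" "f2 holomorphic_on ?T" "f3 holomorphic_on ?T"
      unfolding f1_def f2_def f3_def by (intro holomorphic_intros hol)+
    have e_hol: "e1 holomorphic_on ?T" "e2 holomorphic_on ?T" "e3 holomorphic_on ?T"
      unfolding e1_def e2_def e3_def by (intro holomorphic_intros hol)+
    have order: "vanishes_to_order m (\<lambda>w. (P w * B w - Q w * A w) * e w) z"
      if c: "contact_ge m \<phi> a (ball 0 R)" and la: "lift_on ?T a A B" and e: "e holomorphic_on ?T"
        and z: "z \<in> ?T" and zero: "P z * B z - Q z * A z = 0" for m a A B e z
    proof -
      obtain d where d: "d > 0" "ball z d \<subseteq> ?T" using openE[OF open_ball z] by blast
      have "\<phi> z = a z" using lf la z zero sphere_pt_eq_iff[of "P z" "Q z" "A z" "B z"] by (auto simp: lift_on_def)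
      then have "vanishes_to_order m (\<lambda>w. P w * B w - Q w * A w) z"
        using c d z TR lift_on_subset[OF lf d(2)] lift_on_subset[OF la d(2)] unfolding contact_ge_def by blast
      then show ?thesis
        by (rule vanishes_to_order_mult) (use e z in \<open>auto simp: analytic_at intro: exI[of _ ?T]\<close>)
    qed
    define X1 X2 X3 where "X1 z = f1 z * e1 z" and "X2 z = f2 z * e2 z" and "X3 z = f3 z * e3 z" for z
    have ahl: "((r/2)\<^sup>2 - (cmod z)\<^sup>2) * cmod (deriv X1 z * X2 z - X1 z * deriv X2 z)
       \<le> 44 * (r/2) * (sqrt (cmod (X1 z)) + sqrt (cmod (X2 z)) + sqrt (cmod (X3 z))) ^ 4"
      if z: "z \<in> ball 0 (r/2)" for z
    proof (rule ahlfors_bound_433[where R' = r])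
      show "X1 holomorphic_on ?T" "X2 holomorphic_on ?T" "X3 holomorphic_on ?T"
        unfolding X1_def X2_def X3_def by (intro holomorphic_intros f_hol e_hol)+
      show "X1 z + X2 z + X3 z = 0" for z
        by (simp add: X1_def X2_def X3_def f1_def f2_def f3_def e1_def e2_def e3_def algebra_simps)
      show "\<not> (X1 z = 0 \<and> X2 z = 0)" if z: "z \<in> ?T" for z
      proof
        assume "X1 z = 0 \<and> X2 z = 0"
        then have 0: "f1 z = 0" "f2 z = 0" using e_nz[OF z] by (auto simp: X1_def X2_def)
        have "P z * e3 z = p1 z * f2 z - p2 z * f1 z" "Q z * e3 z = q1 z * f2 z - q2 z * f1 z"
          by (simp_all add: e3_def f1_def f2_def algebra_simps)
        then show False using 0 e_nz(3)[OF z] lf z by (auto simp: lift_on_def)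
      qed
      show "vanishes_to_order 4 X1 z" if "z \<in> ?T" "X1 z = 0" for z
        using order[OF ct(1) l1 e_hol(1) that(1)] that e_nz(1)[OF that(1)]
        by (simp add: X1_def[abs_def] f1_def)
      show "vanishes_to_order 3 X2 z" if "z \<in> ?T" "X2 z = 0" for z
        using order[OF ct(2) l2 e_hol(2) that(1)] that e_nz(2)[OF that(1)]
        by (simp add: X2_def[abs_def] f2_def)
      show "vanishes_to_order 3 X3 z" if "z \<in> ?T" "X3 z = 0" for z
        using order[OF ct(3) l3 e_hol(3) that(1)] that e_nz(3)[OF that(1)]
        by (simp add: X3_def[abs_def] f3_def)
    qed (use z r0 in auto)
    have "cmod (deriv P z * Q z - P z * deriv Q z) \<le> 2 * C3 * ((cmod (P z))\<^sup>2 + (cmod (Q z))\<^sup>2)"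
      if z: "z \<in> ball 0 (r/4)" for z
    proof -
      have zT: "z \<in> ?T" and z2: "z \<in> ball 0 (r/2)" using z r0 by auto
      define n where "n = cmod (P z) + cmod (Q z)"
      have n0: "n \<ge> 0" "cmod (P z) \<le> n" "cmod (Q z) \<le> n" by (auto simp: n_def)
      have wb: "cmod (a * b - c * d) \<le> 2 * x * y"
        if "cmod a \<le> x" "cmod c \<le> x" "cmod b \<le> y" "cmod d \<le> y" for a b c d x y
      proof -
        have "0 \<le> x" using that(1) norm_ge_zero order_trans by blast
        have "cmod (a * b - c * d) \<le> cmod (a * b) + cmod (c * d)" by (rule norm_triangle_ineq4)
        also have "\<dots> \<le> x * y + x * y" unfolding norm_mult
          using that \<open>0 \<le> x\<close> by (intro add_mono mult_mono) auto
        finally show ?thesis by simp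
      qed
      note bz = bM[OF zT]
      have dz: "cmod (deriv p1 z) \<le> D" "cmod (deriv q1 z) \<le> D" "cmod (deriv p2 z) \<le> D" "cmod (deriv q2 z) \<le> D"
        "cmod (deriv p3 z) \<le> D" "cmod (deriv q3 z) \<le> D"
        unfolding D_def using hol bM z2 r0 by (auto intro!: Cauchy_deriv_bound_half_ball[where R = r])
      have f_bd: "cmod (P z * b - Q z * a) \<le> 2 * n * y" if "cmod a \<le> y" "cmod b \<le> y" for a b y
        using wb[of "P z" n "Q z" b y a] n0 that by simp
      have fz: "cmod (f1 z) \<le> 2 * n * M" "cmod (f2 z) \<le> 2 * n * M" "cmod (f3 z) \<le> 2 * n * M"
        unfolding f1_def f2_def f3_def by (intro f_bd bz)+
      have ez: "cmod (e1 z) \<le> 2 * M * M" "cmod (e2 z) \<le> 2 * M * M" "cmod (e3 z) \<le> 2 * M * M"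
        unfolding e1_def e2_def e3_def by (intro wb bz)+
      have X_bd: "cmod (X1 z) \<le> 4 * M ^ 3 * n" "cmod (X2 z) \<le> 4 * M ^ 3 * n" "cmod (X3 z) \<le> 4 * M ^ 3 * n"
      proof -
        have "cmod (x * y) \<le> 4 * M ^ 3 * n" if "cmod x \<le> 2 * n * M" "cmod y \<le> 2 * M * M" for x y
        proof -
          have "cmod (x * y) \<le> (2 * n * M) * (2 * M * M)"
            unfolding norm_mult using that n0 pos by (intro mult_mono) auto
          then show ?thesis by (simp add: power3_eq_cube mult_ac)
        qed
        then show "cmod (X1 z) \<le> 4 * M ^ 3 * n" "cmod (X2 z) \<le> 4 * M ^ 3 * n" "cmod (X3 z) \<le> 4 * M ^ 3 * n"
          using fz ez by (simp_all add: X1_def X2_def X3_def)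
      qed
      define s where "s = sqrt (cmod (X1 z)) + sqrt (cmod (X2 z)) + sqrt (cmod (X3 z))"
      have s4: "s ^ 4 \<le> 1296 * M ^ 6 * n\<^sup>2"
      proof -
        define x where "x = 4 * M ^ 3 * n"
        have x0: "x \<ge> 0" using pos n0 by (simp add: x_def)
        have "s \<le> sqrt x + sqrt x + sqrt x" unfolding s_def x_def
          using X_bd by (intro add_mono real_sqrt_le_mono)
        then have "s ^ 4 \<le> (3 * sqrt x) ^ 4" by (intro power_mono) (auto simp: s_def)
        also have "\<dots> = 81 * ((sqrt x)\<^sup>2)\<^sup>2" by (simp add: power_mult_distrib flip: power_mult)
        also have "\<dots> = 81 * x\<^sup>2" using x0 by simp
        also have "\<dots> = 1296 * M ^ 6 * n\<^sup>2" by (simp add: x_def power_mult_distrib flip: power_mult)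
        finally show ?thesis .
      qed
      define W where "W = deriv X1 z * X2 z - X1 z * deriv X2 z"
      have "W_bound": "cmod W \<le> C1 * n\<^sup>2"
      proof -
        have "(cmod z)\<^sup>2 \<le> (r/4)\<^sup>2" using z by (intro power_mono) auto
        then have "3 * r\<^sup>2 / 16 \<le> (r/2)\<^sup>2 - (cmod z)\<^sup>2" by (simp add: power2_eq_square)
        then have "3 * r\<^sup>2 / 16 * cmod W \<le> ((r/2)\<^sup>2 - (cmod z)\<^sup>2) * cmod W" by (rule mult_right_mono) simp
        also have "\<dots> \<le> 44 * (r/2) * s ^ 4" using ahl[OF z2] by (simp add: W_def s_def)
        also have "\<dots> \<le> 44 * (r/2) * (1296 * M ^ 6 * n\<^sup>2)" using s4 r0 by (intro mult_left_mono) auto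
        finally have 1: "3 * r\<^sup>2 / 16 * cmod W \<le> 22 * r * (1296 * M ^ 6 * n\<^sup>2)" by simp
        define Y where "Y = 1296 * M ^ 6 * n\<^sup>2"
        have "Y \<ge> 0" using pos by (simp add: Y_def)
        have "r * (3 * r * cmod W) \<le> r * (352 * Y)" using 1 by (simp add: Y_def power2_eq_square mult_ac)
        then have "3 * (r * cmod W) \<le> 352 * Y" using r0 by simp
        then have "r * cmod W \<le> 118 * Y" using \<open>Y \<ge> 0\<close> by linarith
        then show ?thesis using r0 by (simp add: C1_def Y_def field_simps)
      qed
      have dd: "(u has_field_derivative deriv u z) (at z)" if "u holomorphic_on ?T" for u
        using holomorphic_derivI[OF that open_ball zT] .
      have dw: "deriv (\<lambda>w. u w * v w - x w * y w) z = deriv u z * v z + u z * deriv v z - (deriv x z * y z + x z * deriv y z)"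
        if "u holomorphic_on ?T" "v holomorphic_on ?T" "x holomorphic_on ?T" "y holomorphic_on ?T" for u v x y
        by (rule DERIV_imp_deriv) (auto intro!: derivative_eq_intros dd that)
      have dm: "deriv (\<lambda>w. u w * v w) z = deriv u z * v z + u z * deriv v z"
        if "u holomorphic_on ?T" "v holomorphic_on ?T" for u v
        by (rule DERIV_imp_deriv) (auto intro!: derivative_eq_intros dd that)
      have dX: "deriv X1 z = deriv f1 z * e1 z + f1 z * deriv e1 z" "deriv X2 z = deriv f2 z * e2 z + f2 z * deriv e2 z"
        unfolding X1_def[abs_def] X2_def[abs_def] by (intro dm f_hol e_hol)+
      have df: "deriv f1 z = deriv P z * q1 z + P z * deriv q1 z - (deriv Q z * p1 z + Q z * deriv p1 z)"
        "deriv f2 z = deriv P z * q2 z + P z * deriv q2 z - (deriv Q z * p2 z + Q z * deriv p2 z)"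
        unfolding f1_def[abs_def] f2_def[abs_def] by (intro dw hol)+
      have de: "deriv e1 z = deriv p2 z * q3 z + p2 z * deriv q3 z - (deriv q2 z * p3 z + q2 z * deriv p3 z)"
        "deriv e2 z = deriv p3 z * q1 z + p3 z * deriv q1 z - (deriv q3 z * p1 z + q3 z * deriv p1 z)"
        unfolding e1_def[abs_def] e2_def[abs_def] by (intro dw hol)+
      have de_bd: "cmod (a * b + c * d - (x * y + u * v)) \<le> 4 * M * D"
        if "cmod a \<le> D" "cmod b \<le> M" "cmod c \<le> M" "cmod d \<le> D" "cmod x \<le> D" "cmod y \<le> M" "cmod u \<le> M" "cmod v \<le> D"
        for a b c d x y u v
      proof -
        have "cmod (a * b + c * d - (x * y + u * v)) \<le> cmod a * cmod b + cmod c * cmod d + (cmod x * cmod y + cmod u * cmod v)"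
          unfolding norm_mult[symmetric]
          by (intro order_trans[OF norm_triangle_ineq4] add_mono norm_triangle_ineq)
        also have "\<dots> \<le> D * M + M * D + (D * M + M * D)"
          using that pos by (intro add_mono mult_mono) auto
        finally show ?thesis by (simp add: mult_ac)
      qed
      have dez: "cmod (deriv e1 z) \<le> 4 * M * D" "cmod (deriv e2 z) \<le> 4 * M * D"
        unfolding de by (intro de_bd dz bz)+
      \<comment> \<open>The Wronskian of \<open>[f, a\<^sub>1]\<close> and \<open>[f, a\<^sub>2]\<close>, freed from the determinants of the targets in \<open>X\<^sub>1\<close> and \<open>X\<^sub>2\<close>.\<close>
      define \<Phi> where "\<Phi> = deriv f1 z * f2 z - f1 z * deriv f2 z"
      have "\<Phi> * (e1 z * e2 z) = W - f1 z * f2 z * (deriv e1 z * e2 z - e1 z * deriv e2 z)"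
        unfolding \<Phi>_def W_def dX X1_def X2_def by (simp add: algebra_simps)
      then have "cmod \<Phi> * (cmod (e1 z) * cmod (e2 z)) \<le> cmod W + cmod (f1 z * f2 z * (deriv e1 z * e2 z - e1 z * deriv e2 z))"
        using norm_triangle_ineq4[of W "f1 z * f2 z * (deriv e1 z * e2 z - e1 z * deriv e2 z)"]
        by (metis norm_mult)
      also have "cmod (f1 z * f2 z * (deriv e1 z * e2 z - e1 z * deriv e2 z))
         \<le> (2 * n * M) * (2 * n * M) * (4 * M * D * (2 * M * M) + (2 * M * M) * (4 * M * D))"
      proof -
        have "cmod (deriv e1 z * e2 z - e1 z * deriv e2 z) \<le> cmod (deriv e1 z) * cmod (e2 z) + cmod (e1 z) * cmod (deriv e2 z)"
          unfolding norm_mult[symmetric] by (rule norm_triangle_ineq4)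
        also have "\<dots> \<le> 4 * M * D * (2 * M * M) + (2 * M * M) * (4 * M * D)"
          using ez dez pos by (intro add_mono mult_mono) auto
        finally show ?thesis unfolding norm_mult using fz n0 pos by (intro mult_mono) auto
      qed
      also have "cmod W \<le> C1 * n\<^sup>2" by (rule W_bound)
      finally have "cmod \<Phi> * (cmod (e1 z) * cmod (e2 z)) \<le> C1 * n\<^sup>2 + (2 * n * M) * (2 * n * M) * (4 * M * D * (2 * M * M) + (2 * M * M) * (4 * M * D))"
        by simp
      also have "\<dots> = (C1 + 64 * M ^ 5 * D) * n\<^sup>2"
        by (simp add: algebra_simps power2_eq_square eval_nat_numeral)
      finally have 1: "cmod \<Phi> * (cmod (e1 z) * cmod (e2 z)) \<le> (C1 + 64 * M ^ 5 * D) * n\<^sup>2" .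
      have "(1/K) * (1/K) \<le> cmod (e1 z) * cmod (e2 z)"
        using w23[OF zT] w31[OF zT] K0 by (intro mult_mono) (auto simp: e1_def e2_def)
      then have "cmod \<Phi> * ((1/K) * (1/K)) \<le> cmod \<Phi> * (cmod (e1 z) * cmod (e2 z))" by (rule mult_left_mono) simp
      with 1 have "cmod \<Phi> * ((1/K) * (1/K)) \<le> (C1 + 64 * M ^ 5 * D) * n\<^sup>2" by linarith
      then have \<Phi>_bd: "cmod \<Phi> \<le> C2 * n\<^sup>2" using K0 by (simp add: C2_def field_simps power2_eq_square)
      define \<Delta> where "\<Delta> = deriv P z * Q z - P z * deriv Q z"
      \<comment> \<open>The determinant of a product of two matrices of size 2, with the correction that comes from
        the derivatives of the targets.\<close>
      have "\<Delta> * e3 z = \<Phi> - ((P z * deriv q1 z - Q z * deriv p1 z) * f2 z - f1 z * (P z * deriv q2 z - Q z * deriv p2 z))"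
        unfolding \<Delta>_def \<Phi>_def df f1_def f2_def e3_def by (simp add: algebra_simps)
      then have "cmod (\<Delta> * e3 z) = cmod (\<Phi> - ((P z * deriv q1 z - Q z * deriv p1 z) * f2 z - f1 z * (P z * deriv q2 z - Q z * deriv p2 z)))"
        by (simp only:)
      also have "\<dots> \<le> cmod \<Phi> + cmod ((P z * deriv q1 z - Q z * deriv p1 z) * f2 z - f1 z * (P z * deriv q2 z - Q z * deriv p2 z))"
        by (rule norm_triangle_ineq4)
      also have "cmod ((P z * deriv q1 z - Q z * deriv p1 z) * f2 z - f1 z * (P z * deriv q2 z - Q z * deriv p2 z))
          \<le> cmod (P z * deriv q1 z - Q z * deriv p1 z) * cmod (f2 z) + cmod (f1 z) * cmod (P z * deriv q2 z - Q z * deriv p2 z)"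
        unfolding norm_mult[symmetric] by (rule norm_triangle_ineq4)
      also have "\<dots> \<le> (2 * n * D) * (2 * n * M) + (2 * n * M) * (2 * n * D)"
        using fz n0 pos by (intro add_mono mult_mono f_bd dz) auto
      finally have "cmod \<Delta> * cmod (e3 z) \<le> C2 * n\<^sup>2 + ((2 * n * D) * (2 * n * M) + (2 * n * M) * (2 * n * D))"
        using \<Phi>_bd by (simp add: norm_mult)
      also have "\<dots> = (C2 + 8 * D * M) * n\<^sup>2" by (simp add: algebra_simps power2_eq_square)
      finally have 2: "cmod \<Delta> * cmod (e3 z) \<le> (C2 + 8 * D * M) * n\<^sup>2" .
      have "cmod \<Delta> * (1/K) \<le> cmod \<Delta> * cmod (e3 z)" using w12[OF zT] by (intro mult_left_mono) (auto simp: e3_def)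
      with 2 have "cmod \<Delta> * (1/K) \<le> (C2 + 8 * D * M) * n\<^sup>2" by linarith
      then have "cmod \<Delta> \<le> C3 * n\<^sup>2" using K0 by (simp add: C3_def field_simps)
      also have "\<dots> \<le> C3 * (2 * ((cmod (P z))\<^sup>2 + (cmod (Q z))\<^sup>2))"
      proof (rule mult_left_mono)
        have "0 \<le> (cmod (P z) - cmod (Q z))\<^sup>2" by simp
        then show "n\<^sup>2 \<le> 2 * ((cmod (P z))\<^sup>2 + (cmod (Q z))\<^sup>2)"
          unfolding n_def by (simp add: power2_eq_square algebra_simps)
      qed (use pos in simp)
      finally show ?thesis by (simp only: \<Delta>_def mult_ac)
    qed
    then show "\<exists>P Q. lift_on (ball 0 r) \<phi> P Q \<and> (\<forall>z\<in>ball 0 (r/4).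
        cmod (deriv P z * Q z - P z * deriv Q z) \<le> 2 * C3 * ((cmod (P z))\<^sup>2 + (cmod (Q z))\<^sup>2))"
      using lf by blast
  qed
qed

section \<open>Charts of the sphere and zero multiplicities\<close>

lemma sph_chart_0 [simp]: "sph_chart p 0 = p"
  by (cases p) auto

lemma sph_chart_None_eq: "sph_chart None w = (if w = 0 then None else Some (1 / w))"
  by simp

lemma sph_chart_eq_iff [simp]: "sph_chart p w = sph_chart p w' \<longleftrightarrow> w = w'"
  by (cases p) auto

text \<open>
  The change of charts is written as \<open>(w - z) k w\<close> with \<open>k w \<noteq> 0\<close>, which displays that it preserves
  orders of vanishing.
\<close>

lemma chart_transition:
  obtains d k where "d > 0" "k holomorphic_on ball z d" "\<And>w. w \<in> ball z d \<Longrightarrow> k w \<noteq> 0"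
    "\<And>w. w \<in> ball z d \<Longrightarrow> sph_chart p w = sph_chart (sph_chart p z) ((w - z) * k w)"
proof (cases p)
  case (Some c)
  then show ?thesis by (intro that[of 1 "\<lambda>_. 1"]) auto
next
  case None
  show ?thesis
  proof (cases "z = 0")
    case True
    then show ?thesis using None by (intro that[of 1 "\<lambda>_. 1"]) auto
  next
    case False
    have nz: "w \<noteq> 0" if "w \<in> ball z (cmod z)" for w using that by auto
    show ?thesis
    proof (rule that[of "cmod z" "\<lambda>w. - (1 / (w * z))"])
      show "(\<lambda>w. - (1 / (w * z))) holomorphic_on ball z (cmod z)"
        using nz False by (intro holomorphic_intros) auto
      show "sph_chart p w = sph_chart (sph_chart p z) ((w - z) * - (1 / (w * z)))" if "w \<in> ball z (cmod z)" for w
        using nz[OF that] False None by (simp add: field_simps)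
    qed (use False nz in auto)
  qed
qed

lemma open_vimage_Some:
  assumes "openin sphere_top D" shows "open (Some -` D)"
proof -
  have "openin euclidean {x \<in> topspace euclidean. Some x \<in> D}"
    using continuous_map_Some assms by (rule openin_continuous_map_preimage)
  then show ?thesis by (simp add: vimage_def)
qed

lemma openin_chart_ball: "openin sphere_top (sph_chart p ` ball 0 d)"
proof (cases p)
  case (Some c)
  have "sph_chart p ` ball 0 d = Some ` ((\<lambda>w. c + w) ` ball 0 d)" unfolding Some image_image by simp
  then show ?thesis by (simp add: open_translation)
next
  case None
  show ?thesis
  proof (cases "d > 0")
    case True
    have "sph_chart p ` ball 0 d = insert None (Some ` (topspace euclidean - cball (0::complex) (1 / d)))"
    proof (intro set_eqI iffI)
      fix q assume "q \<in> sph_chart p ` ball 0 d"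
      then show "q \<in> insert None (Some ` (topspace euclidean - cball (0::complex) (1 / d)))"
        using None True by (auto simp: sph_chart_None_eq norm_divide field_simps split: if_splits)
    next
      fix q :: riemann_sphere assume q: "q \<in> insert None (Some ` (topspace euclidean - cball (0::complex) (1 / d)))"
      show "q \<in> sph_chart p ` ball 0 d"
      proof (cases q)
        case None
        then show ?thesis using \<open>p = None\<close> True by (intro image_eqI[of _ _ 0]) auto
      next
        case (Some u)
        with q have "cmod u > 1 / d" by auto
        moreover from this have "u \<noteq> 0" using True by (auto simp: not_less)
        ultimately show ?thesis using \<open>p = None\<close> True Some
          by (intro image_eqI[of _ _ "1 / u"]) (auto simp: norm_divide field_simps)
      qed
    qed
    then show ?thesis unfolding openin_Alexandroff_compactification
      by (intro disjI2 exI[of _ "cball 0 (1 / d)"]) auto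
  next
    case False
    then have empty: "ball (0::complex) d = {}" by simp
    show ?thesis unfolding empty image_empty by (rule openin_empty)
  qed
qed

lemma chart_ball_in_open:
  assumes "openin sphere_top D" "p \<in> D"
  obtains d where "d > 0" "sph_chart p ` ball 0 d \<subseteq> D"
proof (cases p)
  case (Some c)
  then obtain d where d: "d > 0" "ball c d \<subseteq> Some -` D"
    using openE[OF open_vimage_Some[OF assms(1)], of c] assms(2) by auto
  have "Some (c + w) \<in> D" if "w \<in> ball 0 d" for w
    using subsetD[OF d(2), of "c + w"] that by (simp add: dist_norm)
  then show ?thesis using Some d(1) by (intro that[of d]) auto
next
  case None
  then have "\<not> (\<exists>U. openin euclidean U \<and> D = Some ` U)" using assms(2) by auto
  then obtain C where "compactin euclidean C" "D = insert None (Some ` (topspace euclidean - C))"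
    using assms(1) unfolding openin_Alexandroff_compactification by blast
  then have C: "compact C" "D = insert None (Some ` (- C))" by (simp_all add: Compl_eq_Diff_UNIV)
  obtain B where B: "B > 0" "\<forall>x\<in>C. cmod x \<le> B"
    using compact_imp_bounded[OF C(1)] unfolding bounded_pos by blast
  have "sph_chart p w \<in> D" if "w \<in> ball 0 (1 / B)" for w
  proof (cases "w = 0")
    case False
    have "cmod (1 / w) > B" using that False B(1) by (simp add: norm_divide field_simps)
    then have "1 / w \<notin> C" using B(2) by force
    then show ?thesis using False None C(2) by simp
  qed (use assms in simp)
  then show ?thesis using B(1) by (intro that[of "1 / B"]) auto
qed

lemma chart_holo_imp_sphere_holo:
  assumes loc: "\<And>q. q \<in> D \<Longrightarrow> \<exists>d>0. \<exists>P Q. lift_on (ball 0 d) (\<lambda>w. f (sph_chart q w)) P Q"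
    and S: "open S" "sph_chart p ` S \<subseteq> D"
  shows "sphere_holo S (\<lambda>w. f (sph_chart p w))"
  unfolding sphere_holo_def
proof
  fix z assume z: "z \<in> S"
  define q where "q = sph_chart p z"
  have "q \<in> D" using z S by (auto simp: q_def)
  then obtain d P Q where d: "d > 0" and l: "lift_on (ball 0 d) (\<lambda>w. f (sph_chart q w)) P Q" using loc by blast
  obtain e k where e: "e > 0" "k holomorphic_on ball z e"
    "\<And>w. w \<in> ball z e \<Longrightarrow> sph_chart p w = sph_chart q ((w - z) * k w)"
    unfolding q_def using chart_transition[of z p] by metis
  define \<tau> where "\<tau> w = (w - z) * k w" for w
  have \<tau>: "\<tau> holomorphic_on ball z e" unfolding \<tau>_def by (intro holomorphic_intros e)
  have "isCont \<tau> z" using holomorphic_isCont[OF \<tau>] e(1) by simp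
  moreover have "\<tau> z = 0" by (simp add: \<tau>_def)
  ultimately obtain c where c: "c > 0" "\<And>w. dist w z < c \<Longrightarrow> dist (\<tau> w) 0 < d"
    using d unfolding continuous_at_eps_delta by metis
  obtain b where b: "b > 0" "ball z b \<subseteq> S" using S(1) z openE by blast
  define r where "r = min e (min c b)"
  have r: "r > 0" "ball z r \<subseteq> ball z e" "ball z r \<subseteq> S" using e c b by (auto simp: r_def)
  have in_d: "\<tau> w \<in> ball 0 d" if "w \<in> ball z r" for w
    using c(2)[of w] that by (auto simp: r_def dist_commute)
  have "lift_on (ball z r) (\<lambda>w. f (sph_chart p w)) (P \<circ> \<tau>) (Q \<circ> \<tau>)"
    unfolding lift_on_def
  proof (intro conjI ballI)
    have \<tau>r: "\<tau> holomorphic_on ball z r" using \<tau> r holomorphic_on_subset by blast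
    show "P \<circ> \<tau> holomorphic_on ball z r" "Q \<circ> \<tau> holomorphic_on ball z r"
      using l in_d by (auto simp: lift_on_def intro!: holomorphic_on_compose_gen[OF \<tau>r])
    fix w assume w: "w \<in> ball z r"
    show "(P \<circ> \<tau>) w \<noteq> 0 \<or> (Q \<circ> \<tau>) w \<noteq> 0" using l in_d[OF w] by (auto simp: lift_on_def)
    have "sph_chart p w = sph_chart q (\<tau> w)" using e(3) w r by (auto simp: \<tau>_def)
    then show "f (sph_chart p w) = sphere_pt ((P \<circ> \<tau>) w) ((Q \<circ> \<tau>) w)"
      using l in_d[OF w] by (auto simp: lift_on_def)
  qed
  then show "\<exists>r>0. \<exists>P Q. ball z r \<subseteq> S \<and> lift_on (ball z r) (\<lambda>w. f (sph_chart p w)) P Q"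
    using r by blast
qed

text \<open>
  At a point where \<open>f\<close> is finite, the finite part of \<open>f\<close> is holomorphic, but it could still hide values
  \<open>\<infinity>\<close> at nearby points, because it is 0 there.  By definition such points are poles in their own
  charts; transported to the chart at \<open>q\<close>, this contradicts continuity of the finite part.
\<close>

lemma meromorphic_fns_local_lift:
  assumes f: "f \<in> meromorphic_fns D" and D: "openin sphere_top D" and q: "q \<in> D"
  shows "\<exists>d>0. \<exists>P Q. lift_on (ball 0 d) (\<lambda>w. f (sph_chart q w)) P Q"
proof -
  let ?h = "\<lambda>q w. finite_part (f (sph_chart q w))"
  have nm: "?h q nicely_meromorphic_on {0}" and pole: "f q = None \<longleftrightarrow> is_pole (?h q) 0" if "q \<in> D" for q
    using f that by (auto simp: meromorphic_fns_def)
  obtain d0 where d0: "d0 > 0" "sph_chart q ` ball 0 d0 \<subseteq> D" using chart_ball_in_open[OF D q] .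
  show ?thesis
  proof (cases "f q = None")
    case True
    then have ip: "is_pole (?h q) 0" using pole[OF q] by simp
    have "isolated_singularity_at (?h q) 0"
      using nm[OF q] by (simp add: nicely_meromorphic_on_def meromorphic_at_iff)
    then obtain r1 where r1: "r1 > 0" "?h q analytic_on ball 0 r1 - {0}" by (auto simp: isolated_singularity_at_def)
    obtain r2 where r2: "r2 > 0" "\<And>w. w \<noteq> 0 \<Longrightarrow> dist w 0 < r2 \<Longrightarrow> ?h q w \<noteq> 0"
      using non_zero_neighbour_pole[OF ip] unfolding eventually_at by auto
    define r where "r = min r1 r2"
    have r: "r > 0" using r1 r2 by (simp add: r_def)
    define Q where "Q = (\<lambda>w. if w = 0 then 0 else inverse (?h q w))"
    have "Q holomorphic_on ball 0 r"
      unfolding Q_def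
    proof (rule is_pole_inverse_holomorphic[OF open_ball _ ip])
      show "?h q holomorphic_on ball 0 r - {0}"
        by (rule analytic_imp_holomorphic, rule analytic_on_subset[OF r1(2)]) (auto simp: r_def)
      show "\<forall>x\<in>ball 0 r - {0}. ?h q x \<noteq> 0" using r2 by (auto simp: r_def)
    qed
    moreover have "f (sph_chart q w) = sphere_pt 1 (Q w)" if w: "w \<in> ball 0 r" for w
    proof (cases "w = 0")
      case True
      then show ?thesis using \<open>f q = None\<close> by (simp add: Q_def sphere_pt_def)
    next
      case False
      then have "?h q w \<noteq> 0" using r2(2)[of w] w by (auto simp: r_def)
      moreover from this obtain a where a: "f (sph_chart q w) = Some a" by (cases "f (sph_chart q w)") auto
      ultimately show ?thesis using False by (simp add: Q_def sphere_pt_def divide_inverse)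
    qed
    ultimately have "lift_on (ball 0 r) (\<lambda>w. f (sph_chart q w)) (\<lambda>_. 1) Q"
      by (simp add: lift_on_def)
    then show ?thesis using r by blast
  next
    case False
    then have "?h q analytic_on {0}"
      using nicely_meromorphic_on_imp_analytic_at[OF nm[OF q]] pole[OF q] by simp
    then obtain r1 where r1: "r1 > 0" "?h q holomorphic_on ball 0 r1" by (auto simp: analytic_on_def)
    define r where "r = min r1 d0"
    have r: "r > 0" using r1 d0 by (simp add: r_def)
    have hol: "?h q holomorphic_on ball 0 r" using r1(2) by (rule holomorphic_on_subset) (auto simp: r_def)
    have not_None: "f (sph_chart q w) \<noteq> None" if w: "w \<in> ball 0 r" for w
    proof
      assume none: "f (sph_chart q w) = None"
      define q' where "q' = sph_chart q w"
      have "q' \<in> D" using d0 w by (auto simp: q'_def r_def)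
      then have ip: "is_pole (?h q') 0" using none pole by (simp add: q'_def)
      obtain e k where e: "e > 0" "k holomorphic_on ball w e" "\<And>u. u \<in> ball w e \<Longrightarrow> k u \<noteq> 0"
        "\<And>u. u \<in> ball w e \<Longrightarrow> sph_chart q u = sph_chart q' ((u - w) * k u)"
        unfolding q'_def using chart_transition[of w q] by metis
      have "isCont k w" using holomorphic_isCont[OF e(2)] e(1) by simp
      then have "isCont (\<lambda>u. (u - w) * k u) w" by (intro continuous_intros)
      then have "((\<lambda>u. (u - w) * k u) \<longlongrightarrow> 0) (at w)" by (simp add: isCont_def)
      moreover have ev: "\<forall>\<^sub>F u in at w. u \<in> ball w e - {w}" by (rule eventually_at_in_open[OF open_ball]) (use e(1) in simp)
      then have "\<forall>\<^sub>F u in at w. (u - w) * k u \<noteq> 0" by eventually_elim (use e(3) in auto)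
      ultimately have "filterlim (\<lambda>u. (u - w) * k u) (at 0) (at w)" by (simp add: filterlim_at)
      then have "filterlim (\<lambda>u. ?h q' ((u - w) * k u)) at_infinity (at w)"
        by (rule filterlim_compose[OF ip[unfolded is_pole_def]])
      moreover have "\<forall>\<^sub>F u in at w. ?h q' ((u - w) * k u) = ?h q u"
        using ev by eventually_elim (use e(4) in auto)
      ultimately have "filterlim (?h q) at_infinity (at w)"
        by (rule filterlim_cong[OF refl refl, THEN iffD1, rotated])
      moreover have "(?h q \<longlongrightarrow> ?h q w) (at w)" using holomorphic_isCont[OF hol open_ball w] by (simp add: isCont_def)
      ultimately show False using not_tendsto_and_filterlim_at_infinity[OF at_neq_bot] by blast
    qed
    have "f (sph_chart q w) = Some (?h q w)" if "w \<in> ball 0 r" for w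
      using not_None[OF that] by (cases "f (sph_chart q w)") auto
    then have "lift_on (ball 0 r) (\<lambda>w. f (sph_chart q w)) (?h q) (\<lambda>_. 1)"
      unfolding lift_on_def using hol by (simp add: sphere_pt_def)
    then show ?thesis using r by blast
  qed
qed

lemma meromorphic_or_infinity_sphere_holo:
  assumes f: "f \<in> meromorphic_fns D \<union> infinity_fns D" and D: "openin sphere_top D"
    and S: "open S" "sph_chart p ` S \<subseteq> D"
  shows "sphere_holo S (\<lambda>w. f (sph_chart p w))"
proof (rule chart_holo_imp_sphere_holo[OF _ S])
  fix q assume q: "q \<in> D"
  show "\<exists>d>0. \<exists>P Q. lift_on (ball 0 d) (\<lambda>w. f (sph_chart q w)) P Q"
  proof (cases "f \<in> meromorphic_fns D")
    case True
    then show ?thesis using meromorphic_fns_local_lift D q by blast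
  next
    case False
    then have inf: "\<And>p. p \<in> D \<Longrightarrow> f p = None" using f by (auto simp: infinity_fns_def)
    obtain d where d: "d > 0" "sph_chart q ` ball 0 d \<subseteq> D" using chart_ball_in_open[OF D q] .
    have "lift_on (ball 0 d) (\<lambda>w. f (sph_chart q w)) (\<lambda>_. 1) (\<lambda>_. 0)"
      using inf d by (auto simp: lift_on_def sphere_pt_def image_subset_iff)
    then show ?thesis using d by blast
  qed
qed

lemma vanishes_to_order_transport:
  assumes \<delta>: "\<delta> analytic_on {0}" and m: "m \<le> nat (zorder \<delta> 0)"
    and e: "e > 0" "k holomorphic_on ball z e" and c: "c analytic_on {z}"
    and h: "\<forall>\<^sub>F w in nhds z. h w = c w * \<delta> ((w - z) * k w)"
  shows "vanishes_to_order m h z"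
proof -
  obtain d where d: "d > 0" "\<delta> holomorphic_on ball 0 d" using \<delta> by (auto simp: analytic_on_def)
  have kan: "k analytic_on {z}" using e by (auto simp: analytic_at intro: exI[of _ "ball z e"])
  have \<tau>an: "(\<lambda>w. (w - z) * k w) analytic_on {z}" by (intro analytic_intros kan)
  have "((\<lambda>w. (w - z) * k w) \<longlongrightarrow> (z - z) * k z) (nhds z)"
    using analytic_at_imp_isCont[OF \<tau>an, unfolded isCont_def]
      tendsto_at_iff_tendsto_nhds[of "\<lambda>w. (w - z) * k w" z] by blast
  then have lim: "((\<lambda>w. (w - z) * k w) \<longlongrightarrow> 0) (nhds z)" by simp
  then have small: "\<forall>\<^sub>F w in nhds z. (w - z) * k w \<in> ball 0 r" if "r > 0" for r
    using topological_tendstoD[OF lim open_ball, of 0 r] that by simp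
  show ?thesis
  proof (cases "\<forall>w\<in>ball 0 d. \<delta> w = 0")
    case True
    have "\<forall>\<^sub>F w in nhds z. h w = (w - z) ^ m * 0"
      using h small[OF d(1)] by eventually_elim (use True in auto)
    moreover have "(\<lambda>_. 0) analytic_on {z}" by simp
    ultimately show ?thesis unfolding vanishes_to_order_def by blast
  next
    case False
    then have ex: "\<exists>w\<in>ball 0 d. \<delta> w \<noteq> 0" by blast
    have 0: "0 \<in> ball (0::complex) d" using d by simp
    define n where "n = nat (zorder \<delta> 0)"
    obtain r g where r: "r > 0" "g holomorphic_on cball 0 r" "\<And>w. w \<in> cball 0 r \<Longrightarrow> \<delta> w = g w * w ^ n"
    proof -
      from zorder_exist_zero[OF d(2) open_ball connected_ball 0 ex] obtain r where "r > 0"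
        "zor_poly \<delta> 0 holomorphic_on cball 0 r" "\<forall>w\<in>cball 0 r. \<delta> w = zor_poly \<delta> 0 w * (w - 0) ^ n"
        unfolding n_def by auto
      then show ?thesis using that[of r "zor_poly \<delta> 0"] by simp
    qed
    obtain j where j: "n = m + j" using m unfolding n_def[symmetric] using le_Suc_ex by blast
    have "g holomorphic_on ball 0 r" using r(2) ball_subset_cball holomorphic_on_subset by blast
    then have gan: "g analytic_on {0}" using r(1) by (auto simp: analytic_at intro: exI[of _ "ball 0 r"])
    have "(\<lambda>w. g ((w - z) * k w)) analytic_on {z}"
      using analytic_on_compose[OF \<tau>an, of g] gan by (simp add: o_def)
    then have "(\<lambda>w. c w * (g ((w - z) * k w) * (k w ^ n * (w - z) ^ j))) analytic_on {z}"
      by (intro analytic_intros c kan)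
    moreover have "\<forall>\<^sub>F w in nhds z. h w = (w - z) ^ m * (c w * (g ((w - z) * k w) * (k w ^ n * (w - z) ^ j)))"
      using h small[OF r(1)]
    proof eventually_elim
      case (elim w)
      have "\<delta> ((w - z) * k w) = g ((w - z) * k w) * ((w - z) * k w) ^ n"
        using elim(2) by (intro r(3)) auto
      then show ?case using elim(1) by (simp add: power_mult_distrib j power_add mult_ac)
    qed
    ultimately show ?thesis unfolding vanishes_to_order_def by blast
  qed
qed

lemma sph_inverse_sphere_pt:
  assumes "P \<noteq> 0 \<or> Q \<noteq> 0"
  shows "sph_inverse (sphere_pt P Q) = sphere_pt Q P"
  using assms by (auto simp: sphere_pt_def)

lemma lift_on_inverse:
  assumes "lift_on S \<phi> P Q"
  shows "lift_on S (\<lambda>w. sph_inverse (\<phi> w)) Q P"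
  using assms by (auto simp: lift_on_def sph_inverse_sphere_pt)

text \<open>
  The determinant of the lifts in the chart at \<open>p\<close> is the difference of the functions in the chart at
  \<open>sph_chart p z\<close>, composed with the change of charts and multiplied by \<open>Q B\<close>.
\<close>

lemma zorder_difference_imp_contact:
  assumes r: "r > 0" and lf: "lift_on (ball z r) (\<lambda>w. f (sph_chart p w)) P Q"
    and la: "lift_on (ball z r) (\<lambda>w. a (sph_chart p w)) A B"
    and d: "d > 0" and lf0: "lift_on (ball 0 d) (\<lambda>w. f (sph_chart (sph_chart p z) w)) P1 Q1"
    and la0: "lift_on (ball 0 d) (\<lambda>w. a (sph_chart (sph_chart p z) w)) A1 B1"
    and finite: "f (sph_chart p z) \<noteq> None" "a (sph_chart p z) \<noteq> None"
    and m: "m \<le> nat (zorder (\<lambda>w. finite_part (f (sph_chart (sph_chart p z) w))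
                              - finite_part (a (sph_chart (sph_chart p z) w))) 0)"
  shows "vanishes_to_order m (\<lambda>w. P w * B w - Q w * A w) z"
proof -
  define q where "q = sph_chart p z"
  define \<delta> where "\<delta> w = finite_part (f (sph_chart q w)) - finite_part (a (sph_chart q w))" for w
  have z: "z \<in> ball z r" and 0: "0 \<in> ball (0::complex) d" using r d by auto
  obtain e k where e: "e > 0" "k holomorphic_on ball z e"
    "\<And>w. w \<in> ball z e \<Longrightarrow> sph_chart p w = sph_chart q ((w - z) * k w)"
    unfolding q_def using chart_transition[of z p] by metis
  have an: "Q analytic_on {z}" "B analytic_on {z}"
    using lf la z by (auto simp: lift_on_def analytic_at intro: exI[of _ "ball z r"])
  have an0: "P1 analytic_on {0}" "Q1 analytic_on {0}" "A1 analytic_on {0}" "B1 analytic_on {0}"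
    using lf0 la0 0 by (auto simp: lift_on_def analytic_at intro: exI[of _ "ball 0 d"])
  have nz: "Q z \<noteq> 0" "B z \<noteq> 0" "Q1 0 \<noteq> 0" "B1 0 \<noteq> 0"
    using finite lift_onD[OF lf z] lift_onD[OF la z] lift_onD[OF lf0 0] lift_onD[OF la0 0]
    by (auto simp: sphere_pt_def split: if_splits)
  have "\<forall>\<^sub>F w in nhds 0. \<delta> w = P1 w / Q1 w - A1 w / B1 w"
    using eventually_nhds_in_open[OF open_ball 0]
    by eventually_elim
      (simp add: \<delta>_def q_def lift_on_finite_part[OF lf0] lift_on_finite_part[OF la0])
  moreover have "(\<lambda>w. P1 w / Q1 w - A1 w / B1 w) analytic_on {0}"
    using nz by (intro analytic_intros an0) auto
  ultimately have \<delta>: "\<delta> analytic_on {0}" using analytic_at_cong[OF _ refl] by (simp only:)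
  have near: "\<forall>\<^sub>F w in nhds z. w \<in> ball z r \<inter> ball z e"
    using r e by (intro eventually_nhds_in_open) auto
  have nz_near: "\<forall>\<^sub>F w in nhds z. F w \<noteq> 0" if "F analytic_on {z}" "F z \<noteq> 0" for F :: "complex \<Rightarrow> complex"
    using analytic_at_imp_isCont[OF that(1)] that(2)
    by (simp add: isCont_def tendsto_at_iff_tendsto_nhds tendsto_imp_eventually_ne)
  show ?thesis
  proof (rule vanishes_to_order_transport[OF \<delta> _ e(1,2)])
    show "m \<le> nat (zorder \<delta> 0)" using m by (simp add: \<delta>_def[abs_def] q_def)
    show "(\<lambda>w. Q w * B w) analytic_on {z}" by (intro analytic_intros an)
    show "\<forall>\<^sub>F w in nhds z. P w * B w - Q w * A w = Q w * B w * \<delta> ((w - z) * k w)"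
      using near nz_near[OF an(1) nz(1)] nz_near[OF an(2) nz(2)]
    proof eventually_elim
      case (elim w)
      have "\<delta> ((w - z) * k w) = P w / Q w - A w / B w"
        using elim e(3)[of w] lift_on_finite_part[OF lf, of w] lift_on_finite_part[OF la, of w]
        by (simp add: \<delta>_def)
      then show ?case using elim by (simp add: field_simps)
    qed
  qed
qed

text \<open>
  At a common value \<open>\<infinity>\<close> the multiplicity is that of \<open>1/f - 1/a\<close>, so the preceding lemma is applied to the
  inversions.  Their lifts are those of \<open>f\<close> and \<open>a\<close> with the two coordinates exchanged, which changes only the
  sign of the determinant.
\<close>

lemma zero_multiplicity_contact:
  assumes f: "f \<in> meromorphic_fns D \<union> infinity_fns D" and a: "a \<in> meromorphic_fns D \<union> infinity_fns D"
    and D: "openin sphere_top D"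
    and S: "open S" "sph_chart p ` S \<subseteq> D"
    and mult: "\<And>q. q \<in> D \<Longrightarrow> f q = a q \<Longrightarrow> zero_multiplicity D f a q \<ge> enat m"
  shows "contact_ge m (\<lambda>w. f (sph_chart p w)) (\<lambda>w. a (sph_chart p w)) S"
  unfolding contact_ge_def
proof (intro ballI impI allI)
  fix z r P Q A B
  assume z: "z \<in> S" and eq: "f (sph_chart p z) = a (sph_chart p z)" and r: "r > 0"
    and lf: "lift_on (ball z r) (\<lambda>w. f (sph_chart p w)) P Q" and la: "lift_on (ball z r) (\<lambda>w. a (sph_chart p w)) A B"
  let ?q = "sph_chart p z"
  have q: "?q \<in> D" using z S by auto
  show "vanishes_to_order m (\<lambda>w. P w * B w - Q w * A w) z"
  proof (cases "\<forall>q\<in>D. f q = a q")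
    case True
    obtain b where b: "b > 0" "ball z b \<subseteq> S" using S(1) z openE by blast
    have "\<forall>\<^sub>F w in nhds z. w \<in> ball z r \<inter> ball z b"
      using r b by (intro eventually_nhds_in_open) auto
    then have "\<forall>\<^sub>F w in nhds z. P w * B w - Q w * A w = (w - z) ^ m * 0"
    proof eventually_elim
      case (elim w)
      then have "w \<in> S" using b by auto
      then have "sph_chart p w \<in> D" using S by blast
      then have "sphere_pt (P w) (Q w) = sphere_pt (A w) (B w)"
        using True lift_onD(2)[OF lf, of w] lift_onD(2)[OF la, of w] elim by auto
      then show ?case
        using sphere_pt_eq_iff lift_onD(1)[OF lf, of w] lift_onD(1)[OF la, of w] elim by auto
    qed
    moreover have "(\<lambda>_. 0) analytic_on {z}" by simp
    ultimately show ?thesis unfolding vanishes_to_order_def by blast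
  next
    case False
    obtain d0 where d0: "d0 > 0" "sph_chart ?q ` ball 0 d0 \<subseteq> D" using chart_ball_in_open[OF D q] .
    have 0: "0 \<in> ball (0::complex) d0" using d0 by simp
    obtain r1 P1 Q1 where 1: "r1 > 0" "lift_on (ball 0 r1) (\<lambda>w. f (sph_chart ?q w)) P1 Q1"
      using meromorphic_or_infinity_sphere_holo[OF f D open_ball d0(2)] 0 by (meson sphere_holo_def)
    obtain r2 A1 B1 where 2: "r2 > 0" "lift_on (ball 0 r2) (\<lambda>w. a (sph_chart ?q w)) A1 B1"
      using meromorphic_or_infinity_sphere_holo[OF a D open_ball d0(2)] 0 by (meson sphere_holo_def)
    define d where "d = min r1 r2"
    have d: "d > 0" "ball 0 d \<subseteq> ball (0::complex) r1" "ball 0 d \<subseteq> ball (0::complex) r2"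
      using 1 2 by (auto simp: d_def)
    note lf0 = lift_on_subset[OF 1(2) d(2)] and la0 = lift_on_subset[OF 2(2) d(3)]
    have m: "enat m \<le> zero_multiplicity D f a ?q" using mult[OF q eq] .
    show ?thesis
    proof (cases "f ?q = None")
      case finite: False
      show ?thesis
      proof (rule zorder_difference_imp_contact[OF r lf la d(1) lf0 la0])
        show "m \<le> nat (zorder (\<lambda>w. finite_part (f (sph_chart ?q w)) - finite_part (a (sph_chart ?q w))) 0)"
          using m finite False by (simp add: zero_multiplicity_def)
      qed (use finite eq in auto)
    next
      case inf: True
      have "vanishes_to_order m (\<lambda>w. Q w * A w - P w * B w) z"
      proof (rule zorder_difference_imp_contact[OF r lift_on_inverse[OF lf] lift_on_inverse[OF la] d(1)
            lift_on_inverse[OF lf0] lift_on_inverse[OF la0]])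
        show "m \<le> nat (zorder (\<lambda>w. finite_part (sph_inverse (f (sph_chart ?q w)))
            - finite_part (sph_inverse (a (sph_chart ?q w)))) 0)"
          using m inf False by (simp add: zero_multiplicity_def)
      qed (use inf eq in auto)
      from vanishes_to_order_mult[OF this, of "\<lambda>_. -1"] show ?thesis by simp
    qed
  qed
qed

lemma sph_dist_ge_inner:
  assumes "sph_dist p q \<ge> \<epsilon>" "0 \<le> \<epsilon>"
  shows "stereo p \<bullet> stereo q \<le> cos \<epsilon>"
proof -
  have "\<bar>stereo p \<bullet> stereo q\<bar> \<le> 1" using Cauchy_Schwarz_ineq2[of "stereo p" "stereo q"] by simp
  then have b: "-1 \<le> stereo p \<bullet> stereo q" "stereo p \<bullet> stereo q \<le> 1" by auto
  have "cos (sph_dist p q) \<le> cos \<epsilon>"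
    using assms arccos_bounded[OF b] by (intro cos_monotone_0_pi_le) (auto simp: sph_dist_def)
  then show ?thesis using b by (simp add: sph_dist_def)
qed

lemma sph_dist_less:
  assumes "e > 0"
  obtains \<eta> where "\<eta> > 0" "\<And>p q. norm (stereo p - stereo q) \<le> \<eta> \<Longrightarrow> sph_dist p q < e"
proof -
  define e' where "e' = min e 1"
  have e': "0 < e'" "e' \<le> 1" "e' \<le> e" using assms by (auto simp: e'_def)
  have "e' < pi" using e' pi_gt3 by linarith
  have c: "cos e' < 1" using cos_monotone_0_pi[of 0 e'] e' \<open>e' < pi\<close> by simp
  define \<eta> where "\<eta> = sqrt (1 - cos e')"
  show ?thesis
  proof (rule that[of \<eta>])
    show "\<eta> > 0" using c by (simp add: \<eta>_def)
    fix p q assume n: "norm (stereo p - stereo q) \<le> \<eta>"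
    have "\<bar>stereo p \<bullet> stereo q\<bar> \<le> 1" using Cauchy_Schwarz_ineq2[of "stereo p" "stereo q"] by simp
    moreover have "2 - 2 * (stereo p \<bullet> stereo q) \<le> 1 - cos e'"
      using power_mono[OF n norm_ge_zero, of 2] c unfolding norm_stereo_diff_sq by (simp add: \<eta>_def)
    then have "cos e' < stereo p \<bullet> stereo q" using c by linarith
    ultimately have "arccos (stereo p \<bullet> stereo q) < arccos (cos e')"
      by (intro arccos_less_arccos) auto
    then show "sph_dist p q < e" using e' \<open>e' < pi\<close> by (simp add: sph_dist_def arccos_cos)
  qed
qed

section \<open>Limits of equicontinuous sequences\<close>

lemma stereo_sph_inverse: "stereo (sph_inverse p) = (cnj (fst (stereo p)), - snd (stereo p))"
proof -
  obtain P Q where 1: "P \<noteq> 0 \<or> Q \<noteq> 0" "p = sphere_pt P Q" using sphere_pt_surj by blast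
  then have 2: "Q \<noteq> 0 \<or> P \<noteq> 0" by blast
  show ?thesis unfolding 1(2) sph_inverse_sphere_pt[OF 1(1)] stereo_sphere_pt[OF 1(1)] stereo_sphere_pt[OF 2]
    by (simp add: add.commute mult.commute scaleR_conv_of_real minus_divide_left)
qed

lemma norm_stereo_inverse_diff:
  "norm (stereo (sph_inverse p) - stereo (sph_inverse q)) = norm (stereo p - stereo q)"
proof -
  have "stereo (sph_inverse p) - stereo (sph_inverse q)
      = (cnj (fst (stereo p - stereo q)), - snd (stereo p - stereo q))"
    unfolding stereo_sph_inverse by simp
  then show ?thesis
    unfolding norm_prod_def by (simp only: fst_conv snd_conv complex_mod_cnj norm_minus_cancel)
qed

lemma norm_components_le:
  fixes x :: "complex \<times> real"
  shows "cmod (fst x) \<le> norm x" "\<bar>snd x\<bar> \<le> norm x"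
  using norm_fst_le[of "fst x" "snd x"] norm_snd_le[of "snd x" "fst x"] by simp_all

lemma finite_part_stereo:
  assumes "snd (stereo p) < 1"
  shows "p = Some (finite_part p)" "finite_part p = fst (stereo p) / of_real (1 - snd (stereo p))"
proof -
  obtain z where z: "p = Some z" using assms by (cases p) auto
  then show "p = Some (finite_part p)" by simp
  define n where "n = 1 + (cmod z)\<^sup>2"
  have n: "n > 0" by (simp add: n_def add_pos_nonneg)
  have "1 - ((cmod z)\<^sup>2 - 1) / ((cmod z)\<^sup>2 + 1) = 2 / n"
    using n by (simp add: n_def field_simps)
  then have "fst (stereo p) / of_real (1 - snd (stereo p)) = ((2 / n) *\<^sub>R z) / of_real (2 / n)"
    by (simp add: z n_def)
  also have "\<dots> = z" using n by (simp add: scaleR_conv_of_real)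
  finally show "finite_part p = fst (stereo p) / of_real (1 - snd (stereo p))" by (simp add: z)
qed

lemma range_stereo: "norm x = 1 \<Longrightarrow> x \<in> range stereo"
proof -
  assume nx: "norm x = 1"
  obtain a t where x: "x = (a, t)" by (cases x)
  have at: "(cmod a)\<^sup>2 + t\<^sup>2 = 1" using nx unfolding x norm_prod_def by simp
  show ?thesis
  proof (cases "t = 1")
    case True
    then have "x = stereo None" using at x by simp
    then show ?thesis by blast
  next
    case False
    have "t\<^sup>2 \<le> 1" using at by (metis le_add_same_cancel2 zero_le_power2)
    then have t1: "1 - t > 0" using False by (auto simp: abs_square_le_1)
    define c where "c = 1 - t"
    have c: "c > 0" "t = 1 - c" using t1 by (auto simp: c_def)
    have N: "(cmod a)\<^sup>2 + (cmod (of_real c))\<^sup>2 = 2 * c"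
      using at unfolding c(2) by (simp add: power2_eq_square algebra_simps)
    have N': "(cmod a)\<^sup>2 - (cmod (of_real c))\<^sup>2 = t * (2 * c)"
      using at unfolding c(2) by (simp add: power2_eq_square algebra_simps)
    have nz: "a \<noteq> 0 \<or> (of_real c :: complex) \<noteq> 0" using c by auto
    have "stereo (sphere_pt a (of_real c)) = x"
      unfolding stereo_sphere_pt[OF nz] N N' x using c(1) by (simp add: scaleR_conv_of_real)
    then show ?thesis by (metis rangeI)
  qed
qed

text \<open>
  Away from the north pole stereographic projection \<open>(a, t) \<mapsto> a / (1 - t)\<close> is Lipschitz, so chordal
  uniform convergence becomes uniform convergence of holomorphic functions.
\<close>

lemma lower_hemisphere_limit_lift:
  fixes \<phi> :: "nat \<Rightarrow> complex \<Rightarrow> riemann_sphere"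
  assumes r: "r > 0" and sh: "\<And>n. sphere_holo (ball 0 r) (\<phi> n)"
    and lim: "\<And>e. e > 0 \<Longrightarrow> \<exists>N. \<forall>n\<ge>N. \<forall>w\<in>ball 0 r. norm (stereo (\<phi> n w) - stereo (\<psi> w)) \<le> e"
    and low: "\<And>w. w \<in> ball 0 r \<Longrightarrow> snd (stereo (\<psi> w)) \<le> 1/4"
  shows "\<exists>h. lift_on (ball 0 r) \<psi> h (\<lambda>_. 1)"
proof -
  obtain N where N: "\<forall>n\<ge>N. \<forall>w\<in>ball 0 r. norm (stereo (\<phi> n w) - stereo (\<psi> w)) \<le> 1/4"
    using lim[of "1/4"] by auto
  define \<xi> where "\<xi> n w = finite_part (\<phi> (n + N) w)" for n w
  define h where "h w = finite_part (\<psi> w)" for w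
  have snd_le: "snd (stereo p) \<le> snd (stereo q) + norm (stereo p - stereo q)" for p q
    using norm_components_le(2)[of "stereo p - stereo q"] by simp
  have low': "snd (stereo (\<phi> (n + N) w)) \<le> 1/2" if "w \<in> ball 0 r" for n w
  proof -
    have "norm (stereo (\<phi> (n + N) w) - stereo (\<psi> w)) \<le> 1/4" using N that by simp
    then show ?thesis using snd_le[of "\<phi> (n + N) w" "\<psi> w"] low[OF that] by linarith
  qed
  have \<xi>_hol: "\<xi> n holomorphic_on ball 0 r" for n
  proof -
    have "\<xi> n analytic_on ball 0 r"
    proof (subst analytic_on_analytic_at, rule ballI)
      fix z :: complex assume "z \<in> ball 0 r"
      then obtain d P Q where d: "d > 0" "ball z d \<subseteq> ball 0 r" "lift_on (ball z d) (\<phi> (n + N)) P Q"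
        using sh unfolding sphere_holo_def by blast
      have "Q w \<noteq> 0" if w: "w \<in> ball z d" for w
      proof
        assume "Q w = 0"
        then have "\<phi> (n + N) w = None" using lift_onD[OF d(3) w] by (simp add: sphere_pt_def)
        then show False using low'[of w n] d(2) w by auto
      qed
      then have "(\<lambda>w. P w / Q w) holomorphic_on ball z d"
        using d(3) by (intro holomorphic_on_divide) (auto simp: lift_on_def)
      then have "\<xi> n holomorphic_on ball z d"
        by (rule holomorphic_transform) (simp add: \<xi>_def lift_on_finite_part[OF d(3)])
      then show "\<xi> n analytic_on {z}" using d(1) by (auto simp: analytic_at intro: exI[of _ "ball z d"])
    qed
    then show ?thesis by (rule analytic_imp_holomorphic)
  qed
  have quot: "cmod (a / of_real (1 - s) - b / of_real (1 - t)) \<le> 6 * e"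
    if "s \<le> 1/2" "t \<le> 1/2" "cmod (a - b) \<le> e" "\<bar>s - t\<bar> \<le> e" "cmod b \<le> 1" for a b :: complex and s t e :: real
  proof -
    have st: "1 - s \<ge> 1/2" "1 - t \<ge> 1/2" using that by auto
    then have nz: "(of_real (1 - s) :: complex) \<noteq> 0" "(of_real (1 - t) :: complex) \<noteq> 0" by auto
    have eq: "a / of_real (1 - s) - b / of_real (1 - t)
       = (a - b) / of_real (1 - s) + b * of_real (s - t) / (of_real (1 - s) * of_real (1 - t))"
      using nz by (simp add: divide_simps) (simp add: algebra_simps)
    have "cmod (a / of_real (1 - s) - b / of_real (1 - t))
      \<le> cmod (a - b) / (1 - s) + cmod b * \<bar>s - t\<bar> / ((1 - s) * (1 - t))"
      unfolding eq using st
      by (intro order_trans[OF norm_triangle_ineq]) (simp add: norm_divide norm_mult del: of_real_diff)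
    also have "cmod (a - b) / (1 - s) \<le> e / (1/2)"
      using that st by (intro frac_le) (auto intro: order_trans[OF norm_ge_zero])
    also have "cmod b * \<bar>s - t\<bar> / ((1 - s) * (1 - t)) \<le> (1 * e) / (1/2 * (1/2))"
      using that st by (intro frac_le mult_mono) (auto intro: order_trans[OF norm_ge_zero])
    finally show ?thesis by simp
  qed
  have ul: "uniform_limit (ball 0 r) \<xi> h sequentially"
    unfolding uniform_limit_iff
  proof (intro allI impI)
    fix e :: real assume e: "e > 0"
    obtain K where K: "\<forall>n\<ge>K. \<forall>w\<in>ball 0 r. norm (stereo (\<phi> n w) - stereo (\<psi> w)) \<le> e / 12"
      using lim[of "e / 12"] e by auto
    show "\<forall>\<^sub>F n in sequentially. \<forall>w\<in>ball 0 r. dist (\<xi> n w) (h w) < e"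
      unfolding eventually_sequentially
    proof (intro exI[of _ K] allI impI ballI)
      fix n and w :: complex assume n: "K \<le> n" and w: "w \<in> ball 0 r"
      have nn: "norm (stereo (\<phi> (n + N) w) - stereo (\<psi> w)) \<le> e / 12" using K n w by simp
      have l1: "snd (stereo (\<phi> (n + N) w)) \<le> 1/2" "snd (stereo (\<psi> w)) \<le> 1/2" using low'[OF w] low[OF w] by auto
      have "cmod (\<xi> n w - h w) \<le> 6 * (e / 12)"
      proof -
        have "\<xi> n w = fst (stereo (\<phi> (n + N) w)) / of_real (1 - snd (stereo (\<phi> (n + N) w)))"
          unfolding \<xi>_def using l1 by (intro finite_part_stereo) auto
        moreover have "h w = fst (stereo (\<psi> w)) / of_real (1 - snd (stereo (\<psi> w)))"
          unfolding h_def using l1 by (intro finite_part_stereo) auto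
        moreover have "cmod (fst (stereo (\<phi> (n + N) w)) - fst (stereo (\<psi> w))) \<le> e / 12"
          using norm_components_le(1)[of "stereo (\<phi> (n + N) w) - stereo (\<psi> w)"] nn by simp
        moreover have "\<bar>snd (stereo (\<phi> (n + N) w)) - snd (stereo (\<psi> w))\<bar> \<le> e / 12"
          using norm_components_le(2)[of "stereo (\<phi> (n + N) w) - stereo (\<psi> w)"] nn by simp
        moreover have "cmod (fst (stereo (\<psi> w))) \<le> 1" using norm_components_le(1)[of "stereo (\<psi> w)"] by simp
        ultimately show ?thesis using quot l1 by metis
      qed
      then show "dist (\<xi> n w) (h w) < e" using e by (simp add: dist_norm)
    qed
  qed
  have "h holomorphic_on ball 0 r"
  proof (rule holomorphic_uniform_sequence[OF open_ball \<xi>_hol])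
    fix x :: complex assume "x \<in> ball 0 r"
    then obtain d where "d > 0" "cball x d \<subseteq> ball 0 r" using open_contains_cball open_ball by blast
    then show "\<exists>d>0. cball x d \<subseteq> ball 0 r \<and> uniform_limit (cball x d) \<xi> h sequentially"
      using uniform_limit_on_subset[OF ul] by blast
  qed
  moreover have "\<psi> w = sphere_pt (h w) 1" if "w \<in> ball 0 r" for w
    using finite_part_stereo(1)[of "\<psi> w"] low[OF that] by (simp add: h_def sphere_pt_def)
  ultimately have "lift_on (ball 0 r) \<psi> h (\<lambda>_. 1)" by (simp add: lift_on_def)
  then show ?thesis by blast
qed

text \<open>
  By equicontinuity the limit stays close to the hemisphere of its value at the centre on a whole disc.
  Inversion of the sphere exchanges the hemispheres.
\<close>

lemma limit_local_lift:
  fixes \<phi> :: "nat \<Rightarrow> complex \<Rightarrow> riemann_sphere"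
  assumes r: "r > 0" and L: "L \<ge> 0" and sh: "\<And>n. sphere_holo (ball 0 r) (\<phi> n)"
    and lim: "\<And>e. e > 0 \<Longrightarrow> \<exists>N. \<forall>n\<ge>N. \<forall>w\<in>ball 0 r. norm (stereo (\<phi> n w) - stereo (\<psi> w)) \<le> e"
    and lip: "\<And>z w. z \<in> ball 0 r \<Longrightarrow> w \<in> ball 0 r \<Longrightarrow> norm (stereo (\<psi> z) - stereo (\<psi> w)) \<le> L * cmod (z - w)"
  shows "\<exists>d>0. \<exists>P Q. lift_on (ball 0 d) \<psi> P Q"
proof -
  define d where "d = min r (1 / (4 * (L + 1)))"
  have d: "d > 0" "d \<le> r" using r L by (auto simp: d_def)
  have near: "\<bar>snd (stereo (\<psi> w)) - snd (stereo (\<psi> 0))\<bar> \<le> 1/4" if w: "w \<in> ball 0 d" for w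
  proof -
    have "\<bar>snd (stereo (\<psi> w)) - snd (stereo (\<psi> 0))\<bar> \<le> norm (stereo (\<psi> w) - stereo (\<psi> 0))"
      using norm_components_le(2)[of "stereo (\<psi> w) - stereo (\<psi> 0)"] by simp
    also have "\<dots> \<le> L * cmod (w - 0)" using w d r by (intro lip) auto
    also have "\<dots> \<le> (L + 1) * (1 / (4 * (L + 1)))" using w L by (intro mult_mono) (auto simp: d_def)
    also have "\<dots> = 1/4" using L by simp
    finally show ?thesis .
  qed
  have sub: "ball 0 d \<subseteq> ball (0::complex) r" using d by auto
  show ?thesis
  proof (cases "snd (stereo (\<psi> 0)) \<le> 0")
    case True
    have "\<exists>h. lift_on (ball 0 d) \<psi> h (\<lambda>_. 1)"
    proof (rule lower_hemisphere_limit_lift[OF d(1)])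
      show "sphere_holo (ball 0 d) (\<phi> n)" for n by (rule sphere_holo_open_subset[OF sh open_ball sub])
      show "\<exists>N. \<forall>n\<ge>N. \<forall>w\<in>ball 0 d. norm (stereo (\<phi> n w) - stereo (\<psi> w)) \<le> e" if "e > 0" for e
        using lim[OF that] sub by blast
      show "snd (stereo (\<psi> w)) \<le> 1/4" if "w \<in> ball 0 d" for w using near[OF that] True by linarith
    qed
    then show ?thesis using d by blast
  next
    case False
    have "\<exists>h. lift_on (ball 0 d) (\<lambda>w. sph_inverse (\<psi> w)) h (\<lambda>_. 1)"
    proof (rule lower_hemisphere_limit_lift[OF d(1)])
      show "sphere_holo (ball 0 d) (\<lambda>w. sph_inverse (\<phi> n w))" for n
        using sphere_holo_open_subset[OF sh open_ball sub] lift_on_inverse unfolding sphere_holo_def by blast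
      show "\<exists>N. \<forall>n\<ge>N. \<forall>w\<in>ball 0 d. norm (stereo (sph_inverse (\<phi> n w)) - stereo (sph_inverse (\<psi> w))) \<le> e" if "e > 0" for e
        unfolding norm_stereo_inverse_diff using lim[OF that] sub by blast
      show "snd (stereo (sph_inverse (\<psi> w))) \<le> 1/4" if "w \<in> ball 0 d" for w
        using near[OF that] False unfolding stereo_sph_inverse snd_conv by linarith
    qed
    then obtain h where "lift_on (ball 0 d) (\<lambda>w. sph_inverse (\<psi> w)) h (\<lambda>_. 1)" by blast
    from lift_on_inverse[OF this] have "lift_on (ball 0 d) (\<lambda>w. sph_inverse (sph_inverse (\<psi> w))) (\<lambda>_. 1) h" .
    moreover have "sph_inverse (sph_inverse q) = q" for q by (cases q) auto
    ultimately show ?thesis using d by auto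
  qed
qed

text \<open>
  The argument of \<open>sphere_holo_dichotomy\<close>, now on the connected set \<open>D\<close> in the sphere.
\<close>

lemma local_lifts_meromorphic_or_infinity:
  assumes D: "openin sphere_top D" "connectedin sphere_top D"
    and lift: "\<And>p. p \<in> D \<Longrightarrow> \<exists>d>0. \<exists>P Q. lift_on (ball 0 d) (\<lambda>w. g (sph_chart p w)) P Q"
  shows "g \<in> meromorphic_fns D \<union> infinity_fns D"
proof -
  define A where "A = \<Union>{U. openin sphere_top U \<and> U \<subseteq> D \<and> (\<forall>q\<in>U. g q = None)}"
  define B where "B = \<Union>{U. openin sphere_top U \<and> U \<subseteq> D \<and> (\<exists>p\<in>U. \<forall>q\<in>U - {p}. g q \<noteq> None)}"
  have op: "openin sphere_top A" "openin sphere_top B" unfolding A_def B_def by (intro openin_Union; blast)+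
  have cover: "D \<subseteq> A \<union> B"
  proof
    fix p assume p: "p \<in> D"
    obtain d P Q where d: "d > 0" "lift_on (ball 0 d) (\<lambda>w. g (sph_chart p w)) P Q" using lift[OF p] by blast
    obtain c where c: "c > 0" "sph_chart p ` ball 0 c \<subseteq> D" using chart_ball_in_open[OF D(1) p] .
    from lift_on_locally_none_or_isolated[OF d] show "p \<in> A \<union> B"
    proof
      assume *: "\<forall>w\<in>ball 0 d. g (sph_chart p w) = None"
      define U where "U = sph_chart p ` ball 0 (min c d)"
      have "p \<in> U" unfolding U_def using c d by (intro image_eqI[of _ _ 0]) auto
      moreover have "openin sphere_top U" unfolding U_def by (rule openin_chart_ball)
      moreover have "U \<subseteq> D" "\<forall>q\<in>U. g q = None" using c * by (auto simp: U_def)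
      ultimately show ?thesis unfolding A_def by blast
    next
      assume "\<exists>\<rho>'>0. \<rho>' \<le> d \<and> (\<forall>w\<in>ball 0 \<rho>' - {0}. g (sph_chart p w) \<noteq> None)"
      then obtain e where e: "e > 0" "\<forall>w\<in>ball 0 e - {0}. g (sph_chart p w) \<noteq> None" by blast
      define U where "U = sph_chart p ` ball 0 (min c e)"
      have "p \<in> U" unfolding U_def using c e by (intro image_eqI[of _ _ 0]) auto
      moreover have "openin sphere_top U" unfolding U_def by (rule openin_chart_ball)
      moreover have "U \<subseteq> D" using c by (auto simp: U_def)
      moreover have "g q \<noteq> None" if q: "q \<in> U - {p}" for q
      proof -
        obtain w where w: "w \<in> ball 0 (min c e)" "q = sph_chart p w" using q by (auto simp: U_def)
        then have "w \<noteq> 0" using q by auto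
        then show ?thesis using w e(2) by auto
      qed
      ultimately show ?thesis unfolding B_def by blast
    qed
  qed
  have disj: "A \<inter> B = {}"
  proof (rule ccontr)
    assume "A \<inter> B \<noteq> {}"
    then obtain x U V p where U: "openin sphere_top U" "x \<in> U" "\<forall>q\<in>U. g q = None"
      and V: "openin sphere_top V" "x \<in> V" "\<forall>q\<in>V - {p}. g q \<noteq> None"
      unfolding A_def B_def by blast
    obtain c where c: "c > 0" "sph_chart x ` ball 0 c \<subseteq> U \<inter> V"
      using chart_ball_in_open[OF openin_Int[OF U(1) V(1)]] U(2) V(2) by blast
    have in_c: "of_real (c/2) \<in> ball (0::complex) c" "of_real (c/3) \<in> ball (0::complex) c" using c(1) by auto
    then have "sph_chart x (of_real (c/2)) \<in> U \<inter> V" "sph_chart x (of_real (c/3)) \<in> U \<inter> V" using c(2) by blast+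
    then have "sph_chart x (of_real (c/2)) = p" "sph_chart x (of_real (c/3)) = p" using U(3) V(3) by blast+
    then have "sph_chart x (of_real (c/2)) = sph_chart x (of_real (c/3))" by simp
    then have "(of_real (c/2) :: complex) = of_real (c/3)" unfolding sph_chart_eq_iff .
    then show False using c(1) unfolding of_real_eq_iff by simp
  qed
  have "A \<inter> D = {} \<or> B \<inter> D = {}"
    using connectedinD[OF D(2) op cover] disj by blast
  then show ?thesis
  proof
    assume "B \<inter> D = {}"
    then have "D \<subseteq> A" using cover by blast
    then have "g \<in> infinity_fns D" by (auto simp: infinity_fns_def A_def)
    then show ?thesis by blast
  next
    assume "A \<inter> D = {}"
    have "(\<lambda>w. finite_part (g (sph_chart p w))) nicely_meromorphic_on {0} \<and>
       (g p = None \<longleftrightarrow> is_pole (\<lambda>w. finite_part (g (sph_chart p w))) 0)" if p: "p \<in> D" for p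
    proof -
      obtain d P Q where d: "d > 0" "lift_on (ball 0 d) (\<lambda>w. g (sph_chart p w)) P Q" using lift[OF p] by blast
      obtain c where c: "c > 0" "sph_chart p ` ball 0 c \<subseteq> D" using chart_ball_in_open[OF D(1) p] .
      have not_none: "\<not> (\<forall>w\<in>ball 0 d. g (sph_chart p w) = None)"
      proof
        assume *: "\<forall>w\<in>ball 0 d. g (sph_chart p w) = None"
        define U where "U = sph_chart p ` ball 0 (min c d)"
        have "p \<in> U" unfolding U_def using c d by (intro image_eqI[of _ _ 0]) auto
        moreover have "openin sphere_top U" unfolding U_def by (rule openin_chart_ball)
        moreover have "U \<subseteq> D" "\<forall>q\<in>U. g q = None" using c * by (auto simp: U_def)
        ultimately have "p \<in> A" unfolding A_def by blast
        then show False using \<open>A \<inter> D = {}\<close> p by blast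
      qed
      then obtain e where e: "e > 0" "\<forall>w\<in>ball 0 e - {0}. g (sph_chart p w) \<noteq> None"
        using lift_on_locally_none_or_isolated[OF d] by blast
      show ?thesis
        using lift_on_nicely_meromorphic[OF d e(1) bspec[OF e(2)]] by simp
    qed
    then show ?thesis by (simp add: meromorphic_fns_def)
  qed
qed

lemma chart_dense:
  assumes E: "\<And>X. open X \<Longrightarrow> X \<noteq> {} \<Longrightarrow> \<exists>x\<in>E. x \<in> X" and V: "open V" "V \<noteq> {}"
  shows "\<exists>u\<in>V. sph_chart p u \<in> Some ` (E :: complex set)"
proof (cases p)
  case (Some c)
  have "open ((\<lambda>w. c + w) ` V)" "(\<lambda>w. c + w) ` V \<noteq> {}" using V by (auto simp: open_translation)
  from E[OF this] show ?thesis using Some by auto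
next
  case None
  have "V - {0} \<noteq> {}"
  proof
    assume "V - {0} = {}"
    then have "V = {0}" using V(2) by blast
    then show False using V(1) not_open_singleton[of "0::complex"] by simp
  qed
  then obtain v where v: "v \<in> V" "v \<noteq> 0" by blast
  define X where "X = (\<lambda>x. 1 / x) -` V \<inter> (- {0})"
  have "continuous_on (- {0}) (\<lambda>x::complex. 1 / x)"
    by (intro continuous_on_divide continuous_on_const continuous_on_id) simp
  then have "open X" unfolding X_def
    using continuous_on_open_vimage[of "- {0::complex}" "\<lambda>x. 1 / x"] V(1) open_Compl[OF closed_singleton] by metis
  moreover have "1 / v \<in> X" using v by (simp add: X_def)
  ultimately obtain x where "x \<in> E" "x \<in> X" using E by blast
  then show ?thesis using None by (intro bexI[of _ "1 / x"]) (auto simp: X_def)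
qed

text \<open>
  The Arzela-Ascoli argument.  A diagonal subsequence converges on the countable dense set of finite
  points with coordinates in \<open>E\<close>, which meets every chart in a dense set.  Equicontinuity makes it uniformly
  Cauchy on small discs of the charts.
\<close>

lemma equicontinuous_on_charts_imp_normal:
  assumes D: "sphere_domain D"
    and F: "F \<subseteq> meromorphic_fns D"
    and equi: "\<And>p. p \<in> D \<Longrightarrow> \<exists>r L. 0 < r \<and> 0 \<le> L \<and> sph_chart p ` ball 0 r \<subseteq> D \<and>
      (\<forall>f\<in>F. \<forall>z\<in>ball 0 r. \<forall>w\<in>ball 0 r. norm (stereo (f (sph_chart p z)) - stereo (f (sph_chart p w))) \<le> L * cmod (z - w))"
  shows "normal_family D F"
  unfolding normal_family_def
proof (intro allI impI)
  fix s :: "nat \<Rightarrow> riemann_sphere \<Rightarrow> riemann_sphere"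
  assume "range s \<subseteq> F"
  then have sF: "s n \<in> F" for n by blast
  have Do: "openin sphere_top D" "connectedin sphere_top D" using D by (auto simp: sphere_domain_def)
  obtain E :: "complex set" where E: "countable E" "\<And>X. open X \<Longrightarrow> X \<noteq> {} \<Longrightarrow> \<exists>x\<in>E. x \<in> X"
    using countable_dense_exists by blast
  obtain k :: "nat \<Rightarrow> nat" where k: "strict_mono k"
    "\<And>q. q \<in> Some ` E \<Longrightarrow> \<exists>l. (\<lambda>n. stereo (s (k n) q)) \<longlonglongrightarrow> l"
    by (rule function_convergent_subsequence[of "Some ` E" "\<lambda>n q. stereo (s n q)" 1]) (use E(1) in auto)
  define S where "S n p w = stereo (s (k n) (sph_chart p w))" for n p w
  define good where "good p r L \<longleftrightarrow> 0 < r \<and> 0 \<le> L \<and> sph_chart p ` ball 0 r \<subseteq> D \<and>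
      (\<forall>f\<in>F. \<forall>z\<in>ball 0 r. \<forall>w\<in>ball 0 r.
         norm (stereo (f (sph_chart p z)) - stereo (f (sph_chart p w))) \<le> L * cmod (z - w))" for p r L
  have "\<forall>p\<in>D. \<exists>r L. good p r L" using equi unfolding good_def by blast
  then obtain r L where rL: "\<And>p. p \<in> D \<Longrightarrow> good p (r p) (L p)" by metis
  have r: "0 < r p" "ball 0 (r p / 2) \<subseteq> ball (0::complex) (r p)" and L: "0 \<le> L p"
    and in_D: "\<And>w. w \<in> ball 0 (r p) \<Longrightarrow> sph_chart p w \<in> D"
    and lip: "\<And>n z w. z \<in> ball 0 (r p) \<Longrightarrow> w \<in> ball 0 (r p) \<Longrightarrow> norm (S n p z - S n p w) \<le> L p * cmod (z - w)"
    if "p \<in> D" for p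
    using rL[OF that] sF unfolding good_def S_def by auto
  have cauchy: "\<exists>N. \<forall>m\<ge>N. \<forall>n\<ge>N. \<forall>w\<in>ball 0 (r p / 2). norm (S m p w - S n p w) \<le> e"
    if p: "p \<in> D" and e: "e > 0" for p e
  proof -
    define \<eta> where "\<eta> = e / (3 * (L p + 1))"
    have \<eta>: "\<eta> > 0" using e L[OF p] by (simp add: \<eta>_def)
    have L\<eta>: "L p * \<eta> \<le> e / 3"
    proof -
      have "L p * \<eta> \<le> (L p + 1) * \<eta>" using \<eta> by (intro mult_right_mono) auto
      also have "\<dots> = e / 3" using L[OF p] by (simp add: \<eta>_def field_simps)
      finally show ?thesis .
    qed
    define T where "T = {u \<in> ball 0 (r p). sph_chart p u \<in> Some ` E}"
    have "cball 0 (r p / 2) \<subseteq> (\<Union>u\<in>T. ball u \<eta>)"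
    proof
      fix x :: complex assume x: "x \<in> cball 0 (r p / 2)"
      have "x \<in> ball x \<eta> \<inter> ball 0 (r p)" using x r[OF p] \<eta> by auto
      then have ne: "ball x \<eta> \<inter> ball 0 (r p) \<noteq> {}" by blast
      obtain u where u: "u \<in> ball x \<eta> \<inter> ball 0 (r p)" "sph_chart p u \<in> Some ` E"
        using chart_dense[OF E(2) open_Int[OF open_ball open_ball] ne] by blast
      then have "u \<in> T" "x \<in> ball u \<eta>" by (auto simp: T_def dist_commute)
      then show "x \<in> (\<Union>u\<in>T. ball u \<eta>)" by blast
    qed
    then obtain T0 where T0: "T0 \<subseteq> T" "finite T0" "cball 0 (r p / 2) \<subseteq> (\<Union>u\<in>T0. ball u \<eta>)"
      using compactE_image[OF compact_cball, of T "\<lambda>u. ball u \<eta>"] by (metis open_ball)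
    have "\<exists>N. \<forall>m\<ge>N. \<forall>n\<ge>N. norm (S m p u - S n p u) < e / 3"
      if u: "u \<in> T0" for u
    proof -
      have "sph_chart p u \<in> Some ` E" using u T0(1) by (auto simp: T_def)
      then obtain l where "(\<lambda>n. S n p u) \<longlonglongrightarrow> l" using k(2) unfolding S_def by blast
      then have "Cauchy (\<lambda>n. S n p u)" by (rule LIMSEQ_imp_Cauchy)
      then show ?thesis using CauchyD[of _ "e/3"] e by auto
    qed
    then obtain N where N: "\<And>u m n. u \<in> T0 \<Longrightarrow> m \<ge> N u \<Longrightarrow> n \<ge> N u \<Longrightarrow>
      norm (S m p u - S n p u) < e / 3" by metis
    define M where "M = Max (insert 0 (N ` T0))"
    have MN: "N u \<le> M" if "u \<in> T0" for u unfolding M_def using T0(2) that by (intro Max_ge) auto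
    show ?thesis
    proof (intro exI[of _ M] allI impI ballI)
      fix m n :: nat and w :: complex
      assume mn: "M \<le> m" "M \<le> n" and w: "w \<in> ball 0 (r p / 2)"
      then obtain u where u: "u \<in> T0" "w \<in> ball u \<eta>" using T0(3) ball_subset_cball by blast
      have ur: "u \<in> ball 0 (r p)" "w \<in> ball 0 (r p)" using u(1) T0(1) w r[OF p] by (auto simp: T_def)
      have close: "norm (S j p w - S j p u) \<le> e / 3" for j
      proof -
        have "norm (S j p w - S j p u) \<le> L p * cmod (w - u)"
          by (rule lip[OF p ur(2,1)])
        also have "\<dots> \<le> L p * \<eta>" using u(2) L[OF p] by (intro mult_left_mono) (auto simp: dist_norm norm_minus_commute)
        finally show ?thesis using L\<eta> by linarith
      qed
      have mid: "norm (S m p u - S n p u) < e / 3"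
        using N[OF u(1)] MN[OF u(1)] mn by simp
      have tri: "norm (a - d) \<le> norm (a - b) + norm (b - c) + norm (d - c)" for a b c d :: "complex \<times> real"
        using norm_triangle_ineq[of "a - b" "b - c"] norm_triangle_ineq4[of "a - c" "d - c"] by simp
      show "norm (S m p w - S n p w) \<le> e"
        using tri[of "S m p w" "S n p w"
            "S m p u" "S n p u"]
          close[of m] close[of n] mid by linarith
    qed
  qed
  have conv: "\<exists>y. (\<lambda>n. stereo (s (k n) q)) \<longlonglongrightarrow> stereo y" if q: "q \<in> D" for q
  proof -
    have "Cauchy (\<lambda>n. S n q 0)"
    proof (rule CauchyI)
      fix e :: real assume "e > 0"
      then have "e / 2 > 0" by simp
      then obtain N where "\<forall>m\<ge>N. \<forall>n\<ge>N. \<forall>w\<in>ball 0 (r q / 2). norm (S m q w - S n q w) \<le> e / 2"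
        using cauchy[OF q] by blast
      then have "\<forall>m\<ge>N. \<forall>n\<ge>N. norm (S m q 0 - S n q 0) \<le> e / 2" using r(1)[OF q] by simp
      then show "\<exists>M. \<forall>m\<ge>M. \<forall>n\<ge>M. norm (S m q 0 - S n q 0) < e"
        using \<open>e > 0\<close> by (intro exI[of _ N]) fastforce
    qed
    then obtain l where l: "(\<lambda>n. stereo (s (k n) q)) \<longlonglongrightarrow> l"
      unfolding S_def sph_chart_0 using Cauchy_convergent_iff convergent_def by blast
    have "(\<lambda>n. norm (stereo (s (k n) q))) \<longlonglongrightarrow> norm l" by (rule tendsto_norm[OF l])
    then have "norm l = 1" by (simp add: LIMSEQ_const_iff)
    then show ?thesis using range_stereo[of l] l by blast
  qed
  then obtain g where g: "\<And>q. q \<in> D \<Longrightarrow> (\<lambda>n. stereo (s (k n) q)) \<longlonglongrightarrow> stereo (g q)" by metis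
  have g_lim: "(\<lambda>n. S n p w) \<longlonglongrightarrow> stereo (g (sph_chart p w))" if "p \<in> D" "w \<in> ball 0 (r p / 2)" for p w
    unfolding S_def using that r(2)[OF that(1)] by (intro g in_D) auto
  have unif: "\<exists>N. \<forall>n\<ge>N. \<forall>w\<in>ball 0 (r p / 2). norm (S n p w - stereo (g (sph_chart p w))) \<le> e"
    if p: "p \<in> D" and e: "e > 0" for p e
  proof -
    obtain N where N: "\<forall>m\<ge>N. \<forall>n\<ge>N. \<forall>w\<in>ball 0 (r p / 2). norm (S m p w - S n p w) \<le> e"
      using cauchy[OF p e] by blast
    show ?thesis
    proof (intro exI[of _ N] allI impI ballI)
      fix n and w :: complex assume n: "N \<le> n" and w: "w \<in> ball 0 (r p / 2)"
      have "(\<lambda>m. norm (S n p w - S m p w)) \<longlonglongrightarrow> norm (S n p w - stereo (g (sph_chart p w)))"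
        by (intro tendsto_intros g_lim p w)
      then show "norm (S n p w - stereo (g (sph_chart p w))) \<le> e"
        by (rule LIMSEQ_le_const2) (use N n w in blast)
    qed
  qed
  have "g \<in> meromorphic_fns D \<union> infinity_fns D"
  proof (rule local_lifts_meromorphic_or_infinity[OF Do])
    fix p assume p: "p \<in> D"
    show "\<exists>d>0. \<exists>P Q. lift_on (ball 0 d) (\<lambda>w. g (sph_chart p w)) P Q"
    proof (rule limit_local_lift[where \<phi> = "\<lambda>n w. s (k n) (sph_chart p w)" and L = "L p"])
      show "0 < r p / 2" "0 \<le> L p" using r[OF p] L[OF p] by auto
      show "sphere_holo (ball 0 (r p / 2)) (\<lambda>w. s (k n) (sph_chart p w))" for n
      proof (rule meromorphic_or_infinity_sphere_holo[OF _ Do(1) open_ball])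
        show "s (k n) \<in> meromorphic_fns D \<union> infinity_fns D" using sF F by blast
        show "sph_chart p ` ball 0 (r p / 2) \<subseteq> D" using in_D[OF p] r(2)[OF p] by blast
      qed
      show "\<exists>N. \<forall>n\<ge>N. \<forall>w\<in>ball 0 (r p / 2). norm (stereo (s (k n) (sph_chart p w)) - stereo (g (sph_chart p w))) \<le> e"
        if "e > 0" for e using unif[OF p that] unfolding S_def .
      fix z w :: complex assume zw: "z \<in> ball 0 (r p / 2)" "w \<in> ball 0 (r p / 2)"
      have "(\<lambda>n. norm (S n p z - S n p w)) \<longlonglongrightarrow> norm (stereo (g (sph_chart p z)) - stereo (g (sph_chart p w)))"
        by (intro tendsto_intros g_lim p zw)
      then show "norm (stereo (g (sph_chart p z)) - stereo (g (sph_chart p w))) \<le> L p * cmod (z - w)"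
        by (rule LIMSEQ_le_const2) (use lip[OF p] zw r(2)[OF p] in blast)
    qed
  qed
  moreover have "locally_uniform_limit D (s \<circ> k) g"
    unfolding locally_uniform_limit_def
  proof
    fix p assume p: "p \<in> D"
    define U where "U = sph_chart p ` ball 0 (r p / 2)"
    have U: "openin sphere_top U" unfolding U_def by (rule openin_chart_ball)
    have pU: "p \<in> U" unfolding U_def using r(1)[OF p] by (intro image_eqI[of _ _ 0]) auto
    have UD: "U \<subseteq> D" using in_D[OF p] r(2)[OF p] unfolding U_def by blast
    have "\<exists>N. \<forall>n\<ge>N. \<forall>q\<in>U. sph_dist ((s \<circ> k) n q) (g q) < e" if e: "e > 0" for e
    proof -
      obtain \<eta> where \<eta>: "\<eta> > 0" "\<And>p q. norm (stereo p - stereo q) \<le> \<eta> \<Longrightarrow> sph_dist p q < e"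
        using sph_dist_less[OF e] by blast
      obtain N where "\<forall>n\<ge>N. \<forall>w\<in>ball 0 (r p / 2). norm (S n p w - stereo (g (sph_chart p w))) \<le> \<eta>"
        using unif[OF p \<eta>(1)] by blast
      then have "sph_dist ((s \<circ> k) n q) (g q) < e" if "n \<ge> N" "q \<in> U" for n q
        using that unfolding U_def S_def by (auto intro!: \<eta>(2))
      then show ?thesis by blast
    qed
    then show "\<exists>U. openin sphere_top U \<and> p \<in> U \<and> U \<subseteq> D \<and>
       (\<forall>e>0. \<exists>N. \<forall>n\<ge>N. \<forall>q\<in>U. sph_dist ((s \<circ> k) n q) (g q) < e)"
      using U pU UD by blast
  qed
  ultimately show "\<exists>r g. strict_mono r \<and> g \<in> meromorphic_fns D \<union> infinity_fns D \<and> locally_uniform_limit D (s \<circ> r) g"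
    using k(1) by blast
qed

section \<open>Normality\<close>

theorem theorem1p6:
  fixes D :: "riemann_sphere set"
    and F :: "(riemann_sphere \<Rightarrow> riemann_sphere) set"
    and \<epsilon> :: real
  assumes "sphere_domain D"
    and "F \<subseteq> meromorphic_fns D"
    and "\<epsilon> > 0"
    and "\<forall>f\<in>F. \<exists>a :: nat \<Rightarrow> riemann_sphere \<Rightarrow> riemann_sphere.
           (\<forall>j\<in>{1,2,3}. a j \<in> meromorphic_fns D \<union> infinity_fns D) \<and>
           (\<forall>j\<in>{1,2,3}. \<forall>k\<in>{1,2,3}. j \<noteq> k \<longrightarrow>
              (\<forall>z\<in>D. sph_dist (a j z) (a k z) \<ge> \<epsilon>)) \<and>
           (\<forall>z\<in>D. f z = a 1 z \<longrightarrow> zero_multiplicity D f (a 1) z \<ge> 4) \<and>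
           (\<forall>j\<in>{2,3}. \<forall>z\<in>D. f z = a j z \<longrightarrow> zero_multiplicity D f (a j) z \<ge> 3)"
  shows "normal_family D F"
proof (rule equicontinuous_on_charts_imp_normal[OF assms(1,2)])
  fix p assume p: "p \<in> D"
  have Do: "openin sphere_top D" using assms(1) by (simp add: sphere_domain_def)
  obtain R where R: "R > 0" "sph_chart p ` ball 0 R \<subseteq> D" using chart_ball_in_open[OF Do p] .
  \<comment> \<open>The cosine is decreasing only on \<open>[0, \<pi>]\<close>, and \<open>\<epsilon>\<close> may be larger.\<close>
  define \<epsilon>' where "\<epsilon>' = min \<epsilon> 1"
  have \<epsilon>': "0 < \<epsilon>'" "\<epsilon>' \<le> 1" "\<epsilon>' \<le> \<epsilon>" using assms(3) by (auto simp: \<epsilon>'_def)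
  define \<kappa> where "\<kappa> = 1 - cos \<epsilon>'"
  have "\<epsilon>' \<le> pi" using \<epsilon>' pi_gt3 by linarith
  then have \<kappa>: "\<kappa> > 0" using cos_monotone_0_pi[of 0 \<epsilon>'] \<epsilon>' by (simp add: \<kappa>_def)
  obtain C r where Cr: "0 \<le> C" "0 < r"
    and bd: "\<And>\<phi> a1 a2 a3. sphere_holo (ball 0 R) \<phi> \<Longrightarrow> sphere_holo (ball 0 R) a1 \<Longrightarrow>
      sphere_holo (ball 0 R) a2 \<Longrightarrow> sphere_holo (ball 0 R) a3 \<Longrightarrow>
     (\<forall>z\<in>ball 0 R. stereo (a1 z) \<bullet> stereo (a2 z) \<le> 1 - \<kappa> \<and> stereo (a2 z) \<bullet> stereo (a3 z) \<le> 1 - \<kappa>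
        \<and> stereo (a3 z) \<bullet> stereo (a1 z) \<le> 1 - \<kappa>) \<Longrightarrow>
     contact_ge 4 \<phi> a1 (ball 0 R) \<Longrightarrow> contact_ge 3 \<phi> a2 (ball 0 R) \<Longrightarrow> contact_ge 3 \<phi> a3 (ball 0 R) \<Longrightarrow>
     (\<exists>P Q. lift_on (ball 0 r) \<phi> P Q \<and> (\<forall>z\<in>ball 0 (r/4).
        cmod (deriv P z * Q z - P z * deriv Q z) \<le> C * ((cmod (P z))\<^sup>2 + (cmod (Q z))\<^sup>2)))"
    using spherical_derivative_bound[OF R(1) \<kappa>] by blast
  define \<rho> where "\<rho> = min R (r/4)"
  have \<rho>: "\<rho> > 0" "\<rho> \<le> R" "\<rho> \<le> r/4" using R Cr by (auto simp: \<rho>_def)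
  have "norm (stereo (f (sph_chart p z)) - stereo (f (sph_chart p w))) \<le> (2 * C + 1) * cmod (z - w)"
    if f: "f \<in> F" and zw: "z \<in> ball 0 \<rho>" "w \<in> ball 0 \<rho>" for f z w
  proof -
    obtain a :: "nat \<Rightarrow> riemann_sphere \<Rightarrow> riemann_sphere" where
      a: "\<forall>j\<in>{1,2,3}. a j \<in> meromorphic_fns D \<union> infinity_fns D"
      and sep: "\<forall>j\<in>{1,2,3}. \<forall>k\<in>{1,2,3}. j \<noteq> k \<longrightarrow> (\<forall>z\<in>D. sph_dist (a j z) (a k z) \<ge> \<epsilon>)"
      and m1: "\<forall>z\<in>D. f z = a 1 z \<longrightarrow> zero_multiplicity D f (a 1) z \<ge> 4"
      and m23: "\<forall>j\<in>{2,3}. \<forall>z\<in>D. f z = a j z \<longrightarrow> zero_multiplicity D f (a j) z \<ge> 3"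
      using bspec[OF assms(4) f] by (elim exE conjE) (rule that)
    have fm: "f \<in> meromorphic_fns D \<union> infinity_fns D" using assms(2) f by blast
    have am: "a 1 \<in> meromorphic_fns D \<union> infinity_fns D" "a 2 \<in> meromorphic_fns D \<union> infinity_fns D"
      "a 3 \<in> meromorphic_fns D \<union> infinity_fns D" using a by auto
    have sep': "stereo (a i q) \<bullet> stereo (a j q) \<le> 1 - \<kappa>"
      if "i \<in> {1,2,3}" "j \<in> {1,2,3}" "i \<noteq> j" "q \<in> D" for i j q
    proof -
      have "sph_dist (a i q) (a j q) \<ge> \<epsilon>'" using sep that \<epsilon>'(3) by (meson order_trans)
      then show ?thesis using sph_dist_ge_inner[of \<epsilon>'] \<epsilon>'(1) by (simp add: \<kappa>_def)
    qed
    have holo: "sphere_holo (ball 0 R) (\<lambda>w. h (sph_chart p w))" if "h \<in> meromorphic_fns D \<union> infinity_fns D" for h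
      using meromorphic_or_infinity_sphere_holo[OF that Do open_ball R(2)] .
    have "\<exists>P Q. lift_on (ball 0 r) (\<lambda>w. f (sph_chart p w)) P Q \<and> (\<forall>z\<in>ball 0 (r/4).
        cmod (deriv P z * Q z - P z * deriv Q z) \<le> C * ((cmod (P z))\<^sup>2 + (cmod (Q z))\<^sup>2))"
    proof (rule bd[of _ "\<lambda>w. a 1 (sph_chart p w)" "\<lambda>w. a 2 (sph_chart p w)" "\<lambda>w. a 3 (sph_chart p w)"])
      show "\<forall>z\<in>ball 0 R. stereo (a 1 (sph_chart p z)) \<bullet> stereo (a 2 (sph_chart p z)) \<le> 1 - \<kappa> \<and>
          stereo (a 2 (sph_chart p z)) \<bullet> stereo (a 3 (sph_chart p z)) \<le> 1 - \<kappa> \<and>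
          stereo (a 3 (sph_chart p z)) \<bullet> stereo (a 1 (sph_chart p z)) \<le> 1 - \<kappa>"
        using R(2) by (intro ballI conjI sep') auto
      show "contact_ge 4 (\<lambda>w. f (sph_chart p w)) (\<lambda>w. a 1 (sph_chart p w)) (ball 0 R)"
        using m1 by (intro zero_multiplicity_contact[OF fm am(1) Do open_ball R(2)]) (auto simp: numeral_eq_enat)
      show "contact_ge 3 (\<lambda>w. f (sph_chart p w)) (\<lambda>w. a 2 (sph_chart p w)) (ball 0 R)"
        using m23 by (intro zero_multiplicity_contact[OF fm am(2) Do open_ball R(2)]) (auto simp: numeral_eq_enat)
      show "contact_ge 3 (\<lambda>w. f (sph_chart p w)) (\<lambda>w. a 3 (sph_chart p w)) (ball 0 R)"
        using m23 by (intro zero_multiplicity_contact[OF fm am(3) Do open_ball R(2)]) (auto simp: numeral_eq_enat)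
    qed (intro holo fm am)+
    then obtain P Q where PQ: "lift_on (ball 0 r) (\<lambda>w. f (sph_chart p w)) P Q"
      "\<And>z. z \<in> ball 0 (r/4) \<Longrightarrow> cmod (deriv P z * Q z - P z * deriv Q z) \<le> C * ((cmod (P z))\<^sup>2 + (cmod (Q z))\<^sup>2)"
      by blast
    show ?thesis
      by (rule stereo_lipschitz[OF PQ(1) _ Cr(1) PQ(2), of "r/4"]) (use zw \<rho> Cr in auto)
  qed
  moreover have "sph_chart p ` ball 0 \<rho> \<subseteq> D" using R(2) \<rho>(2) by (meson image_mono subset_ball subset_trans)
  ultimately show "\<exists>r L. 0 < r \<and> 0 \<le> L \<and> sph_chart p ` ball 0 r \<subseteq> D \<and>
      (\<forall>f\<in>F. \<forall>z\<in>ball 0 r. \<forall>w\<in>ball 0 r. norm (stereo (f (sph_chart p z)) - stereo (f (sph_chart p w))) \<le> L * cmod (z - w))"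
    using \<rho>(1) Cr(1) by (intro exI[of _ \<rho>] exI[of _ "2 * C + 1"]) auto
qed

end
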